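(* Let $m\ge d+2$. For every combinatorial $d$-sphere $\Delta$ with a proper $m$-coloring $\kappa$, there is a finite sequence of bistellar flips transforming $\Delta$ into the boundary of a $(d+1)$-simplex such that every intermediate complex carries a proper $m$-coloring, these colorings agree with $\kappa$ at the start, and consecutive colorings agree on all vertices common to consecutive complexes (i.e. the flips preserve vertex colors).
   Context: All simplicial complexes are finite abstract simplicial complexes. A combinatorial $d$-sphere is a simplicial complex PL homeomorphic to the boundary of a $(d+1)$-simplex. For a finite set $F$, $\overline{F}$ is the simplex of all subsets of $F$, $\partial\overline{F}$ the complex of proper subsets, $*$ the join, and $\mathrm{lk}_\Delta(A)=\{G\in\Delta: A\cap G=\emptyset, A\cup G\in\Delta\}$. Bistellar flip: if $A\in\Delta$, $B\notin\Delta$ are disjoint with $\mathrm{lk}_\Delta(A)=\partial\overline{B}$, the flip replaces $\Delta$ by $\{G\in\Delta: A\not\subseteq G\}\cup(\partial\overline{A}*\overline{B})$. A proper $m$-coloring maps vertices to $\{0,\dots,m-1\}$ with distinct colors on the endpoints of each edge. *)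

theory Defs
  imports "HOL-Analysis.Analysis"
begin

definition simplicial_complex :: "'a set set \<Rightarrow> bool" where
  "simplicial_complex \<Delta> \<longleftrightarrow> finite \<Delta> \<and> (\<forall>F\<in>\<Delta>. \<forall>G. G \<subseteq> F \<longrightarrow> G \<in> \<Delta>)"

definition vertices :: "'a set set \<Rightarrow> 'a set" where
  "vertices \<Delta> = {v. {v} \<in> \<Delta>}"

definition full_simplex :: "'a set \<Rightarrow> 'a set set" where
  "full_simplex F = Pow F"

definition simplex_boundary :: "'a set \<Rightarrow> 'a set set" where
  "simplex_boundary F = {G. G \<subset> F}"

definition join :: "'a set set \<Rightarrow> 'a set set \<Rightarrow> 'a set set" where
  "join K L = {G \<union> H | G H. G \<in> K \<and> H \<in> L}"

definition link :: "'a set set \<Rightarrow> 'a set \<Rightarrow> 'a set set" where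
  "link \<Delta> A = {G \<in> \<Delta>. A \<inter> G = {} \<and> A \<union> G \<in> \<Delta>}"

definition bistellar_flip :: "'a set set \<Rightarrow> 'a set set \<Rightarrow> bool" where
  "bistellar_flip \<Delta> \<Delta>' \<longleftrightarrow>
     (\<exists>A B. A \<in> \<Delta> \<and> B \<notin> \<Delta> \<and> A \<inter> B = {} \<and> link \<Delta> A = simplex_boundary B \<and>
        \<Delta>' = {G \<in> \<Delta>. \<not> A \<subseteq> G} \<union> join (simplex_boundary A) (full_simplex B))"

definition proper_coloring :: "nat \<Rightarrow> 'a set set \<Rightarrow> ('a \<Rightarrow> nat) \<Rightarrow> bool" where
  "proper_coloring m \<Delta> \<kappa> \<longleftrightarrow>
     (\<forall>v\<in>vertices \<Delta>. \<kappa> v < m) \<and>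
     (\<forall>u v. {u, v} \<in> \<Delta> \<and> u \<noteq> v \<longrightarrow> \<kappa> u \<noteq> \<kappa> v)"

text \<open>Standard geometric realization in the space of functions 'a \<Rightarrow> real
  (product topology): points are barycentric coordinate vectors supported on a face.\<close>
definition realization :: "'a set set \<Rightarrow> ('a \<Rightarrow> real) set" where
  "realization \<Delta> = {p. \<exists>F\<in>\<Delta>. (\<forall>v. p v \<ge> 0) \<and> (\<forall>v. v \<notin> F \<longrightarrow> p v = 0) \<and> sum p F = 1}"

definition conv_comb :: "('x \<Rightarrow> real) \<Rightarrow> ('x \<Rightarrow> ('a \<Rightarrow> real)) \<Rightarrow> 'x set \<Rightarrow> ('a \<Rightarrow> real)" where
  "conv_comb c q S = (\<lambda>v. \<Sum>s\<in>S. c s * q s v)"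

definition conv_hull_fun :: "('a \<Rightarrow> real) set \<Rightarrow> ('a \<Rightarrow> real) set" where
  "conv_hull_fun S = {conv_comb c id S | c. (\<forall>s\<in>S. c s \<ge> 0) \<and> sum c S = 1}"

definition pl_map_on :: "('a \<Rightarrow> real) set \<Rightarrow> (('a \<Rightarrow> real) \<Rightarrow> ('b \<Rightarrow> real)) \<Rightarrow> bool" where
  "pl_map_on P f \<longleftrightarrow>
     (\<exists>\<S>. finite \<S> \<and> (\<forall>S\<in>\<S>. finite S) \<and> P = \<Union> (conv_hull_fun ` \<S>) \<and>
        (\<forall>S\<in>\<S>. \<forall>c. (\<forall>s\<in>S. c s \<ge> 0) \<and> sum c S = 1 \<longrightarrow>
            f (conv_comb c id S) = conv_comb c f S))"

definition pl_homeomorphic :: "'a set set \<Rightarrow> 'b set set \<Rightarrow> bool" where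
  "pl_homeomorphic \<Delta> \<Gamma> \<longleftrightarrow>
     (\<exists>f g. homeomorphism (realization \<Delta>) (realization \<Gamma>) f g \<and>
        pl_map_on (realization \<Delta>) f \<and> pl_map_on (realization \<Gamma>) g)"

definition combinatorial_sphere :: "nat \<Rightarrow> 'a set set \<Rightarrow> bool" where
  "combinatorial_sphere d \<Delta> \<longleftrightarrow>
     simplicial_complex \<Delta> \<and> pl_homeomorphic \<Delta> (simplex_boundary {0..d+1::nat})"

end

theory Submission
  imports Defs
begin

text \<open>
  If a sphere \<open>\<Delta>\<close> bounds a shellable ball, then removing the facets of the ball in shelling order
  turns \<open>\<Delta>\<close> by bistellar flips into the boundary of the last facet. Stellar subdivisions at faces
  outside \<open>\<Delta>\<close> keep the ball shellable, and since \<open>m \<ge> d + 2\<close> enough of them make the given colouring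
  of \<open>\<Delta>\<close> extend to the whole ball, so that all flips respect it.

  To find the ball, cut \<open>\<Delta>\<close> by hyperplanes, that is by stellar subdivisions of edges, until a PL
  homeomorphism to the boundary of the simplex is affine on faces; the image spans a complete
  simplicial fan. Further cuts along all walls of this fan make it regular, hence shellable together
  with all its links. Bounding a shellable ball, for a complex and all its links, is then carried
  back along the edge subdivisions.
\<close>

text \<open>A shelling is kept as a path of pairs past and future. It can then be reversed, or run
  beside other pieces that stay unchanged, and balls are never treated as spaces. Glued balls must
  meet only where intended; subdividing unwanted faces at fresh vertices, available because the
  vertex type is infinite, arranges this. Undoing the subdivision of an edge needs a shellable ball
  bounded by the link of that edge. For an induction over subdivisions the same must be known of the
  links of the result, so the statement carried along speaks of every link. Passing from
  realizations to cones turns piecewise affine maps into piecewise linear ones. The boundary of the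
  simplex becomes a complete fan in dimension \<open>d + 1\<close>, and regularity becomes strict
  convexity of a piecewise linear function. The bound \<open>m \<ge> d + 2\<close> enters because
  the largest simplices of the ball have \<open>d + 2\<close> vertices, all of different colours.
  The intermediate spheres are subcomplexes of the ball, so one colouring of the ball serves all of
  them.\<close>

text \<open>Since no membership of \<open>F\<close> in \<open>X\<close> is required, the operation leaves \<open>X\<close> unchanged
  when \<open>F\<close> is not a face; \<open>v\<close> is meant to be a fresh vertex.\<close>

definition stellar :: "'a set set \<Rightarrow> 'a set \<Rightarrow> 'a \<Rightarrow> 'a set set" where
  "stellar X F v = {Y. \<not> F \<subseteq> Y \<and> (if v \<in> Y then (Y - {v}) \<union> F \<in> X else Y \<in> X)}"

section \<open>Shellings as paths of pairs of past and future\<close>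

text \<open>\<open>K\<close> is the past and \<open>M\<close> the future of a shelling; the current sphere is \<open>K \<inter> M\<close>. Transferring
  the simplex \<open>A \<union> B\<close> from the future to the past flips \<open>A\<close> to \<open>B\<close> in this sphere. In this
  form a shelling is reversed by exchanging past and future.\<close>

definition shelling_move :: "'a set set \<Rightarrow> 'a set set \<Rightarrow> 'a set set \<Rightarrow> 'a set set \<Rightarrow> bool" where
  "shelling_move K M K' M' \<longleftrightarrow> (\<exists>A B. finite A \<and> finite B \<and> A \<inter> B = {} \<and>
     (\<forall>H \<subseteq> A \<union> B. (H \<in> K \<longleftrightarrow> \<not> B \<subseteq> H) \<and> (H \<in> M' \<longleftrightarrow> \<not> A \<subseteq> H)) \<and>
     K' = K \<union> Pow (A \<union> B) \<and> M = M' \<union> Pow (A \<union> B))"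

lemma shelling_moveI:
  assumes "finite A" "finite B" "A \<inter> B = {}" "C = A \<union> B"
    and "\<And>H. H \<subseteq> C \<Longrightarrow> H \<in> K \<longleftrightarrow> \<not> B \<subseteq> H"
    and "\<And>H. H \<subseteq> C \<Longrightarrow> H \<in> M' \<longleftrightarrow> \<not> A \<subseteq> H"
    and "K' = K \<union> Pow C" "M = M' \<union> Pow C"
  shows "shelling_move K M K' M'"
  unfolding shelling_move_def by (intro exI[of _ A] exI[of _ B]) (use assms in auto)

lemma shelling_moveE:
  assumes "shelling_move K M K' M'"
  obtains A B where "finite A" "finite B" "A \<inter> B = {}"
    "\<And>H. H \<subseteq> A \<union> B \<Longrightarrow> H \<in> K \<longleftrightarrow> \<not> B \<subseteq> H" "\<And>H. H \<subseteq> A \<union> B \<Longrightarrow> H \<in> M' \<longleftrightarrow> \<not> A \<subseteq> H"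
    "K' = K \<union> Pow (A \<union> B)" "M = M' \<union> Pow (A \<union> B)"
  using assms unfolding shelling_move_def by auto

inductive cobordism :: "'a set set \<Rightarrow> 'a set set \<Rightarrow> 'a set set \<Rightarrow> 'a set set \<Rightarrow> bool" where
  cobordism_refl: "cobordism K M K M"
| cobordism_step: "cobordism K M K' M' \<Longrightarrow> shelling_move K' M' K'' M'' \<Longrightarrow> cobordism K M K'' M''"

lemma cobordism_of_move: "shelling_move K M K' M' \<Longrightarrow> cobordism K M K' M'"
  using cobordism_refl cobordism_step by blast

lemma cobordism_trans: "cobordism K' M' K'' M'' \<Longrightarrow> cobordism K M K' M' \<Longrightarrow> cobordism K M K'' M''"
  by (induction rule: cobordism.induct) (auto intro: cobordism_step)

lemma shelling_move_rev: "shelling_move K M K' M' \<Longrightarrow> shelling_move M' K' M K"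
proof -
  assume "shelling_move K M K' M'"
  then show ?thesis by (rule shelling_moveE) (rule shelling_moveI, auto)
qed

lemma cobordism_rev: "cobordism K M K' M' \<Longrightarrow> cobordism M' K' M K"
proof (induction rule: cobordism.induct)
  case (cobordism_step K M K' M' K'' M'')
  then show ?case using cobordism_trans cobordism_of_move shelling_move_rev by blast
qed (rule cobordism_refl)

lemma shelling_move_mono: "shelling_move K M K' M' \<Longrightarrow> K \<subseteq> K' \<and> M' \<subseteq> M \<and> K \<union> M = K' \<union> M'"
  unfolding shelling_move_def by blast

lemma cobordism_mono: "cobordism K M K' M' \<Longrightarrow> K \<subseteq> K' \<and> M' \<subseteq> M \<and> K \<union> M = K' \<union> M'"
  by (induction rule: cobordism.induct) (auto dest!: shelling_move_mono)

text \<open>\<open>X\<close> and \<open>Y\<close> stand for other pieces of a ball under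
  construction. They may sit beside a move that adds no face of \<open>X\<close> to the past and
  takes no face of \<open>Y\<close> out of the future; gluing balls comes down to this.\<close>

lemma shelling_move_frame:
  assumes "shelling_move K M K' M'" "X \<inter> K' \<subseteq> K" "Y \<inter> M \<subseteq> M'"
  shows "shelling_move (K \<union> X) (M \<union> Y) (K' \<union> X) (M' \<union> Y)"
proof -
  obtain A B where *: "finite A" "finite B" "A \<inter> B = {}"
     "\<And>H. H \<subseteq> A \<union> B \<Longrightarrow> H \<in> K \<longleftrightarrow> \<not> B \<subseteq> H" "\<And>H. H \<subseteq> A \<union> B \<Longrightarrow> H \<in> M' \<longleftrightarrow> \<not> A \<subseteq> H"
     "K' = K \<union> Pow (A \<union> B)" "M = M' \<union> Pow (A \<union> B)"
    by (rule shelling_moveE[OF assms(1)]) (rule that)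
  show ?thesis
  proof (rule shelling_moveI[OF *(1-3) refl])
    fix H assume H: "H \<subseteq> A \<union> B"
    then have "H \<in> X \<Longrightarrow> H \<in> K" "H \<in> Y \<Longrightarrow> H \<in> M'" using assms(2,3) *(6,7) by blast+
    then show "H \<in> K \<union> X \<longleftrightarrow> \<not> B \<subseteq> H" "H \<in> M' \<union> Y \<longleftrightarrow> \<not> A \<subseteq> H" using *(4,5)[OF H] by blast+
  qed (use * in auto)
qed

lemma cobordism_frame:
  assumes "cobordism K M K' M'" "X \<inter> K' \<subseteq> K" "Y \<inter> M \<subseteq> M'"
  shows "cobordism (K \<union> X) (M \<union> Y) (K' \<union> X) (M' \<union> Y)"
  using assms
proof (induction rule: cobordism.induct)
  case (cobordism_step K M K' M' K'' M'')
  note m = cobordism_mono[OF cobordism_step(1)] shelling_move_mono[OF cobordism_step(2)]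
  show ?case
  proof (rule cobordism.cobordism_step[OF cobordism_step.IH])
    show "X \<inter> K' \<subseteq> K" "Y \<inter> M \<subseteq> M'" using m cobordism_step.prems by blast+
    show "shelling_move (K' \<union> X) (M' \<union> Y) (K'' \<union> X) (M'' \<union> Y)"
      by (rule shelling_move_frame[OF cobordism_step(2)]) (use m cobordism_step.prems in blast)+
  qed
qed (rule cobordism_refl)

subsection \<open>Stellar subdivision\<close>

lemma stellar_Un: "stellar (X \<union> Y) F v = stellar X F v \<union> stellar Y F v"
  by (auto simp: stellar_def)

lemma stellar_empty [simp]: "stellar {} F v = {}"
  by (auto simp: stellar_def)

text \<open>The simplex \<open>A \<union> B\<close> is replaced by the simplices \<open>insert v (A \<union> B - {x})\<close> with \<open>x \<in> F\<close>. Those with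
  \<open>x \<in> F \<inter> B\<close> come first; the remaining ones are handled by reversal.\<close>

lemma cobordism_stellar_half:
  assumes fin: "finite A" "finite B" "A \<inter> B = {}" and v: "v \<notin> A \<union> B" and F: "F \<subseteq> A \<union> B"
    and K: "\<And>H. H \<subseteq> A \<union> B \<Longrightarrow> H \<in> K \<longleftrightarrow> \<not> B \<subseteq> H"
    and M: "\<And>H. H \<subseteq> A \<union> B \<Longrightarrow> H \<in> M \<longleftrightarrow> \<not> A \<subseteq> H"
    and T: "\<And>P. T P = {Y. Y \<subseteq> insert v (A \<union> B) \<and> \<not> P \<subseteq> Y}"
    and P: "P \<subseteq> F \<inter> B"
  shows "cobordism (stellar K F v) (stellar M F v \<union> T F) (stellar K F v \<union> T P) (stellar M F v \<union> T (F - P))"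
proof -
  have "finite P" using P fin by (meson finite_subset inf_le2)
  then show ?thesis using P
  proof (induction P)
    case empty
    have "T {} = {}" by (auto simp: T)
    then show ?case by (simp add: cobordism_refl)
  next
    case (insert x P)
    \<comment> \<open>A face of \<open>?C\<close> through \<open>v\<close> lies in
      \<open>stellar K F v\<close> iff it misses part of \<open>B - F\<close>, and in
      \<open>T P\<close> iff it misses part of \<open>P\<close>; hence the minimal new face
      \<open>?B\<close>. Its complement \<open>?A\<close> in \<open>?C\<close> consists of
      \<open>A\<close> and the vertices of \<open>F \<inter> B\<close> that still have to be
      omitted.\<close>
    let ?A = "A \<union> (F \<inter> B - P - {x})" and ?B = "insert v ((B - F) \<union> P)"
      and ?C = "insert v (A \<union> B - {x})"
    have x: "x \<in> F" "x \<in> B" "x \<notin> A" "x \<noteq> v" using insert.prems fin v by auto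
    have IH: "cobordism (stellar K F v) (stellar M F v \<union> T F) (stellar K F v \<union> T P) (stellar M F v \<union> T (F - P))"
      using insert by blast
    have "shelling_move (stellar K F v \<union> T P) (stellar M F v \<union> T (F - P))
        (stellar K F v \<union> T (insert x P)) (stellar M F v \<union> T (F - insert x P))"
    proof (rule shelling_moveI[where A = ?A and B = ?B and C = ?C])
      show "finite ?A" "finite ?B" using fin insert.hyps by auto
      show "?A \<inter> ?B = {}" using fin v insert.prems by auto
      show "?C = ?A \<union> ?B" using x fin v insert.prems insert.hyps by blast
      show "stellar K F v \<union> T (insert x P) = stellar K F v \<union> T P \<union> Pow ?C"
        using x by (auto simp: T)
      show "stellar M F v \<union> T (F - P) = stellar M F v \<union> T (F - insert x P) \<union> Pow ?C"
        using x insert.hyps by (auto simp: T)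
    next
      fix H assume H: "H \<subseteq> ?C"
      then have HF: "\<not> F \<subseteq> H" "H \<subseteq> insert v (A \<union> B)" "x \<notin> H" using x by auto
      show "H \<in> stellar K F v \<union> T P \<longleftrightarrow> \<not> ?B \<subseteq> H"
      proof (cases "v \<in> H")
        case True
        have "(H - {v}) \<union> F \<in> K \<longleftrightarrow> \<not> B \<subseteq> (H - {v}) \<union> F" by (rule K) (use HF F in auto)
        then have "H \<in> stellar K F v \<longleftrightarrow> \<not> B - F \<subseteq> H" using HF True v by (auto simp: stellar_def)
        then show ?thesis using True HF by (auto simp: T)
      next
        case False
        have "H \<in> K \<longleftrightarrow> \<not> B \<subseteq> H" by (rule K) (use HF False in auto)
        then show ?thesis using False HF x by (auto simp: stellar_def)
      qed
      show "H \<in> stellar M F v \<union> T (F - insert x P) \<longleftrightarrow> \<not> ?A \<subseteq> H"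
      proof (cases "v \<in> H")
        case True
        have "(H - {v}) \<union> F \<in> M \<longleftrightarrow> \<not> A \<subseteq> (H - {v}) \<union> F" by (rule M) (use HF F in auto)
        then have "H \<in> stellar M F v \<longleftrightarrow> \<not> A - F \<subseteq> H" using HF True v by (auto simp: stellar_def)
        moreover have "H \<in> T (F - insert x P) \<longleftrightarrow> \<not> F - insert x P \<subseteq> H" using HF by (simp add: T)
        moreover have "?A = (A - F) \<union> (F - insert x P)" using F insert.prems fin by blast
        ultimately show ?thesis by blast
      next
        case False
        have "H \<in> M \<longleftrightarrow> \<not> A \<subseteq> H" by (rule M) (use HF False in auto)
        then have "H \<in> stellar M F v \<longleftrightarrow> \<not> A \<subseteq> H" using HF False by (auto simp: stellar_def)
        moreover have "H \<in> T (F - insert x P) \<longleftrightarrow> \<not> F - insert x P \<subseteq> H" using HF by (simp add: T)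
        moreover have "?A = A \<union> (F - insert x P)" using F insert.prems fin by blast
        ultimately show ?thesis by blast
      qed
    qed
    then show ?case by (rule cobordism_step[OF IH])
  qed
qed

text \<open>If \<open>F\<close> lies in the simplex, \<open>cobordism_stellar_half\<close> first
  transfers the pieces that omit a vertex of \<open>F \<inter> B\<close>. The same lemma with past
  and future exchanged treats the pieces that omit a vertex of \<open>F \<inter> A\<close>; it stops
  at the very pair reached by the first half, so its reversal completes the path.\<close>

lemma shelling_move_stellar:
  assumes "shelling_move K M K' M'" "v \<notin> \<Union>K'"
  shows "cobordism (stellar K F v) (stellar M F v) (stellar K' F v) (stellar M' F v)"
proof -
  obtain A B where *: "finite A" "finite B" "A \<inter> B = {}"
     "\<And>H. H \<subseteq> A \<union> B \<Longrightarrow> H \<in> K \<longleftrightarrow> \<not> B \<subseteq> H" "\<And>H. H \<subseteq> A \<union> B \<Longrightarrow> H \<in> M' \<longleftrightarrow> \<not> A \<subseteq> H"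
     "K' = K \<union> Pow (A \<union> B)" "M = M' \<union> Pow (A \<union> B)"
    by (rule shelling_moveE[OF assms(1)]) (rule that)
  have v: "v \<notin> A \<union> B" using assms(2) *(6) by auto
  show ?thesis
  proof (cases "F \<subseteq> A \<union> B")
    case False
    then have P: "stellar (Pow (A \<union> B)) F v = Pow (A \<union> B)" using v by (auto simp: stellar_def)
    have "shelling_move (stellar K F v) (stellar M F v) (stellar K' F v) (stellar M' F v)"
    proof (rule shelling_moveI[OF *(1-3) refl])
      fix H assume H: "H \<subseteq> A \<union> B"
      then have "v \<notin> H" "\<not> F \<subseteq> H" using v False by auto
      then show "H \<in> stellar K F v \<longleftrightarrow> \<not> B \<subseteq> H" "H \<in> stellar M' F v \<longleftrightarrow> \<not> A \<subseteq> H"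
        using *(4,5)[OF H] by (auto simp: stellar_def)
    qed (auto simp: *(6,7) stellar_Un P)
    then show ?thesis by (rule cobordism_of_move)
  next
    case True
    define T where "T P = {Y. Y \<subseteq> insert v (A \<union> B) \<and> \<not> P \<subseteq> Y}" for P
    have P: "stellar (Pow (A \<union> B)) F v = T F"
      using v True by (auto simp: stellar_def T_def split: if_splits)
    have T': "T P = {Y. Y \<subseteq> insert v (B \<union> A) \<and> \<not> P \<subseteq> Y}" for P
      by (simp add: T_def Un_commute)
    have 1: "cobordism (stellar K F v) (stellar M' F v \<union> T F) (stellar K F v \<union> T (F \<inter> B)) (stellar M' F v \<union> T (F - F \<inter> B))"
      by (rule cobordism_stellar_half[OF *(1-3) v True *(4,5) T_def subset_refl])
    have 2: "cobordism (stellar M' F v) (stellar K F v \<union> T F) (stellar M' F v \<union> T (F \<inter> A)) (stellar K F v \<union> T (F - F \<inter> A))"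
      by (rule cobordism_stellar_half[OF *(2,1) _ _ _ _ _ T' subset_refl]) (use *(3-5) v True in \<open>auto simp: Un_commute\<close>)
    have "F - F \<inter> B = F \<inter> A" "F - F \<inter> A = F \<inter> B" using True *(3) by auto
    then show ?thesis using cobordism_trans[OF cobordism_rev[OF 2]] 1 by (simp add: *(6,7) stellar_Un P)
  qed
qed

lemma cobordism_stellar:
  assumes "cobordism K M K' M'" "v \<notin> \<Union>K'"
  shows "cobordism (stellar K F v) (stellar M F v) (stellar K' F v) (stellar M' F v)"
  using assms
proof (induction rule: cobordism.induct)
  case (cobordism_step K M K' M' K'' M'')
  have "K' \<subseteq> K''" using shelling_move_mono[OF cobordism_step(2)] by simp
  then have "v \<notin> \<Union>K'" using cobordism_step.prems by blast
  then show ?case using cobordism_step.IH shelling_move_stellar[OF cobordism_step(2) cobordism_step.prems] cobordism_trans by blast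
qed (rule cobordism_refl)

text \<open>Joining every simplex with \<open>e\<close> keeps the minimal new face \<open>B\<close>
  and enlarges \<open>A\<close> to \<open>A \<union> e\<close>. So all faces that do not contain all
  of \<open>e\<close> have to be in the future throughout, and no others may be there too long;
  \<open>N\<close> is the complex that provides this.\<close>

lemma cobordism_join:
  assumes "cobordism K M K' M'" "finite e" "\<Union>K' \<inter> e = {}" "X \<inter> K' \<subseteq> K"
    and dc: "\<And>Y Z. Y \<in> X \<Longrightarrow> Z \<subseteq> Y \<Longrightarrow> Z \<in> X"
    and N: "\<And>Y. Y \<in> N \<Longrightarrow> \<not> e \<subseteq> Y"
    and N': "\<And>Y. \<not> e \<subseteq> Y \<Longrightarrow> Y - e \<in> K' \<Longrightarrow> Y \<in> N"
  shows "cobordism (X \<union> {Y. Y - e \<in> K}) (N \<union> {Y. Y - e \<in> M}) (X \<union> {Y. Y - e \<in> K'}) (N \<union> {Y. Y - e \<in> M'})"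
  using assms(1,3,4) N'
proof (induction rule: cobordism.induct)
  case (cobordism_step K M K' M' K'' M'')
  have m: "K \<subseteq> K'" "K' \<subseteq> K''" using cobordism_mono[OF cobordism_step(1)] shelling_move_mono[OF cobordism_step(2)] by simp_all
  obtain A B where *: "finite A" "finite B" "A \<inter> B = {}"
     "\<And>H. H \<subseteq> A \<union> B \<Longrightarrow> H \<in> K' \<longleftrightarrow> \<not> B \<subseteq> H" "\<And>H. H \<subseteq> A \<union> B \<Longrightarrow> H \<in> M'' \<longleftrightarrow> \<not> A \<subseteq> H"
     "K'' = K' \<union> Pow (A \<union> B)" "M' = M'' \<union> Pow (A \<union> B)"
    by (rule shelling_moveE[OF cobordism_step(2)]) (rule that)
  have e: "(A \<union> B) \<inter> e = {}" using cobordism_step.prems(1) *(6) by auto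
  have "B \<notin> K'" using *(4)[of B] by simp
  then have BX: "B \<notin> X" using cobordism_step.prems(2) m *(6) by auto
  show ?case
  proof (rule cobordism.cobordism_step[OF cobordism_step.IH])
    show "\<Union>K' \<inter> e = {}" "X \<inter> K' \<subseteq> K" using m cobordism_step.prems by blast+
    show "Y \<in> N" if "\<not> e \<subseteq> Y" "Y - e \<in> K'" for Y
      using cobordism_step.prems(3)[OF that(1)] that(2) m(2) by blast
    show "shelling_move (X \<union> {Y. Y - e \<in> K'}) (N \<union> {Y. Y - e \<in> M'}) (X \<union> {Y. Y - e \<in> K''}) (N \<union> {Y. Y - e \<in> M''})"
    proof (rule shelling_moveI[where A = "A \<union> e" and B = B and C = "A \<union> B \<union> e"])
      fix H assume H: "H \<subseteq> A \<union> B \<union> e"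
      then have H': "H - e \<subseteq> A \<union> B" by auto
      have "H \<in> X \<Longrightarrow> \<not> B \<subseteq> H" using BX dc by blast
      moreover have "B \<subseteq> H - e \<longleftrightarrow> B \<subseteq> H" using e by auto
      ultimately show "H \<in> X \<union> {Y. Y - e \<in> K'} \<longleftrightarrow> \<not> B \<subseteq> H" using *(4)[OF H'] by auto
      show "H \<in> N \<union> {Y. Y - e \<in> M''} \<longleftrightarrow> \<not> A \<union> e \<subseteq> H"
      proof (cases "e \<subseteq> H")
        case True
        moreover have "A \<subseteq> H - e \<longleftrightarrow> A \<subseteq> H" using e by auto
        ultimately show ?thesis using *(5)[OF H'] N by auto
      next
        case False
        moreover have "H - e \<in> K''" using H' *(6) by auto
        ultimately show ?thesis using cobordism_step.prems(3) by auto
      qed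
    qed (use * assms(2) e in auto)
  qed
qed (rule cobordism_refl)

text \<open>Each simplex yields two, its cones from \<open>a\<close> and from \<open>b\<close>.
  While the first is transferred, its base still belongs to the future through the second, so
  \<open>a\<close> joins the old face \<open>A\<close>. When the second is transferred, the base is
  already in the past, so \<open>b\<close> joins the new face \<open>B\<close>.\<close>

lemma cobordism_suspension:
  assumes "cobordism K M K' M'" "a \<noteq> b" "a \<notin> \<Union>K'" "b \<notin> \<Union>K'"
  defines "S \<equiv> \<lambda>K. {Y. \<not> {a, b} \<subseteq> Y \<and> Y - {a, b} \<in> K}"
  shows "cobordism (S K) (S M) (S K') (S M')"
  using assms(1,3,4)
proof (induction rule: cobordism.induct)
  case (cobordism_step K M K' M' K'' M'')
  have m: "K \<subseteq> K'" "K' \<subseteq> K''" using cobordism_mono[OF cobordism_step(1)] shelling_move_mono[OF cobordism_step(2)] by simp_all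
  obtain A B where *: "finite A" "finite B" "A \<inter> B = {}"
     "\<And>H. H \<subseteq> A \<union> B \<Longrightarrow> H \<in> K' \<longleftrightarrow> \<not> B \<subseteq> H" "\<And>H. H \<subseteq> A \<union> B \<Longrightarrow> H \<in> M'' \<longleftrightarrow> \<not> A \<subseteq> H"
     "K'' = K' \<union> Pow (A \<union> B)" "M' = M'' \<union> Pow (A \<union> B)"
    by (rule shelling_moveE[OF cobordism_step(2)]) (rule that)
  have ab: "a \<notin> A \<union> B" "b \<notin> A \<union> B" using cobordism_step.prems *(6) by auto
  let ?a = "Pow (insert a (A \<union> B))" and ?b = "Pow (insert b (A \<union> B))"
  have SP: "S (Pow (A \<union> B)) = ?a \<union> ?b" using assms(2) ab by (auto simp: S_def)
  have SU: "S (P \<union> Q) = S P \<union> S Q" for P Q by (auto simp: S_def)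
  have 1: "shelling_move (S K') (S M'' \<union> ?b \<union> ?a) (S K' \<union> ?a) (S M'' \<union> ?b)"
  proof (rule shelling_moveI[where A = "insert a A" and B = B])
    fix H assume H: "H \<subseteq> insert a (A \<union> B)"
    have H': "H - {a, b} = H - {a}" "H - {a} \<subseteq> A \<union> B" "\<not> {a, b} \<subseteq> H" using H ab assms(2) by auto
    have "B \<subseteq> H - {a} \<longleftrightarrow> B \<subseteq> H" "A \<subseteq> H - {a} \<longleftrightarrow> A \<subseteq> H" using ab by auto
    then have e: "H \<in> S K' \<longleftrightarrow> \<not> B \<subseteq> H" "H \<in> S M'' \<longleftrightarrow> \<not> A \<subseteq> H"
      using *(4)[OF H'(2)] *(5)[OF H'(2)] H' by (simp_all add: S_def)
    then show "H \<in> S K' \<longleftrightarrow> \<not> B \<subseteq> H" by simp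
    show "H \<in> S M'' \<union> ?b \<longleftrightarrow> \<not> insert a A \<subseteq> H" using e(2) H assms(2) ab by auto
  qed (use * ab in auto)
  have 2: "shelling_move (S K' \<union> ?a) (S M'' \<union> ?b) (S K' \<union> ?a \<union> ?b) (S M'')"
  proof (rule shelling_moveI[where A = A and B = "insert b B"])
    fix H assume H: "H \<subseteq> insert b (A \<union> B)"
    have H': "H - {a, b} = H - {b}" "H - {b} \<subseteq> A \<union> B" "\<not> {a, b} \<subseteq> H" using H ab assms(2) by auto
    have "B \<subseteq> H - {b} \<longleftrightarrow> B \<subseteq> H" "A \<subseteq> H - {b} \<longleftrightarrow> A \<subseteq> H" using ab by auto
    then have e: "H \<in> S K' \<longleftrightarrow> \<not> B \<subseteq> H" "H \<in> S M'' \<longleftrightarrow> \<not> A \<subseteq> H"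
      using *(4)[OF H'(2)] *(5)[OF H'(2)] H' by (simp_all add: S_def)
    then show "H \<in> S M'' \<longleftrightarrow> \<not> A \<subseteq> H" by simp
    show "H \<in> S K' \<union> ?a \<longleftrightarrow> \<not> insert b B \<subseteq> H" using e(1) H assms(2) ab by auto
  qed (use * ab in auto)
  have IH: "cobordism (S K) (S M) (S K') (S M')"
    by (rule cobordism_step.IH) (use m cobordism_step.prems in blast)+
  have "S M' = S M'' \<union> ?b \<union> ?a" "S K'' = S K' \<union> ?a \<union> ?b" by (auto simp: *(6,7) SU SP)
  then show ?case using cobordism.cobordism_step[OF cobordism.cobordism_step[OF IH]] 1 2 by simp
qed (rule cobordism_refl)

subsection \<open>Spheres that bound shellable balls\<close>

text \<open>\<open>D\<close> is a shellable ball with boundary \<open>\<Delta>\<close>. The future becomes empty, so the last shelling_move has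
  \<open>A = {}\<close> and fills in the boundary of the simplex \<open>B\<close>.\<close>

definition bounds :: "'a set set \<Rightarrow> bool" where
  "bounds \<Delta> \<longleftrightarrow> (\<exists>D. cobordism \<Delta> D D {})"

lemma complex_mem: "simplicial_complex X \<Longrightarrow> Y \<in> X \<Longrightarrow> Z \<subseteq> Y \<Longrightarrow> Z \<in> X"
  by (auto simp: simplicial_complex_def)

lemma complex_face_finite:
  assumes "simplicial_complex X" "Y \<in> X"
  shows "finite Y"
proof -
  have "Pow Y \<subseteq> X" using assms complex_mem by blast
  then show ?thesis using assms by (metis finite_Pow_iff finite_subset simplicial_complex_def)
qed

lemma complex_Union_finite: "simplicial_complex X \<Longrightarrow> finite (\<Union>X)"
  using complex_face_finite by (metis finite_Union simplicial_complex_def)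

lemma complex_Un_Pow: "simplicial_complex K \<Longrightarrow> finite C \<Longrightarrow> simplicial_complex (K \<union> Pow C)"
  unfolding simplicial_complex_def by blast

lemma shelling_move_complex: "shelling_move K M K' M' \<Longrightarrow> simplicial_complex K \<Longrightarrow> simplicial_complex K'"
  unfolding shelling_move_def by (metis complex_Un_Pow finite_UnI)

lemma cobordism_complex: "cobordism K M K' M' \<Longrightarrow> simplicial_complex K \<Longrightarrow> simplicial_complex K'"
  by (induction rule: cobordism.induct) (auto dest: shelling_move_complex)

lemma complex_stellar:
  assumes "simplicial_complex X"
  shows "simplicial_complex (stellar X F v)"
proof -
  have "stellar X F v \<subseteq> X \<union> (\<lambda>(Z, W). insert v (Z - W)) ` (X \<times> Pow F)"
  proof
    fix Y assume Y: "Y \<in> stellar X F v"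
    show "Y \<in> X \<union> (\<lambda>(Z, W). insert v (Z - W)) ` (X \<times> Pow F)"
    proof (cases "v \<in> Y")
      case True
      let ?Z = "(Y - {v}) \<union> F"
      have "Y = insert v (?Z - (F - Y))" using True by auto
      moreover have "?Z \<in> X" using True Y by (auto simp: stellar_def)
      ultimately show ?thesis by blast
    qed (use Y in \<open>auto simp: stellar_def\<close>)
  qed
  moreover have "finite (X \<times> Pow F)" if "F \<in> X"
    using assms complex_face_finite[OF assms that] by (simp add: simplicial_complex_def)
  moreover have "stellar X F v \<subseteq> X" if "F \<notin> X"
    using that complex_mem[OF assms] by (auto simp: stellar_def split: if_splits)
  ultimately have "finite (stellar X F v)"
    using assms by (meson finite_UnI finite_imageI finite_subset simplicial_complex_def)
  moreover have "G \<in> stellar X F v" if "Y \<in> stellar X F v" "G \<subseteq> Y" for Y G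
  proof -
    have "\<not> F \<subseteq> G" using that by (auto simp: stellar_def)
    moreover have "(G - {v}) \<union> F \<in> X" if "v \<in> G"
    proof (rule complex_mem[OF assms])
      show "(Y - {v}) \<union> F \<in> X" using that \<open>Y \<in> _\<close> \<open>G \<subseteq> Y\<close> by (auto simp: stellar_def)
    qed (use \<open>G \<subseteq> Y\<close> in blast)
    moreover have "G \<in> X" if "v \<notin> G"
    proof (rule complex_mem[OF assms])
      show "(if v \<in> Y then (Y - {v}) \<union> F else Y) \<in> X" using \<open>Y \<in> _\<close> by (auto simp: stellar_def)
    qed (use that \<open>G \<subseteq> Y\<close> in auto)
    ultimately show ?thesis by (auto simp: stellar_def)
  qed
  ultimately show ?thesis unfolding simplicial_complex_def by blast
qed

lemma complex_link: "simplicial_complex X \<Longrightarrow> simplicial_complex (link X A)"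
  unfolding simplicial_complex_def link_def
  by (auto intro: finite_subset) (metis Un_mono subset_refl)

lemma stellar_id:
  assumes "simplicial_complex X" "F \<notin> X" "v \<notin> \<Union>X"
  shows "stellar X F v = X"
  using assms complex_mem[OF assms(1)] by (auto simp: stellar_def)

text \<open>An unwanted face of the ball is outside \<open>\<Delta>\<close>, so subdividing it at a
  fresh vertex leaves \<open>\<Delta>\<close> alone and keeps the shelling. The face disappears, and
  since every new face contains the fresh vertex, no new unwanted face arises.\<close>

lemma bounds_induced:
  fixes \<Delta> :: "'a set set"
  assumes inf: "infinite (UNIV :: 'a set)" and cx: "simplicial_complex \<Delta>" and V: "finite V" and b: "bounds \<Delta>"
  shows "\<exists>D. cobordism \<Delta> D D {} \<and> (\<forall>Y\<in>D. Y \<subseteq> V \<union> \<Union>\<Delta> \<longrightarrow> Y \<in> \<Delta>)"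
proof -
  let ?bad = "\<lambda>D. {Y \<in> D. Y \<subseteq> V \<union> \<Union>\<Delta> \<and> Y \<notin> \<Delta>}"
  have "cobordism \<Delta> D D {} \<Longrightarrow> ?thesis" for D
  proof (induction "card (?bad D)" arbitrary: D rule: less_induct)
    case less
    have cD: "simplicial_complex D" by (rule cobordism_complex[OF less.prems cx])
    show ?case
    proof (cases "?bad D = {}")
      case True
      then show ?thesis using less.prems by blast
    next
      case False
      then obtain F where F: "F \<in> D" "F \<subseteq> V \<union> \<Union>\<Delta>" "F \<notin> \<Delta>" by blast
      have "finite (V \<union> \<Union>\<Delta> \<union> \<Union>D)" using V cx cD complex_Union_finite by auto
      then obtain v where v: "v \<notin> V \<union> \<Union>\<Delta> \<union> \<Union>D" using inf ex_new_if_finite by metis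
      have "cobordism (stellar \<Delta> F v) (stellar D F v) (stellar D F v) (stellar {} F v)"
        by (rule cobordism_stellar[OF less.prems]) (use v in auto)
      then have c: "cobordism \<Delta> (stellar D F v) (stellar D F v) {}" using stellar_id[OF cx F(3)] v by simp
      have "?bad (stellar D F v) \<subset> ?bad D"
      proof -
        have "?bad (stellar D F v) \<subseteq> ?bad D" using v by (auto simp: stellar_def split: if_splits)
        moreover have "F \<notin> stellar D F v" by (auto simp: stellar_def)
        ultimately show ?thesis using F by blast
      qed
      moreover have "finite (?bad D)" using cD by (simp add: simplicial_complex_def)
      ultimately show ?thesis using less.hyps[OF psubset_card_mono c] by blast
    qed
  qed
  then show ?thesis using b unfolding bounds_def by blast
qed

lemma bounds_stellar:
  fixes \<Delta> :: "'a set set"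
  assumes inf: "infinite (UNIV :: 'a set)" and cx: "simplicial_complex \<Delta>" and b: "bounds \<Delta>" and v: "v \<notin> \<Union>\<Delta>"
  shows "bounds (stellar \<Delta> F v)"
proof -
  \<comment> \<open>The ball might already use the name \<open>v\<close>; making it induced with
    respect to \<open>{v}\<close> excludes this.\<close>
  obtain D where D: "cobordism \<Delta> D D {}" "\<forall>Y\<in>D. Y \<subseteq> {v} \<union> \<Union>\<Delta> \<longrightarrow> Y \<in> \<Delta>"
    using bounds_induced[OF inf cx _ b, of "{v}"] by auto
  have "v \<notin> \<Union>D"
  proof
    assume "v \<in> \<Union>D"
    then have "{v} \<in> D" using complex_mem[OF cobordism_complex[OF D(1) cx]] by blast
    then have "{v} \<in> \<Delta>" using D(2) by auto
    then show False using v by auto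
  qed
  from cobordism_stellar[OF D(1) this, of F] show ?thesis unfolding bounds_def by auto
qed

text \<open>Let \<open>D\<close> be a ball bounded by the link of the edge. Filling in the join of the edge with \<open>D\<close> leads
  from \<open>\<Sigma>\<close> to a sphere \<open>N\<close>, and filling in the cone from \<open>v\<close> over the suspension of \<open>D\<close> leads from
  the subdivision to the same \<open>N\<close>; the second shelling is traversed backwards.\<close>

lemma bounds_unsubdivide:
  fixes \<Sigma> :: "'a set set"
  assumes inf: "infinite (UNIV :: 'a set)" and cx: "simplicial_complex \<Sigma>"
    and e: "{a, b} \<in> \<Sigma>" "a \<noteq> b" and v: "v \<notin> \<Union>\<Sigma>"
    and bl: "bounds (link \<Sigma> {a, b})" and bs: "bounds (stellar \<Sigma> {a, b} v)"
  shows "bounds \<Sigma>"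
proof -
  let ?e = "{a, b}" and ?L = "link \<Sigma> {a, b}" and ?S' = "stellar \<Sigma> {a, b} v"
  have ab: "a \<in> \<Union>\<Sigma>" "b \<in> \<Union>\<Sigma>" using e by auto
  note cx' = complex_stellar[OF cx, of ?e v] and cxL = complex_link[OF cx, of ?e]
  have fin: "finite (\<Union>\<Sigma>)" by (rule complex_Union_finite[OF cx])
  have "finite (insert v (\<Union>\<Sigma>))" using fin by simp
  from bounds_induced[OF inf cxL this bl] obtain D
    where D: "cobordism ?L D D {}" and D_ind: "\<forall>Y\<in>D. Y \<subseteq> insert v (\<Union>\<Sigma>) \<union> \<Union>?L \<longrightarrow> Y \<in> ?L"
    by (elim exE conjE) (rule that)
  have D2: "Y \<in> ?L" if "Y \<in> D" "Y \<subseteq> insert v (\<Union>\<Sigma>)" for Y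
    by (rule mp[OF bspec[OF D_ind that(1)] le_supI1[OF that(2)]])
  have cxD: "simplicial_complex D" by (rule cobordism_complex[OF D cxL])
  have vD: "v \<notin> \<Union>D" "a \<notin> \<Union>D" "b \<notin> \<Union>D"
  proof -
    have "{x} \<in> ?L" if "x \<in> \<Union>D" "x \<in> insert v (\<Union>\<Sigma>)" for x
      using D2[of "{x}"] that complex_mem[OF cxD] by blast
    then show "v \<notin> \<Union>D" "a \<notin> \<Union>D" "b \<notin> \<Union>D" using ab v by (auto simp: link_def)
  qed
  have LD: "?L \<subseteq> D" using cobordism_mono[OF D] by simp
  \<comment> \<open>\<open>S K\<close> is the join of \<open>K\<close> with the two endpoints of the
    edge. In \<open>N\<close> the star of the edge is replaced by \<open>S D\<close>. The join
    \<open>J\<close> of the edge with \<open>D\<close> fills the gap between \<open>\<Sigma>\<close>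
    and \<open>N\<close>, and the cone \<open>I\<close> from \<open>v\<close> over
    \<open>S D\<close> fills the gap between \<open>?S'\<close> and \<open>N\<close>.\<close>
  define S where "S = (\<lambda>K. {Y. \<not> ?e \<subseteq> Y \<and> Y - ?e \<in> K})"
  define N where "N = {Y \<in> \<Sigma>. \<not> ?e \<subseteq> Y} \<union> S D"
  define J where "J = {Y. Y - ?e \<in> D}"
  define I where "I = {Y. Y - {v} \<in> S D}"
  have 1: "cobordism \<Sigma> (N \<union> J) (\<Sigma> \<union> J) N"
  proof -
    have "cobordism (\<Sigma> \<union> {Y. Y - ?e \<in> ?L}) (N \<union> {Y. Y - ?e \<in> D}) (\<Sigma> \<union> {Y. Y - ?e \<in> D}) (N \<union> {Y. Y - ?e \<in> {}})"
    proof (rule cobordism_join[OF D])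
      show "\<Sigma> \<inter> D \<subseteq> ?L" using D2 by blast
      show "Z \<in> \<Sigma>" if "Y \<in> \<Sigma>" "Z \<subseteq> Y" for Y Z using complex_mem[OF cx] that .
    qed (use vD in \<open>auto simp: N_def S_def\<close>)
    moreover have "Y \<in> \<Sigma>" if "Y - ?e \<in> ?L" for Y
    proof (rule complex_mem[OF cx])
      show "?e \<union> (Y - ?e) \<in> \<Sigma>" using that unfolding link_def by blast
    qed blast
    then have "\<Sigma> \<union> {Y. Y - ?e \<in> ?L} = \<Sigma>" by blast
    ultimately show ?thesis by (simp add: J_def)
  qed
  have 2: "cobordism ?S' (N \<union> I) (?S' \<union> I) N"
  proof -
    have sus: "cobordism (S ?L) (S D) (S D) (S {})" unfolding S_def by (rule cobordism_suspension[OF D e(2) vD(2,3)])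
    have "cobordism (?S' \<union> {Y. Y - {v} \<in> S ?L}) (N \<union> {Y. Y - {v} \<in> S D}) (?S' \<union> {Y. Y - {v} \<in> S D}) (N \<union> {Y. Y - {v} \<in> S {}})"
    proof (rule cobordism_join[OF sus])
      show "\<Union> (S D) \<inter> {v} = {}" using vD ab v by (auto simp: S_def)
      show "?S' \<inter> S D \<subseteq> S ?L"
      proof
        fix Y assume Y: "Y \<in> ?S' \<inter> S D"
        then have "v \<notin> Y" using vD ab v by (auto simp: S_def)
        then have "Y \<in> \<Sigma>" using Y by (auto simp: stellar_def)
        then have "Y - ?e \<in> ?L" using Y D2[of "Y - ?e"] by (auto simp: S_def)
        then show "Y \<in> S ?L" using Y by (auto simp: S_def)
      qed
      show "Z \<in> ?S'" if "Y \<in> ?S'" "Z \<subseteq> Y" for Y Z using complex_mem[OF cx'] that .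
      show "\<not> {v} \<subseteq> Y" if "Y \<in> N" for Y using that vD ab v by (auto simp: N_def S_def)
      show "Y \<in> N" if "\<not> {v} \<subseteq> Y" "Y - {v} \<in> S D" for Y using that by (auto simp: N_def)
    qed auto
    moreover have "Y \<in> ?S'" if "Y - {v} \<in> S ?L" for Y
    proof -
      have Y: "\<not> ?e \<subseteq> Y" "Y - {v} - ?e \<in> ?L" using that ab v by (auto simp: S_def)
      have *: "(Y - {v}) \<union> ?e \<in> \<Sigma>"
      proof (rule complex_mem[OF cx])
        show "?e \<union> (Y - {v} - ?e) \<in> \<Sigma>" using Y(2) unfolding link_def by blast
      qed blast
      then have "Y - {v} \<in> \<Sigma>" using complex_mem[OF cx] by blast
      then show ?thesis using Y(1) * by (auto simp: stellar_def)
    qed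
    then have "?S' \<union> {Y. Y - {v} \<in> S ?L} = ?S'" by blast
    moreover have "S {} = {}" by (simp add: S_def)
    ultimately show ?thesis by (simp add: I_def)
  qed
  \<comment> \<open>Being induced on all vertices used so far, \<open>D'\<close> meets
    \<open>N\<close>, \<open>J\<close> and \<open>I\<close> only in faces of the subdivided
    sphere.\<close>
  let ?V = "\<Union>\<Sigma> \<union> \<Union>D \<union> {v}"
  have "finite ?V" using fin complex_Union_finite[OF cxD] by simp
  from bounds_induced[OF inf cx' this bs] obtain D'
    where D': "cobordism ?S' D' D' {}" and D'_ind: "\<forall>Y\<in>D'. Y \<subseteq> ?V \<union> \<Union>?S' \<longrightarrow> Y \<in> ?S'"
    by (elim exE conjE) (rule that)
  have D2': "Y \<in> ?S'" if "Y \<in> D'" "Y \<subseteq> ?V" for Y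
    by (rule mp[OF bspec[OF D'_ind that(1)] le_supI1[OF that(2)]])
  have S'D': "?S' \<subseteq> D'" using cobordism_mono[OF D'] by simp
  have SD_V: "\<And>Y. Y \<in> S D \<Longrightarrow> Y \<subseteq> ?V" using ab by (auto simp: S_def)
  have N_V: "\<And>Y. Y \<in> N \<Longrightarrow> Y \<subseteq> ?V" using SD_V by (auto simp: N_def)
  have J_V: "\<And>Y. Y \<in> J \<Longrightarrow> Y \<subseteq> ?V" using ab by (auto simp: J_def)
  have I_V: "\<And>Y. Y \<in> I \<Longrightarrow> Y \<subseteq> ?V" using SD_V by (auto simp: I_def)
  have N_v: "\<And>Y. Y \<in> N \<Longrightarrow> v \<notin> Y" using vD ab v by (auto simp: N_def S_def)
  have J_v: "\<And>Y. Y \<in> J \<Longrightarrow> v \<notin> Y" using vD ab v by (auto simp: J_def)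
  have S_v: "\<And>Y. Y \<in> \<Sigma> \<Longrightarrow> v \<notin> Y" using v by auto
  have SN: "\<And>Y. Y \<in> ?S' \<Longrightarrow> v \<notin> Y \<Longrightarrow> Y \<in> N" by (auto simp: stellar_def N_def)
  have IN: "\<And>Y. Y \<in> I \<Longrightarrow> v \<notin> Y \<Longrightarrow> Y \<in> N" by (auto simp: I_def N_def)
  \<comment> \<open>The three cobordisms are now run one after the other in the common ball: the
    pieces still to come stay in the future and those already filled stay in the past.\<close>
  have c1: "cobordism (\<Sigma> \<union> {}) (N \<union> J \<union> (?S' \<union> I \<union> D')) (\<Sigma> \<union> J \<union> {}) (N \<union> (?S' \<union> I \<union> D'))"
  proof (rule cobordism_frame[OF 1])
    show "(?S' \<union> I \<union> D') \<inter> (N \<union> J) \<subseteq> N"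
    proof
      fix Y assume Y: "Y \<in> (?S' \<union> I \<union> D') \<inter> (N \<union> J)"
      then have *: "Y \<subseteq> ?V" "v \<notin> Y" using N_V J_V N_v J_v by (metis IntD2 UnE)+
      have "Y \<in> ?S' \<or> Y \<in> I" using Y D2'[OF _ *(1)] by (metis IntD1 UnE)
      then show "Y \<in> N" using SN IN *(2) by metis
    qed
  qed simp
  have c2: "cobordism (N \<union> (\<Sigma> \<union> J)) (?S' \<union> I \<union> D') (N \<union> I \<union> (\<Sigma> \<union> J)) (?S' \<union> D')"
  proof (rule cobordism_frame[OF cobordism_rev[OF 2]])
    show "(\<Sigma> \<union> J) \<inter> (N \<union> I) \<subseteq> N"
    proof
      fix Y assume Y: "Y \<in> (\<Sigma> \<union> J) \<inter> (N \<union> I)"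
      then have "v \<notin> Y" using J_v S_v by (metis IntD1 UnE)
      then show "Y \<in> N" using Y IN by (metis IntD2 UnE)
    qed
    show "D' \<inter> (?S' \<union> I) \<subseteq> ?S'"
    proof
      fix Y assume Y: "Y \<in> D' \<inter> (?S' \<union> I)"
      then show "Y \<in> ?S'" using D2'[OF _ I_V] by (metis IntD1 IntD2 UnE)
    qed
  qed
  have c3: "cobordism (?S' \<union> (N \<union> I \<union> (\<Sigma> \<union> J))) (D' \<union> {}) (D' \<union> (N \<union> I \<union> (\<Sigma> \<union> J))) ({} \<union> {})"
  proof (rule cobordism_frame[OF D'])
    have S_V: "\<And>Y. Y \<in> \<Sigma> \<Longrightarrow> Y \<subseteq> ?V" by auto
    show "(N \<union> I \<union> (\<Sigma> \<union> J)) \<inter> D' \<subseteq> ?S'"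
    proof
      fix Y assume Y: "Y \<in> (N \<union> I \<union> (\<Sigma> \<union> J)) \<inter> D'"
      then have "Y \<subseteq> ?V" using N_V I_V J_V S_V by (metis IntD1 UnE)
      then show "Y \<in> ?S'" using Y D2' by (metis IntD2)
    qed
  qed simp
  have NJ: "N \<subseteq> \<Sigma> \<union> J" by (auto simp: N_def S_def J_def)
  have NS: "N \<subseteq> ?S' \<union> I"
  proof
    fix Y assume Y: "Y \<in> N"
    then have "v \<notin> Y" "Y - {v} = Y" using N_v by auto
    then show "Y \<in> ?S' \<union> I" using Y by (auto simp: N_def I_def stellar_def)
  qed
  have SI: "?S' \<subseteq> N \<union> I"
  proof
    fix Y assume Y: "Y \<in> ?S'"
    show "Y \<in> N \<union> I"
    proof (cases "v \<in> Y")
      case True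
      then have *: "\<not> ?e \<subseteq> Y" "(Y - {v}) \<union> ?e \<in> \<Sigma>" using Y by (auto simp: stellar_def)
      then have "Y - {v} - ?e \<in> ?L"
      proof -
        have "?e \<union> (Y - {v} - ?e) = (Y - {v}) \<union> ?e" by blast
        then have "?e \<union> (Y - {v} - ?e) \<in> \<Sigma>" using *(2) by simp
        moreover have "Y - {v} - ?e \<in> \<Sigma>" by (rule complex_mem[OF cx *(2)]) blast
        ultimately show ?thesis unfolding link_def by blast
      qed
      then show ?thesis using * LD by (auto simp: I_def S_def)
    qed (use Y SN in auto)
  qed
  have SJ: "\<Sigma> \<subseteq> N \<union> J"
  proof
    fix Y assume Y: "Y \<in> \<Sigma>"
    show "Y \<in> N \<union> J"
    proof (cases "?e \<subseteq> Y")
      case True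
      then have "?e \<union> (Y - ?e) = Y" by auto
      then have "?e \<union> (Y - ?e) \<in> \<Sigma>" using Y by simp
      moreover have "Y - ?e \<in> \<Sigma>" by (rule complex_mem[OF cx Y]) blast
      ultimately have "Y - ?e \<in> ?L" unfolding link_def by blast
      then show ?thesis using LD by (auto simp: J_def)
    qed (use Y in \<open>auto simp: N_def\<close>)
  qed
  let ?M = "N \<union> J \<union> (?S' \<union> I \<union> D')"
  have s1: "cobordism \<Sigma> ?M (\<Sigma> \<union> J) (?S' \<union> I \<union> D')"
  proof -
    have "N \<union> (?S' \<union> I \<union> D') = ?S' \<union> I \<union> D'" using NS by blast
    then show ?thesis using c1 by simp
  qed
  have s2: "cobordism (\<Sigma> \<union> J) (?S' \<union> I \<union> D') (N \<union> I \<union> (\<Sigma> \<union> J)) D'"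
  proof -
    have "N \<union> (\<Sigma> \<union> J) = \<Sigma> \<union> J" "?S' \<union> D' = D'" using NJ S'D' by blast+
    then show ?thesis using c2 by simp
  qed
  have s3: "cobordism (N \<union> I \<union> (\<Sigma> \<union> J)) D' (D' \<union> (N \<union> I \<union> (\<Sigma> \<union> J))) {}"
  proof -
    have "?S' \<union> (N \<union> I \<union> (\<Sigma> \<union> J)) = N \<union> I \<union> (\<Sigma> \<union> J)" using SI by blast
    then show ?thesis using c3 by simp
  qed
  have "cobordism \<Sigma> ?M (D' \<union> (N \<union> I \<union> (\<Sigma> \<union> J))) {}"
    using cobordism_trans[OF s3 cobordism_trans[OF s2 s1]] .
  moreover have "D' \<union> (N \<union> I \<union> (\<Sigma> \<union> J)) = ?M" using SJ S'D' by blast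
  ultimately show ?thesis unfolding bounds_def by auto
qed

section \<open>Undoing edge subdivisions in all links\<close>

definition good :: "'a set set \<Rightarrow> bool" where
  "good \<Sigma> \<longleftrightarrow> (\<forall>\<tau>\<in>\<Sigma>. bounds (link \<Sigma> \<tau>))"

text \<open>The cases are how \<open>\<tau>\<close> meets the edge. If it contains the edge, its
  link is also the link of \<open>insert v (\<tau> - {a})\<close> in the subdivision. If it contains
  one endpoint and is joined to the other endpoint \<open>y\<close>, the subdivision merely renames
  \<open>y\<close> to \<open>v\<close> in the link; a renaming is a stellar subdivision of a vertex,
  and a second one undoes it. If it avoids the edge but is joined to it, the link itself is
  subdivided at the same edge and \<open>bounds_unsubdivide\<close> applies. In the remaining case
  the link does not change.\<close>

lemma good_unsubdivide:
  fixes \<Sigma> :: "'a set set"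
  assumes inf: "infinite (UNIV :: 'a set)" and cx: "simplicial_complex \<Sigma>"
    and e: "{a, b} \<in> \<Sigma>" "a \<noteq> b" and v: "v \<notin> \<Union>\<Sigma>" and g: "good (stellar \<Sigma> {a, b} v)"
  shows "good \<Sigma>"
  unfolding good_def
proof
  fix \<tau> assume \<tau>: "\<tau> \<in> \<Sigma>"
  let ?e = "{a, b}" and ?S' = "stellar \<Sigma> {a, b} v"
  have ab: "a \<noteq> v" "b \<noteq> v" using e v by auto
  have v\<tau>: "v \<notin> \<tau>" using \<tau> v by auto
  have sub: "\<And>Y Z. Y \<in> \<Sigma> \<Longrightarrow> Z \<subseteq> Y \<Longrightarrow> Z \<in> \<Sigma>" using complex_mem[OF cx] .
  have vS: "\<And>Y. Y \<in> \<Sigma> \<Longrightarrow> v \<notin> Y" using v by auto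
  have g': "bounds (link ?S' \<rho>)" if "\<rho> \<in> ?S'" for \<rho> using g that by (simp add: good_def)
  have b: "bounds (link \<Sigma> \<rho>)" if "\<rho> \<in> \<Sigma>" "?e \<subseteq> \<rho>" for \<rho>
  proof -
    let ?r = "insert v (\<rho> - {a})"
    have v\<rho>: "v \<notin> \<rho>" using vS that by blast
    have "Y \<in> link ?S' ?r \<longleftrightarrow> Y \<in> link \<Sigma> \<rho>" for Y
    proof (cases "v \<notin> Y \<and> a \<notin> Y")
      case True
      have u: "(?r \<union> Y) - {v} \<union> ?e = \<rho> \<union> Y" using that True v\<rho> by auto
      have n: "\<not> ?e \<subseteq> ?r \<union> Y" "\<not> ?e \<subseteq> Y" "?r \<inter> Y = {} \<longleftrightarrow> \<rho> \<inter> Y = {}" using True e ab by auto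
      show ?thesis unfolding link_def stellar_def mem_Collect_eq u using n True by auto
    next
      case False
      then have "Y \<notin> link \<Sigma> \<rho>" using that vS by (auto simp: link_def)
      moreover have "Y \<notin> link ?S' ?r" using False that e(2) by (auto simp: link_def stellar_def)
      ultimately show ?thesis by simp
    qed
    then have "link ?S' ?r = link \<Sigma> \<rho>" by blast
    moreover have "?r - {v} \<union> ?e = \<rho>" using that v\<rho> by auto
    then have "?r \<in> ?S'" using that ab e by (auto simp: stellar_def)
    ultimately show ?thesis using g' by metis
  qed
  have c: "bounds (link \<Sigma> \<tau>)" if ac: "{a, b} = {x, y}" "x \<in> \<tau>" "y \<notin> \<tau>" "\<tau> \<union> ?e \<in> \<Sigma>" for x y
  proof -
    let ?L = "link \<Sigma> \<tau>"
    have xy: "x \<noteq> v" "y \<noteq> v" "x \<noteq> y" using ac(1) ab e by auto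
    have L: "link ?S' \<tau> = stellar ?L {y} v"
    proof (rule set_eqI)
      fix Y
      show "Y \<in> link ?S' \<tau> \<longleftrightarrow> Y \<in> stellar ?L {y} v"
      proof (cases "y \<in> Y \<or> \<tau> \<inter> Y \<noteq> {}")
        case True
        then have "Y \<notin> link ?S' \<tau>" using ac by (auto simp: link_def stellar_def)
        moreover have "Y \<notin> stellar ?L {y} v" using True v\<tau> by (auto simp: link_def stellar_def split: if_splits)
        ultimately show ?thesis by simp
      next
        case False
        then have F: "y \<notin> Y" "\<tau> \<inter> Y = {}" "x \<notin> Y" using ac(2) by auto
        have nF: "\<not> ?e \<subseteq> \<tau> \<union> Y" "\<not> ?e \<subseteq> Y" unfolding ac(1) using F ac(3) by auto
        show ?thesis
        proof (cases "v \<in> Y")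
          case True
          have 1: "(\<tau> \<union> Y) - {v} \<union> ?e = \<tau> \<union> ((Y - {v}) \<union> {y})" unfolding ac(1) using v\<tau> ac(2) by auto
          have 2: "(Y - {v}) \<union> ?e \<subseteq> \<tau> \<union> ((Y - {v}) \<union> {y})" "(Y - {v}) \<union> {y} \<subseteq> \<tau> \<union> ((Y - {v}) \<union> {y})"
            unfolding ac(1) using ac(2) by auto
          have "Y \<in> link ?S' \<tau> \<longleftrightarrow> \<tau> \<union> ((Y - {v}) \<union> {y}) \<in> \<Sigma>"
            unfolding link_def stellar_def mem_Collect_eq 1 using nF True F(2) sub[OF _ 2(1)] by auto
          moreover have 3: "\<tau> \<inter> ((Y - {v}) \<union> {y}) = {}" using F ac(3) by auto
          have "Y \<in> stellar ?L {y} v \<longleftrightarrow> \<tau> \<union> ((Y - {v}) \<union> {y}) \<in> \<Sigma>"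
            unfolding link_def stellar_def mem_Collect_eq using 3 F True sub[OF _ 2(2)] by auto
          ultimately show ?thesis by simp
        next
          case False
          then show ?thesis unfolding link_def stellar_def mem_Collect_eq using nF F v\<tau> by auto
        qed
      qed
    qed
    have "\<tau> \<in> ?S'" using \<tau> v\<tau> ac(1,3) by (auto simp: stellar_def)
    from g'[OF this] have bL: "bounds (stellar ?L {y} v)" unfolding L .
    have cxL: "simplicial_complex ?L" by (rule complex_link[OF cx])
    have "bounds (stellar (stellar ?L {y} v) {v} y)"
    proof (rule bounds_stellar[OF inf complex_stellar[OF cxL] bL])
      show "y \<notin> \<Union> (stellar ?L {y} v)" by (auto simp: stellar_def)
    qed
    moreover have "stellar (stellar ?L {y} v) {v} y = ?L"
    proof (rule set_eqI)
      fix Y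
      have vL: "v \<in> Y \<Longrightarrow> Y \<notin> ?L" using vS by (auto simp: link_def)
      show "Y \<in> stellar (stellar ?L {y} v) {v} y \<longleftrightarrow> Y \<in> ?L"
      proof (cases "v \<in> Y")
        case False
        then have "y \<in> Y \<Longrightarrow> (Y - {y} \<union> {v}) - {v} \<union> {y} = Y" by auto
        then show ?thesis using False xy by (auto simp: stellar_def)
      qed (use vL in \<open>auto simp: stellar_def\<close>)
    qed
    ultimately show ?thesis by simp
  qed
  show "bounds (link \<Sigma> \<tau>)"
  proof (cases "\<tau> \<union> ?e \<in> \<Sigma>")
    case False
    then have ne: "\<not> ?e \<subseteq> \<tau>" using \<tau> by (metis sup.absorb1)
    have "link ?S' \<tau> = link \<Sigma> \<tau>"
    proof (rule set_eqI)
      fix Y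
      show "Y \<in> link ?S' \<tau> \<longleftrightarrow> Y \<in> link \<Sigma> \<tau>"
      proof (cases "v \<in> Y")
        case True
        then have "Y \<notin> link \<Sigma> \<tau>" using vS by (auto simp: link_def)
        moreover have "Y \<notin> link ?S' \<tau>"
        proof
          assume "Y \<in> link ?S' \<tau>"
          then have "(\<tau> \<union> Y) - {v} \<union> ?e \<in> \<Sigma>" using True by (auto simp: link_def stellar_def)
          then have "\<tau> \<union> ?e \<in> \<Sigma>" by (rule sub) (use v\<tau> in auto)
          then show False using False by simp
        qed
        ultimately show ?thesis by simp
      next
        case vY: False
        have "\<not> ?e \<subseteq> \<tau> \<union> Y" if "\<tau> \<union> Y \<in> \<Sigma>"
          using False sub[OF that, of "\<tau> \<union> ?e"] by blast
        then show ?thesis using vY v\<tau> by (auto simp: link_def stellar_def)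
      qed
    qed
    moreover have "\<tau> \<in> ?S'" using \<tau> v\<tau> ne by (simp add: stellar_def)
    ultimately show ?thesis using g' by metis
  next
    case True
    consider "?e \<subseteq> \<tau>" | "a \<in> \<tau>" "b \<notin> \<tau>" | "b \<in> \<tau>" "a \<notin> \<tau>" | "a \<notin> \<tau>" "b \<notin> \<tau>" by blast
    then show ?thesis
    proof cases
      case 1 then show ?thesis using b \<tau> by blast
    next
      case 2 then show ?thesis using c[of a b] True by blast
    next
      case 3 then show ?thesis using c[of b a] True by blast
    next
      case 4
      let ?L = "link \<Sigma> \<tau>"
      have cxL: "simplicial_complex ?L" by (rule complex_link[OF cx])
      have eL: "?e \<in> ?L" using 4 True e by (auto simp: link_def)
      have "link ?L ?e = link \<Sigma> (\<tau> \<union> ?e)"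
      proof (rule set_eqI)
        fix Y
        have te: "\<tau> \<inter> ?e = {}" using 4 by simp
        have u: "\<tau> \<union> (?e \<union> Y) = \<tau> \<union> ?e \<union> Y" by auto
        have s: "\<tau> \<union> ?e \<union> Y \<in> \<Sigma> \<Longrightarrow> Y \<in> \<Sigma> \<and> \<tau> \<union> Y \<in> \<Sigma> \<and> ?e \<union> Y \<in> \<Sigma>"
          by (intro conjI; erule sub) blast+
        have i: "\<tau> \<inter> (?e \<union> Y) = {} \<longleftrightarrow> \<tau> \<inter> Y = {}" "(\<tau> \<union> ?e) \<inter> Y = {} \<longleftrightarrow> \<tau> \<inter> Y = {} \<and> ?e \<inter> Y = {}"
          using te by blast+
        show "Y \<in> link ?L ?e \<longleftrightarrow> Y \<in> link \<Sigma> (\<tau> \<union> ?e)"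
          unfolding link_def mem_Collect_eq u i using s by meson
      qed
      then have b1: "bounds (link ?L ?e)" using b[OF True] by simp
      have "link ?S' \<tau> = stellar ?L ?e v"
      proof (rule set_eqI)
        fix Y
        have eY: "?e \<subseteq> \<tau> \<union> Y \<longleftrightarrow> ?e \<subseteq> Y" using 4 by auto
        show "Y \<in> link ?S' \<tau> \<longleftrightarrow> Y \<in> stellar ?L ?e v"
        proof (cases "v \<in> Y")
          case True
          have 1: "(\<tau> \<union> Y) - {v} \<union> ?e = \<tau> \<union> ((Y - {v}) \<union> ?e)" using v\<tau> by auto
          have 2: "(Y - {v}) \<union> ?e \<subseteq> \<tau> \<union> ((Y - {v}) \<union> ?e)" by auto
          have 3: "\<tau> \<inter> ((Y - {v}) \<union> ?e) = {} \<longleftrightarrow> \<tau> \<inter> Y = {}" using 4 v\<tau> by auto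
          have "Y \<in> link ?S' \<tau> \<longleftrightarrow> \<tau> \<inter> Y = {} \<and> \<not> ?e \<subseteq> Y \<and> \<tau> \<union> ((Y - {v}) \<union> ?e) \<in> \<Sigma>"
            unfolding link_def stellar_def mem_Collect_eq eY 1 using True sub[OF _ 2] by auto
          moreover have "Y \<in> stellar ?L ?e v \<longleftrightarrow> \<tau> \<inter> Y = {} \<and> \<not> ?e \<subseteq> Y \<and> \<tau> \<union> ((Y - {v}) \<union> ?e) \<in> \<Sigma>"
            unfolding link_def stellar_def mem_Collect_eq 3 using True sub[OF _ 2] by auto
          ultimately show ?thesis by simp
        next
          case False
          then show ?thesis using v\<tau> unfolding link_def stellar_def mem_Collect_eq eY by auto
        qed
      qed
      moreover have "\<tau> \<in> ?S'" using \<tau> v\<tau> 4 by (simp add: stellar_def)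
      ultimately have b2: "bounds (stellar ?L ?e v)" using g' by metis
      have "v \<notin> \<Union>?L" using v by (auto simp: link_def)
      then show ?thesis by (rule bounds_unsubdivide[OF inf cxL eL e(2) _ b1 b2])
    qed
  qed
qed

section \<open>From two-sided shellings of a sphere to shellable balls\<close>

text \<open>The order by decreasing \<open>\<rho>\<close> and its reverse are both shellings, with complementary restriction
  faces \<open>R F\<close> and \<open>F - R F\<close>; ties of \<open>\<rho>\<close> may be broken arbitrarily.\<close>

locale bishelling =
  fixes \<F> :: "'a set set" and \<rho> :: "'a set \<Rightarrow> real" and R :: "'a set \<Rightarrow> 'a set"
  assumes fin: "finite \<F>" "\<And>F. F \<in> \<F> \<Longrightarrow> finite F" "\<And>F. F \<in> \<F> \<Longrightarrow> R F \<subseteq> F"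
    and C1: "\<And>F F'. F \<in> \<F> \<Longrightarrow> F' \<in> \<F> \<Longrightarrow> F \<noteq> F' \<Longrightarrow> R F \<subseteq> F' \<Longrightarrow> \<rho> F' < \<rho> F"
    and C2: "\<And>F F'. F \<in> \<F> \<Longrightarrow> F' \<in> \<F> \<Longrightarrow> F \<noteq> F' \<Longrightarrow> F - R F \<subseteq> F' \<Longrightarrow> \<rho> F < \<rho> F'"
    and C3: "\<And>F x. F \<in> \<F> \<Longrightarrow> x \<in> R F \<Longrightarrow> \<exists>F'\<in>\<F>. F - {x} \<subseteq> F' \<and> \<rho> F < \<rho> F'"
    and C4: "\<And>F x. F \<in> \<F> \<Longrightarrow> x \<in> F - R F \<Longrightarrow> \<exists>F'\<in>\<F>. F - {x} \<subseteq> F' \<and> \<rho> F' < \<rho> F"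

text \<open>The ball is the cone over the sphere from a fresh point \<open>w\<close>, filled facet
  by facet with decreasing \<open>\<rho>\<close>. For the next facet \<open>F\<close>, conditions
  \<open>C1\<close> and \<open>C3\<close> determine which of its faces lie in earlier facets, and
  \<open>C2\<close> and \<open>C4\<close> which lie in later ones.\<close>

lemma bishelling_bounds:
  fixes \<F> :: "'a set set"
  assumes inf: "infinite (UNIV :: 'a set)" and bs: "bishelling \<F> \<rho> R"
  shows "bounds (\<Union>F\<in>\<F>. Pow F)"
proof -
  interpret bishelling \<F> \<rho> R by (rule bs)
  have "finite (\<Union>\<F>)" using fin by auto
  then obtain w where w: "w \<notin> \<Union>\<F>" using inf ex_new_if_finite by metis
  let ?S = "\<Union>F\<in>\<F>. Pow F" and ?D = "\<lambda>U. \<Union>F\<in>U. Pow (insert w F)"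
  have "n \<le> card \<F> \<Longrightarrow> \<exists>U\<subseteq>\<F>. card U = n \<and> (\<forall>F\<in>U. \<forall>F'\<in>\<F>. \<rho> F < \<rho> F' \<longrightarrow> F' \<in> U) \<and>
      cobordism ?S (?D \<F>) (?S \<union> ?D U) (?D (\<F> - U))" for n
  proof (induction n)
    case 0
    show ?case by (rule exI[of _ "{}"]) (auto intro: cobordism_refl)
  next
    case (Suc n)
    then obtain U where U: "U \<subseteq> \<F>" "card U = n" "\<forall>F\<in>U. \<forall>F'\<in>\<F>. \<rho> F < \<rho> F' \<longrightarrow> F' \<in> U"
      "cobordism ?S (?D \<F>) (?S \<union> ?D U) (?D (\<F> - U))" by auto
    have "finite (\<F> - U)" "\<F> - U \<noteq> {}" using fin(1) U(1,2) Suc.prems by auto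
    obtain F where F: "F \<in> \<F> - U" "\<forall>F'\<in>\<F> - U. \<rho> F' \<le> \<rho> F"
    proof
      show "arg_min_on (\<lambda>F. - \<rho> F) (\<F> - U) \<in> \<F> - U"
        by (rule arg_min_if_finite) fact+
      show "\<forall>F'\<in>\<F> - U. \<rho> F' \<le> \<rho> (arg_min_on (\<lambda>F. - \<rho> F) (\<F> - U))"
        using arg_min_if_finite(2)[OF \<open>finite (\<F> - U)\<close> \<open>\<F> - U \<noteq> {}\<close>, of "\<lambda>F. - \<rho> F"] by force
    qed
    have hi: "(\<exists>F'\<in>U. H \<subseteq> F') \<longleftrightarrow> \<not> R F \<subseteq> H" if H: "H \<subseteq> F" for H
    proof
      assume "\<exists>F'\<in>U. H \<subseteq> F'"
      then obtain F' where F': "F' \<in> U" "H \<subseteq> F'" by blast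
      show "\<not> R F \<subseteq> H"
      proof
        assume "R F \<subseteq> H"
        then have "\<rho> F' < \<rho> F" using C1[of F F'] F F' U(1) by blast
        then show False using U(3) F F' by blast
      qed
    next
      assume "\<not> R F \<subseteq> H"
      then obtain x where x: "x \<in> R F" "x \<notin> H" by blast
      then obtain F' where "F' \<in> \<F>" "F - {x} \<subseteq> F'" "\<rho> F < \<rho> F'" using C3[of F x] F by blast
      moreover have "F' \<in> U" using calculation F by (metis DiffI linorder_not_le)
      ultimately show "\<exists>F'\<in>U. H \<subseteq> F'" using H x by blast
    qed
    have lo: "(\<exists>F'\<in>\<F> - insert F U. H \<subseteq> F') \<longleftrightarrow> \<not> F - R F \<subseteq> H" if H: "H \<subseteq> F" for H
    proof
      assume "\<exists>F'\<in>\<F> - insert F U. H \<subseteq> F'"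
      then obtain F' where F': "F' \<in> \<F> - insert F U" "H \<subseteq> F'" by blast
      show "\<not> F - R F \<subseteq> H"
      proof
        assume "F - R F \<subseteq> H"
        then have "\<rho> F < \<rho> F'" using C2[of F F'] F F' by blast
        then show False using F F' by force
      qed
    next
      assume "\<not> F - R F \<subseteq> H"
      then obtain x where x: "x \<in> F - R F" "x \<notin> H" by blast
      then obtain F' where "F' \<in> \<F>" "F - {x} \<subseteq> F'" "\<rho> F' < \<rho> F" using C4[of F x] F by blast
      moreover have "F' \<notin> U" "F' \<noteq> F" using calculation F U(3) by auto
      ultimately show "\<exists>F'\<in>\<F> - insert F U. H \<subseteq> F'" using H x by blast
    qed
    have FF: "F \<in> \<F>" using F by simp
    have wF: "w \<notin> F'" if "F' \<in> \<F>" for F' using w that by auto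
    have "shelling_move (?S \<union> ?D U) (?D (\<F> - U)) (?S \<union> ?D (insert F U)) (?D (\<F> - insert F U))"
    \<comment> \<open>The base \<open>F\<close> of the cone belongs to the sphere and so to the past
      from the beginning; hence the minimal new face contains \<open>w\<close>.\<close>
    proof (rule shelling_moveI[where A = "F - R F" and B = "insert w (R F)" and C = "insert w F"])
      show "finite (F - R F)" "finite (insert w (R F))"
        using fin(2,3)[OF FF] by (auto intro: finite_subset)
      show "(F - R F) \<inter> insert w (R F) = {}" using wF[OF FF] by auto
      show "insert w F = F - R F \<union> insert w (R F)" using fin(3)[OF FF] by auto
      show "?S \<union> ?D (insert F U) = ?S \<union> ?D U \<union> Pow (insert w F)" by auto
      show "?D (\<F> - U) = ?D (\<F> - insert F U) \<union> Pow (insert w F)" using F(1) by blast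
    next
      fix H assume H: "H \<subseteq> insert w F"
      have H': "H - {w} \<subseteq> F" using H by auto
      have sw: "H \<subseteq> insert w F' \<longleftrightarrow> H - {w} \<subseteq> F'" for F' by auto
      have RH: "R F \<subseteq> H - {w} \<longleftrightarrow> R F \<subseteq> H" "F - R F \<subseteq> H - {w} \<longleftrightarrow> F - R F \<subseteq> H"
        using wF[OF FF] fin(3)[OF FF] by auto
      have "H \<in> ?S \<longleftrightarrow> w \<notin> H" using H FF wF by auto
      moreover have "H \<in> ?D U \<longleftrightarrow> \<not> R F \<subseteq> H" using hi[OF H'] by (simp add: sw RH)
      ultimately show "H \<in> ?S \<union> ?D U \<longleftrightarrow> \<not> insert w (R F) \<subseteq> H" by blast
      show "H \<in> ?D (\<F> - insert F U) \<longleftrightarrow> \<not> F - R F \<subseteq> H"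
        using lo[OF H'] RH(2) by (simp add: sw)
    qed
    then have "cobordism ?S (?D \<F>) (?S \<union> ?D (insert F U)) (?D (\<F> - insert F U))" by (rule cobordism_step[OF U(4)])
    moreover have "insert F U \<subseteq> \<F>" "card (insert F U) = Suc n"
      using U(1,2) F finite_subset[OF U(1) fin(1)] by auto
    moreover have "\<forall>G\<in>insert F U. \<forall>F'\<in>\<F>. \<rho> G < \<rho> F' \<longrightarrow> F' \<in> insert F U"
    proof (intro ballI impI)
      fix G F' assume G: "G \<in> insert F U" "F' \<in> \<F>" "\<rho> G < \<rho> F'"
      show "F' \<in> insert F U"
      proof (cases "G = F")
        case True
        then show ?thesis using F(2) G by (meson DiffI insertI2 linorder_not_le)
      qed (use U(3) G in blast)
    qed
    ultimately show ?case by blast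
  qed
  from this[of "card \<F>"] obtain U where U: "U \<subseteq> \<F>" "card U = card \<F>"
     "cobordism ?S (?D \<F>) (?S \<union> ?D U) (?D (\<F> - U))" by auto
  then have "U = \<F>" using fin(1) card_subset_eq by blast
  moreover have "?S \<union> ?D \<F> = ?D \<F>" by blast
  ultimately have "cobordism ?S (?D \<F>) (?D \<F>) {}" using U(3) by simp
  then show ?thesis unfolding bounds_def by blast
qed

text \<open>The facets through \<open>\<tau>\<close> inherit the order and the restriction faces
  outside \<open>\<tau>\<close>. A neighbour obtained from \<open>C3\<close> or \<open>C4\<close>
  omits only a vertex \<open>x\<close> outside \<open>\<tau>\<close>, so it again contains
  \<open>\<tau>\<close>.\<close>

lemma bishelling_good:
  fixes \<F> :: "'a set set"
  assumes inf: "infinite (UNIV :: 'a set)" and bs: "bishelling \<F> \<rho> R"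
  shows "good (\<Union>F\<in>\<F>. Pow F)"
  unfolding good_def
proof
  fix \<tau>
  let ?F = "(\<lambda>F. F - \<tau>) ` {F \<in> \<F>. \<tau> \<subseteq> F}"
  interpret bishelling \<F> \<rho> R by (rule bs)
  have un: "F - \<tau> \<union> \<tau> = F" if "\<tau> \<subseteq> F" for F :: "'a set" using that by auto
  have "bishelling ?F (\<lambda>G. \<rho> (G \<union> \<tau>)) (\<lambda>G. R (G \<union> \<tau>) - \<tau>)"
  proof unfold_locales
    show "finite ?F" using fin by simp
  next
    fix G assume "G \<in> ?F"
    then obtain F where F: "F \<in> \<F>" "\<tau> \<subseteq> F" "G = F - \<tau>" "G \<union> \<tau> = F" using un by auto
    show "finite G" "R (G \<union> \<tau>) - \<tau> \<subseteq> G" using fin(2,3)[OF F(1)] F by auto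
  next
    fix G x assume "G \<in> ?F" and x0: "x \<in> R (G \<union> \<tau>) - \<tau>"
    then obtain F where F: "F \<in> \<F>" "\<tau> \<subseteq> F" "G = F - \<tau>" "G \<union> \<tau> = F" using un by auto
    have x: "x \<in> R F" "x \<notin> \<tau>" using F x0 by auto
    obtain F' where F': "F' \<in> \<F>" "F - {x} \<subseteq> F'" "\<rho> F < \<rho> F'" using C3[OF F(1) x(1)] by blast
    then have "\<tau> \<subseteq> F'" using F x by auto
    then show "\<exists>G'\<in>?F. G - {x} \<subseteq> G' \<and> \<rho> (G \<union> \<tau>) < \<rho> (G' \<union> \<tau>)"
      by (intro bexI[of _ "F' - \<tau>"]) (use F F' un in auto)
  next
    fix G x assume "G \<in> ?F" and x0: "x \<in> G - (R (G \<union> \<tau>) - \<tau>)"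
    then obtain F where F: "F \<in> \<F>" "\<tau> \<subseteq> F" "G = F - \<tau>" "G \<union> \<tau> = F" using un by auto
    have x: "x \<in> F - R F" "x \<notin> \<tau>" using F x0 by auto
    obtain F' where F': "F' \<in> \<F>" "F - {x} \<subseteq> F'" "\<rho> F' < \<rho> F" using C4[OF F(1) x(1)] by blast
    then have "\<tau> \<subseteq> F'" using F x by auto
    then show "\<exists>G'\<in>?F. G - {x} \<subseteq> G' \<and> \<rho> (G' \<union> \<tau>) < \<rho> (G \<union> \<tau>)"
      by (intro bexI[of _ "F' - \<tau>"]) (use F F' un in auto)
  next
    fix G G' assume "G \<in> ?F" "G' \<in> ?F" and ne: "G \<noteq> G'"
    then obtain F F' where F: "F \<in> \<F>" "\<tau> \<subseteq> F" "G = F - \<tau>" "G \<union> \<tau> = F"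
      and F': "F' \<in> \<F>" "\<tau> \<subseteq> F'" "G' = F' - \<tau>" "G' \<union> \<tau> = F'" using un by auto
    { assume "R (G \<union> \<tau>) - \<tau> \<subseteq> G'"
      then have "R F \<subseteq> F'" using F F' by auto
      then show "\<rho> (G' \<union> \<tau>) < \<rho> (G \<union> \<tau>)" using C1[OF F(1) F'(1)] F F' ne by auto }
    { assume "G - (R (G \<union> \<tau>) - \<tau>) \<subseteq> G'"
      then have "F - R F \<subseteq> F'" using F F' by auto
      then show "\<rho> (G \<union> \<tau>) < \<rho> (G' \<union> \<tau>)" using C2[OF F(1) F'(1)] F F' ne by auto }
  qed
  then have "bounds (\<Union>F\<in>?F. Pow F)" by (rule bishelling_bounds[OF inf])
  moreover have "link (\<Union>F\<in>\<F>. Pow F) \<tau> = (\<Union>F\<in>?F. Pow F)" by (auto simp: link_def)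
  ultimately show "bounds (link (\<Union>F\<in>\<F>. Pow F) \<tau>)" by simp
qed

subsection \<open>Colourings and flips\<close>

text \<open>\<open>S\<close> is the set of vertices colored so far. Colours are treated in decreasing order: once all
  colours \<open>\<ge> c\<close> are distributed, the faces avoiding them have at most \<open>c\<close> vertices.\<close>

locale partial_coloring =
  fixes m :: nat and \<Delta> :: "'a set set" and \<kappa> :: "'a \<Rightarrow> nat" and c :: nat
    and D :: "'a set set" and S :: "'a set" and \<kappa>' :: "'a \<Rightarrow> nat"
  assumes ball: "cobordism \<Delta> D D {}" and S: "\<Union>\<Delta> \<subseteq> S" "S \<subseteq> \<Union>D"
    and ext: "\<And>x. x \<in> \<Union>\<Delta> \<Longrightarrow> \<kappa>' x = \<kappa> x"
    and colors: "\<And>x. x \<in> S \<Longrightarrow> \<kappa>' x < m"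
    and proper: "\<And>x y. x \<in> S \<Longrightarrow> y \<in> S \<Longrightarrow> x \<noteq> y \<Longrightarrow> {x, y} \<in> D \<Longrightarrow> \<kappa>' x \<noteq> \<kappa>' y"
    and small: "\<And>Y. Y \<in> D \<Longrightarrow> (\<And>x. x \<in> Y \<Longrightarrow> x \<in> S \<Longrightarrow> \<kappa>' x < c) \<Longrightarrow> card Y \<le> c"

text \<open>To go from the bound \<open>c + 1\<close> to \<open>c\<close>, take a face
  \<open>F\<close> with \<open>c + 1\<close> vertices whose coloured vertices have colours below
  \<open>c\<close>, subdivide it and give the new vertex colour \<open>c\<close>. By the pigeonhole
  principle \<open>F\<close> is not in \<open>\<Delta>\<close>, which is therefore unchanged. The
  new vertex has no neighbour of colour \<open>c\<close>: together with \<open>F\<close> such a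
  neighbour would form a face of \<open>c + 2\<close> vertices with colours at most
  \<open>c\<close>, against \<open>small\<close>.\<close>

lemma color_ball:
  fixes \<Delta> :: "'a set set"
  assumes inf: "infinite (UNIV :: 'a set)" and cx: "simplicial_complex \<Delta>"
    and c: "cobordism \<Delta> D D {}" and ind: "\<And>Y. Y \<in> D \<Longrightarrow> Y \<subseteq> \<Union>\<Delta> \<Longrightarrow> Y \<in> \<Delta>"
    and card: "\<And>Y. Y \<in> D \<Longrightarrow> card Y \<le> m" and \<kappa>: "proper_coloring m \<Delta> \<kappa>"
  shows "\<exists>D \<kappa>'. cobordism \<Delta> D D {} \<and> proper_coloring m D \<kappa>' \<and> (\<forall>x\<in>\<Union>\<Delta>. \<kappa>' x = \<kappa> x)"
proof -
  let ?I = "partial_coloring m \<Delta> \<kappa>"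
  have "c \<le> m \<Longrightarrow> \<exists>D S \<kappa>'.  ?I (m - c) D S \<kappa>'" for c
  proof (induction c)
    case 0
    have "\<Union>\<Delta> \<subseteq> \<Union>D" using cobordism_mono[OF c] by auto
    moreover have "\<kappa> x < m" if "x \<in> \<Union>\<Delta>" for x
      using that \<kappa> complex_mem[OF cx] by (force simp: proper_coloring_def vertices_def)
    moreover have "\<kappa> x \<noteq> \<kappa> y" if "x \<in> \<Union>\<Delta>" "y \<in> \<Union>\<Delta>" "x \<noteq> y" "{x, y} \<in> D" for x y
      using ind[OF that(4)] that(1-3) \<kappa> by (auto simp: proper_coloring_def)
    ultimately have "?I m D (\<Union>\<Delta>) \<kappa>" using c card by unfold_locales auto
    then show ?case by auto
  next
    case (Suc c')
    define c where "c = m - Suc c'"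
    have cm: "m - c' = Suc c" "c < m" using Suc.prems by (auto simp: c_def)
    let ?bad = "\<lambda>D S \<kappa>'. {Y \<in> D. (\<forall>x\<in>Y. x \<in> S \<longrightarrow> \<kappa>' x < c) \<and> card Y = Suc c}"
    have "?I (Suc c) D S \<kappa>' \<Longrightarrow> \<exists>D S \<kappa>'. ?I c D S \<kappa>'" for D S \<kappa>'
    proof (induction "card (?bad D S \<kappa>')" arbitrary: D S \<kappa>' rule: less_induct)
      case less
      then interpret partial_coloring m \<Delta> \<kappa> "Suc c" D S \<kappa>' by simp
      note D = ball
      have cD: "simplicial_complex D" by (rule cobordism_complex[OF D cx])
      show ?case
      proof (cases "?bad D S \<kappa>' = {}")
        case True
        have "card Y \<le> c" if Y: "Y \<in> D" "\<forall>x\<in>Y. x \<in> S \<longrightarrow> \<kappa>' x < c" for Y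
        proof -
          have "card Y \<le> Suc c" by (rule small[OF Y(1)]) (use Y(2) less_SucI in blast)
          moreover have "card Y \<noteq> Suc c" using True Y by blast
          ultimately show ?thesis by simp
        qed
        then have "?I c D S \<kappa>'" using ball S ext colors proper by unfold_locales auto
        then show ?thesis by blast
      next
        case False
        then obtain F where F: "F \<in> D" "\<And>x. x \<in> F \<Longrightarrow> x \<in> S \<Longrightarrow> \<kappa>' x < c" "card F = Suc c" by blast
        have finF: "finite F" by (rule complex_face_finite[OF cD F(1)])
        have "F \<notin> \<Delta>"
        proof
          assume FD: "F \<in> \<Delta>"
          have "inj_on \<kappa>' F"
          proof (rule inj_onI, rule ccontr)
            fix x y assume xy: "x \<in> F" "y \<in> F" "\<kappa>' x = \<kappa>' y" "x \<noteq> y"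
            have "{x, y} \<in> D" by (rule complex_mem[OF cD F(1)]) (use xy in simp)
            then show False using proper[of x y] xy S FD by blast
          qed
          moreover have "\<kappa>' ` F \<subseteq> {..<c}" using F(2) S(1) FD by blast
          ultimately have "card F \<le> card {..<c}" by (metis card_inj_on_le finite_lessThan)
          then show False using F(3) by simp
        qed
        have "finite (\<Union>D)" by (rule complex_Union_finite[OF cD])
        then obtain v where v: "v \<notin> \<Union>D" using inf ex_new_if_finite by metis
        have vD: "v \<notin> \<Union>\<Delta>" using v S by blast
        let ?D = "stellar D F v" and ?S = "insert v S \<inter> \<Union>(stellar D F v)" and ?k = "\<kappa>'(v := c)"
        have "cobordism (stellar \<Delta> F v) ?D ?D (stellar {} F v)" by (rule cobordism_stellar[OF D v])
        then have cD': "cobordism \<Delta> ?D ?D {}" using stellar_id[OF cx \<open>F \<notin> \<Delta>\<close> vD] by simp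
        have sub: "\<Union>\<Delta> \<subseteq> \<Union>?D" using cobordism_mono[OF cD'] by auto
        have vS: "v \<notin> S" using v S by auto
        have finY: "finite Y" if "Y \<in> ?D" for Y using that complex_face_finite[OF complex_stellar[OF cD]] by blast
        \<comment> \<open>Exchanging \<open>v\<close> for a vertex of \<open>F\<close> outside
          \<open>Y\<close> shows that a new face is no larger than the old face it comes from, so
          the size bounds survive the subdivision.\<close>
        have big: "card Y \<le> card ((Y - {v}) \<union> F) \<and> (Y - {v}) \<union> F \<in> D" if "Y \<in> ?D" "v \<in> Y" for Y
        proof -
          have "\<not> F \<subseteq> Y" using that by (simp add: stellar_def)
          then obtain z where z: "z \<in> F" "z \<notin> Y" by blast
          have "card Y = card (insert z (Y - {v}))" using finY[OF that(1)] z that(2)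
            by (metis DiffD1 card.remove card_insert_disjoint finite_Diff)
          also have "\<dots> \<le> card ((Y - {v}) \<union> F)" by (rule card_mono) (use finY[OF that(1)] finF z in auto)
          finally show ?thesis using that by (auto simp: stellar_def)
        qed
        have edge: "\<kappa>' x \<noteq> c" if "x \<in> S" "{x, v} \<in> ?D" "x \<noteq> v" for x
        proof
          assume k: "\<kappa>' x = c"
          have "({x, v} - {v}) \<union> F \<in> D" using big[OF that(2)] by auto
          moreover have "({x, v} - {v}) \<union> F = insert x F" using that(3) by auto
          ultimately have xF: "insert x F \<in> D" by simp
          have "x \<notin> F" using F(2) k that(1) by blast
          then have "card (insert x F) = Suc (Suc c)" using finF F(3) by simp
          moreover have "card (insert x F) \<le> Suc c"
            by (rule small[OF xF]) (use F(2) k less_SucI in \<open>auto intro: less_SucI\<close>)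
          ultimately show False by simp
        qed
        have I': "?I (Suc c) ?D ?S ?k"
        proof unfold_locales
          show "cobordism \<Delta> ?D ?D {}" by (rule cD')
          show "\<Union>\<Delta> \<subseteq> ?S" using S sub by blast
          show "?S \<subseteq> \<Union>?D" by blast
          show "?k x = \<kappa> x" if "x \<in> \<Union>\<Delta>" for x using that vD ext by auto
          show "?k x < m" if "x \<in> ?S" for x using that colors cm by auto
        next
          fix x y assume xy: "x \<in> ?S" "y \<in> ?S" "x \<noteq> y" "{x, y} \<in> ?D"
          consider "x = v" | "y = v" | "x \<noteq> v" "y \<noteq> v" by blast
          then show "?k x \<noteq> ?k y"
          proof cases
            case 1
            then have "y \<in> S" "{y, v} \<in> ?D" using xy by (auto simp: insert_commute)
            then show ?thesis using edge[of y] 1 xy(3) by auto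
          next
            case 2
            then show ?thesis using edge[of x] xy by auto
          next
            case 3
            then have "{x, y} \<in> D" using xy by (auto simp: stellar_def)
            then show ?thesis using proper[of x y] xy 3 by auto
          qed
        next
          fix Y assume Y: "Y \<in> ?D" "\<And>x. x \<in> Y \<Longrightarrow> x \<in> ?S \<Longrightarrow> ?k x < Suc c"
          have YS: "\<kappa>' x < Suc c" if "x \<in> Y" "x \<in> S" for x
          proof -
            have "x \<in> ?S" "x \<noteq> v" using that Y(1) vS by auto
            then show ?thesis using Y(2)[OF that(1)] by simp
          qed
          show "card Y \<le> Suc c"
          proof (cases "v \<in> Y")
            case True
            have "card ((Y - {v}) \<union> F) \<le> Suc c"
              by (rule small) (use big[OF Y(1) True] YS F(2) in \<open>auto intro: less_SucI\<close>)
            then show ?thesis using big[OF Y(1) True] by simp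
          next
            case False
            then have "Y \<in> D" using Y(1) by (simp add: stellar_def)
            then show ?thesis using small YS by blast
          qed
        qed
        have "?bad ?D ?S ?k \<subset> ?bad D S \<kappa>'"
        proof -
          have "Y \<in> ?bad D S \<kappa>'" if Y: "Y \<in> ?bad ?D ?S ?k" for Y
          proof -
            have "v \<notin> Y" using Y by auto
            moreover from this have "Y \<in> D" using Y by (simp add: stellar_def)
            moreover have "\<kappa>' x < c" if "x \<in> Y" "x \<in> S" for x
            proof -
              have "x \<in> ?S" using that Y by blast
              then have "?k x < c" using Y that by blast
              then show ?thesis using that vS by (auto split: if_splits)
            qed
            ultimately show ?thesis using Y by blast
          qed
          moreover have "F \<notin> ?D" by (simp add: stellar_def)
          ultimately show ?thesis using F by blast
        qed
        moreover have "finite (?bad D S \<kappa>')" using cD by (simp add: simplicial_complex_def)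
        ultimately show ?thesis using less.hyps[OF psubset_card_mono I'] by blast
      qed
    qed
    then show ?case using Suc cm unfolding c_def by auto
  qed
  \<comment> \<open>At bound \<open>0\<close> a face without coloured vertices must be empty, so
    every vertex has received a colour.\<close>
  from this[of m] obtain D S \<kappa>' where "?I 0 D S \<kappa>'" by auto
  then interpret partial_coloring m \<Delta> \<kappa> 0 D S \<kappa>' .
  note D = ball
  have cD: "simplicial_complex D" by (rule cobordism_complex[OF D cx])
  have all: "x \<in> S" if "x \<in> \<Union>D" for x
  proof (rule ccontr)
    assume "x \<notin> S"
    moreover have "{x} \<in> D" using that complex_mem[OF cD] by blast
    ultimately show False using small[of "{x}"] by auto
  qed
  have "proper_coloring m D \<kappa>'"
    unfolding proper_coloring_def vertices_def using all colors proper by blast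
  then show ?thesis using ball ext by metis
qed

definition pure :: "nat \<Rightarrow> 'a set set \<Rightarrow> bool" where
  "pure n X \<longleftrightarrow> (\<forall>Y\<in>X. card Y \<le> n \<and> (\<exists>Z\<in>X. Y \<subseteq> Z \<and> card Z = n))"

lemma pureD:
  assumes "pure n X" "Y \<in> X"
  shows "card Y \<le> n" "\<exists>Z\<in>X. Y \<subseteq> Z \<and> card Z = n"
  using assms by (simp_all add: pure_def)

text \<open>A face through the edge has the size of the face of the subdivision in which
  \<open>v\<close> replaces \<open>a\<close>. Conversely, replacing \<open>v\<close> by both
  endpoints does not make a face smaller, so largest faces come from largest faces.\<close>

lemma pure_unsubdivide:
  assumes cx: "simplicial_complex \<Sigma>" and e: "{a, b} \<in> \<Sigma>" "a \<noteq> b" and v: "v \<notin> \<Union>\<Sigma>"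
    and p: "pure n (stellar \<Sigma> {a, b} v)"
  shows "pure n \<Sigma>"
proof -
  let ?e = "{a, b}" and ?S' = "stellar \<Sigma> {a, b} v"
  have ab: "a \<noteq> v" "b \<noteq> v" using e v by auto
  have "\<exists>Y'\<in>?S'. card Y' = card Y \<and> Y \<subseteq> Y' - {v} \<union> ?e \<and> (?e \<subseteq> Y \<longrightarrow> v \<in> Y')" if Y: "Y \<in> \<Sigma>" for Y
  proof (cases "?e \<subseteq> Y")
    case True
    let ?Y = "insert v (Y - {a})"
    have vY: "v \<notin> Y" using v Y by auto
    have "?Y - {v} \<union> ?e = Y" using True vY by auto
    then have "?Y \<in> ?S'" using Y ab e by (auto simp: stellar_def)
    moreover have "card ?Y = card Y" using complex_face_finite[OF cx Y] True vY
      by (metis Diff_iff card.remove card_insert_disjoint finite_Diff insert_subset)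
    moreover have "Y \<subseteq> ?Y - {v} \<union> ?e" using vY by auto
    ultimately show ?thesis by (intro bexI[of _ ?Y]) auto
  next
    case False
    then have "Y \<in> ?S'" "v \<notin> Y" using Y v by (auto simp: stellar_def)
    then show ?thesis using False by blast
  qed
  note lift = this
  have le: "card Y \<le> n" if "Y \<in> \<Sigma>" for Y using lift[OF that] p by (auto simp: pure_def)
  show ?thesis unfolding pure_def
  proof (intro ballI conjI)
    fix Y assume Y: "Y \<in> \<Sigma>"
    show "card Y \<le> n" by (rule le[OF Y])
    obtain Y' where Y': "Y' \<in> ?S'" "Y \<subseteq> Y' - {v} \<union> ?e" "?e \<subseteq> Y \<longrightarrow> v \<in> Y'"
      "?e \<subseteq> Y \<or> Y' = Y"
    proof (cases "?e \<subseteq> Y")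
      case True then show ?thesis using lift[OF Y] that by blast
    next
      case False then show ?thesis using Y v that[of Y] by (auto simp: stellar_def)
    qed
    obtain Z where Z: "Z \<in> ?S'" "Y' \<subseteq> Z" "card Z = n" using p Y'(1) by (auto simp: pure_def)
    show "\<exists>Z\<in>\<Sigma>. Y \<subseteq> Z \<and> card Z = n"
    proof (cases "v \<in> Z")
      case True
      let ?Z = "Z - {v} \<union> ?e"
      have Zs: "?Z \<in> \<Sigma>" "\<not> ?e \<subseteq> Z" using Z True by (auto simp: stellar_def)
      have fZ: "finite Z" using complex_face_finite[OF complex_stellar[OF cx] Z(1)] .
      obtain z where z: "z \<in> ?e" "z \<notin> Z" using Zs by auto
      have "card Z = card (insert z (Z - {v}))" using fZ z True
        by (metis DiffD1 card.remove card_insert_disjoint finite_Diff)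
      also have "\<dots> \<le> card ?Z" by (rule card_mono) (use fZ z in auto)
      finally have "card ?Z = n" using le[OF Zs(1)] Z by simp
      moreover have "Y \<subseteq> ?Z" using Y'(2) Z(2) by blast
      ultimately show ?thesis using Zs by blast
    next
      case False
      then have "Z \<in> \<Sigma>" "Y' = Y" using Z Y' by (auto simp: stellar_def)
      then show ?thesis using Z by blast
    qed
  qed
qed

text \<open>Since \<open>A\<close> leaves the future, every face of the current sphere that contains
  \<open>A\<close> lies in the transferred simplex; this gives its link. In particular the simplex
  without a vertex of \<open>B\<close> is a maximal face of the sphere, so purity fixes the size of
  the simplex, and thereby that of all new faces.\<close>

lemma shelling_move_flip:
  assumes m: "shelling_move K M K' M'" and K: "simplicial_complex K" "{} \<in> K"
    and M': "\<And>Y Z. Y \<in> M' \<Longrightarrow> Z \<subseteq> Y \<Longrightarrow> Z \<in> M'"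
  shows "bistellar_flip (K \<inter> M) (K' \<inter> M')"
    and "pure n (K \<inter> M) \<Longrightarrow> pure n (K' \<inter> M') \<and> (\<forall>Y\<in>K'. Y \<in> K \<or> card Y \<le> Suc n)"
proof -
  obtain A B where *: "finite A" "finite B" "A \<inter> B = {}"
     "\<And>H. H \<subseteq> A \<union> B \<Longrightarrow> H \<in> K \<longleftrightarrow> \<not> B \<subseteq> H" "\<And>H. H \<subseteq> A \<union> B \<Longrightarrow> H \<in> M' \<longleftrightarrow> \<not> A \<subseteq> H"
     "K' = K \<union> Pow (A \<union> B)" "M = M' \<union> Pow (A \<union> B)"
    by (rule shelling_moveE[OF m]) (rule that)
  have Bne: "B \<noteq> {}" using *(4)[of "{}"] K(2) by auto
  have AM: "A \<notin> M'" using *(5)[of A] by auto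
  have star: "X \<in> K \<inter> M \<longleftrightarrow> X \<subseteq> A \<union> B \<and> \<not> B \<subseteq> X" if "A \<subseteq> X" for X
  proof -
    have "X \<notin> M'" using M'[of X A] AM that by blast
    then show ?thesis using *(4)[of X] *(7) by auto
  qed
  have new: "K' \<inter> M' = {G \<in> K \<inter> M. \<not> A \<subseteq> G} \<union> {G. G \<subseteq> A \<union> B \<and> \<not> A \<subseteq> G}"
    using *(5-7) M'[of _ A] AM by blast
  show "bistellar_flip (K \<inter> M) (K' \<inter> M')"
    unfolding bistellar_flip_def
  proof (intro exI conjI)
    show "A \<in> K \<inter> M" using star[of A] Bne *(3) by blast
    show "B \<notin> K \<inter> M" using *(4)[of B] by auto
    show "A \<inter> B = {}" by fact
    show "link (K \<inter> M) A = simplex_boundary B"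
    proof (rule set_eqI)
      fix G
      have "G \<in> K \<inter> M" if "G \<subset> B" for G using *(4)[of G] *(7) that by auto
      moreover have "A \<union> G \<in> K \<inter> M \<longleftrightarrow> A \<union> G \<subseteq> A \<union> B \<and> \<not> B \<subseteq> A \<union> G" by (rule star) simp
      ultimately show "G \<in> link (K \<inter> M) A \<longleftrightarrow> G \<in> simplex_boundary B"
        unfolding link_def simplex_boundary_def mem_Collect_eq using *(3) by blast
    qed
    have "join (simplex_boundary A) (full_simplex B) = {G. G \<subseteq> A \<union> B \<and> \<not> A \<subseteq> G}"
    proof (rule set_eqI, rule iffI)
      fix G assume "G \<in> join (simplex_boundary A) (full_simplex B)"
      then show "G \<in> {G. G \<subseteq> A \<union> B \<and> \<not> A \<subseteq> G}"
        using *(3) unfolding join_def simplex_boundary_def full_simplex_def by blast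
    next
      fix G assume G: "G \<in> {G. G \<subseteq> A \<union> B \<and> \<not> A \<subseteq> G}"
      then have "G = (G \<inter> A) \<union> (G \<inter> B)" "G \<inter> A \<subset> A" "G \<inter> B \<subseteq> B" by auto
      then show "G \<in> join (simplex_boundary A) (full_simplex B)"
        unfolding join_def simplex_boundary_def full_simplex_def by blast
    qed
    then show "K' \<inter> M' = {G \<in> K \<inter> M. \<not> A \<subseteq> G} \<union> join (simplex_boundary A) (full_simplex B)"
      using new by simp
  qed
  assume p: "pure n (K \<inter> M)"
  have cd: "card (A \<union> B - {x}) = n" if "x \<in> A \<union> B" for x
  proof -
    obtain b where b: "b \<in> B" using Bne by auto
    have "A \<union> (B - {b}) \<in> K \<inter> M" using star[of "A \<union> (B - {b})"] b *(3) by blast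
    then obtain Z where Z: "Z \<in> K \<inter> M" "A \<union> (B - {b}) \<subseteq> Z" "card Z = n" using p unfolding pure_def by blast
    then have "Z \<subseteq> A \<union> B" "\<not> B \<subseteq> Z" using star[of Z] by auto
    then have "Z = A \<union> B - {b}" using Z b *(3) by blast
    then have "card (A \<union> B - {b}) = n" using Z by simp
    then show ?thesis using that b *(1,2) by (simp add: card_Diff_singleton)
  qed
  have cC: "card (A \<union> B) = Suc n"
    using cd Bne *(1,2) by (metis Un_empty all_not_in_conv card.remove finite_UnI)
  show "pure n (K' \<inter> M') \<and> (\<forall>Y\<in>K'. Y \<in> K \<or> card Y \<le> Suc n)"
  proof
    show "\<forall>Y\<in>K'. Y \<in> K \<or> card Y \<le> Suc n"
      using *(1,2,6) cC by (metis Pow_iff UnE card_mono finite_UnI)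
    have small: "card Y \<le> n \<and> (\<exists>Z\<in>K' \<inter> M'. Y \<subseteq> Z \<and> card Z = n)" if Y: "Y \<subseteq> A \<union> B" "\<not> A \<subseteq> Y" for Y
    proof -
      obtain x where x: "x \<in> A" "x \<notin> Y" using Y by blast
      have "A \<union> B - {x} \<in> K' \<inter> M'" unfolding new using x by blast
      moreover have "Y \<subseteq> A \<union> B - {x}" using x Y by blast
      moreover from this have "card Y \<le> n" using cd[of x] x *(1,2) by (metis UnI1 card_mono finite_Diff finite_UnI)
      ultimately show ?thesis using cd[of x] x by blast
    qed
    show "pure n (K' \<inter> M')" unfolding pure_def
    proof
      fix Y assume "Y \<in> K' \<inter> M'"
      then consider "Y \<subseteq> A \<union> B" "\<not> A \<subseteq> Y" | "Y \<in> K \<inter> M" "\<not> A \<subseteq> Y" "\<not> Y \<subseteq> A \<union> B" unfolding new by blast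
      then show "card Y \<le> n \<and> (\<exists>Z\<in>K' \<inter> M'. Y \<subseteq> Z \<and> card Z = n)"
      proof cases
        case 1 then show ?thesis by (rule small)
      next
        case 2
        then obtain Z where Z: "Z \<in> K \<inter> M" "Y \<subseteq> Z" "card Z = n" "card Y \<le> n" using p unfolding pure_def by blast
        have "\<not> A \<subseteq> Z" using star[of Z] Z 2 by blast
        then have "Z \<in> K' \<inter> M'" unfolding new using Z by blast
        then show ?thesis using Z by blast
      qed
    qed
  qed
qed

lemma cobordism_flips:
  assumes c: "cobordism K M K' M'" and K: "simplicial_complex K" "{} \<in> K" and M': "simplicial_complex M'"
    and p: "pure n (K \<inter> M)"
  shows "pure n (K' \<inter> M') \<and> (\<forall>Y\<in>K'. Y \<in> K \<or> card Y \<le> Suc n) \<and>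
    (\<exists>N Ds. Ds 0 = K \<inter> M \<and> Ds N = K' \<inter> M' \<and> (\<forall>i\<le>N. Ds i \<subseteq> K') \<and>
      (\<forall>i<N. bistellar_flip (Ds i) (Ds (Suc i))))"
  using assms
proof (induction rule: cobordism.induct)
  case (cobordism_refl K M)
  then show ?case by (intro conjI exI[of _ 0] exI[of _ "\<lambda>_. K \<inter> M"]) auto
next
  case (cobordism_step K M K' M' K'' M'')
  have K': "simplicial_complex K'" "{} \<in> K'"
    using cobordism_complex[OF cobordism_step(1) cobordism_step.prems(1)] cobordism_mono[OF cobordism_step(1)] cobordism_step.prems(2) by auto
  have M': "simplicial_complex M'" using shelling_move_complex[OF shelling_move_rev[OF cobordism_step(2)] cobordism_step.prems(3)] .
  from cobordism_step.IH[OF cobordism_step.prems(1,2) M' cobordism_step.prems(4)] obtain N Ds where IH: "pure n (K' \<inter> M')"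
    "\<forall>Y\<in>K'. Y \<in> K \<or> card Y \<le> Suc n" "Ds 0 = K \<inter> M" "Ds N = K' \<inter> M'"
    "\<forall>i\<le>N. Ds i \<subseteq> K'" "\<forall>i<N. bistellar_flip (Ds i) (Ds (Suc i))" by blast
  have fl: "bistellar_flip (K' \<inter> M') (K'' \<inter> M'')"
    using shelling_move_flip(1)[OF cobordism_step(2) K'] complex_mem[OF cobordism_step.prems(3)] by blast
  have "pure n (K'' \<inter> M'') \<and> (\<forall>Y\<in>K''. Y \<in> K' \<or> card Y \<le> Suc n)"
    using shelling_move_flip(2)[OF cobordism_step(2) K'] complex_mem[OF cobordism_step.prems(3)] IH(1) by blast
  note pr = this
  have KK: "K' \<subseteq> K''" using shelling_move_mono[OF cobordism_step(2)] by simp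
  let ?D = "\<lambda>i. if i \<le> N then Ds i else K'' \<inter> M''"
  have "?D 0 = K \<inter> M \<and> ?D (Suc N) = K'' \<inter> M'' \<and> (\<forall>i\<le>Suc N. ?D i \<subseteq> K'') \<and>
      (\<forall>i<Suc N. bistellar_flip (?D i) (?D (Suc i)))"
  proof (intro conjI allI impI)
    show "?D i \<subseteq> K''" if "i \<le> Suc N" for i using IH(5) KK by auto
    show "bistellar_flip (?D i) (?D (Suc i))" if "i < Suc N" for i
      using that IH(4,6) fl by (cases "i = N") auto
  qed (use IH(3) in auto)
  moreover have "\<forall>Y\<in>K''. Y \<in> K \<or> card Y \<le> Suc n" using IH(2) pr by metis
  ultimately show ?case using pr by (intro conjI exI[of _ "Suc N"] exI[of _ ?D]) simp_all
qed

lemma proper_coloring_subset: "X \<subseteq> Y \<Longrightarrow> proper_coloring m Y \<kappa> \<Longrightarrow> proper_coloring m X \<kappa>"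
  by (auto simp: proper_coloring_def vertices_def)

theorem good_colored_flips:
  fixes \<Delta> :: "'a set set" and \<kappa> :: "'a \<Rightarrow> nat" and d m :: nat
  assumes inf: "infinite (UNIV :: 'a set)" and m: "m \<ge> d + 2"
    and cx: "simplicial_complex \<Delta>" "{} \<in> \<Delta>" and g: "good \<Delta>" and p: "pure (Suc d) \<Delta>"
    and \<kappa>: "proper_coloring m \<Delta> \<kappa>"
  shows "\<exists>n (Ds :: nat \<Rightarrow> 'a set set) (ks :: nat \<Rightarrow> 'a \<Rightarrow> nat).
           Ds 0 = \<Delta> \<and>
           (\<forall>i<n. bistellar_flip (Ds i) (Ds (Suc i))) \<and>
           (\<exists>F. finite F \<and> card F = d + 2 \<and> Ds n = simplex_boundary F) \<and>
           (\<forall>i\<le>n. proper_coloring m (Ds i) (ks i)) \<and>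
           (\<forall>v\<in>vertices \<Delta>. ks 0 v = \<kappa> v) \<and>
           (\<forall>i<n. \<forall>v\<in>vertices (Ds i) \<inter> vertices (Ds (Suc i)). ks i v = ks (Suc i) v)"
proof -
  have "link \<Delta> {} = \<Delta>" by (auto simp: link_def)
  then have "bounds \<Delta>" using g cx(2) unfolding good_def by metis
  \<comment> \<open>An edge of \<open>D0\<close> between vertices of \<open>\<Delta>\<close> is now
    an edge of \<open>\<Delta>\<close>, so \<open>\<kappa>\<close> is a proper partial colouring of
    the ball.\<close>
  then obtain D0 where D0: "cobordism \<Delta> D0 D0 {}" "\<forall>Y\<in>D0. Y \<subseteq> {} \<union> \<Union>\<Delta> \<longrightarrow> Y \<in> \<Delta>"
    using bounds_induced[OF inf cx(1) finite.emptyI] by blast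
  have e: "simplicial_complex {}" by (simp add: simplicial_complex_def)
  have "\<Delta> \<inter> D0 = \<Delta>" using cobordism_mono[OF D0(1)] by auto
  \<comment> \<open>Only the sizes of the faces of \<open>D0\<close> are taken from the flips here,
    as the starting bound for the colouring; the flips of the conclusion come from the subdivided
    ball \<open>D\<close>.\<close>
  then have "\<forall>Y\<in>D0. Y \<in> \<Delta> \<or> card Y \<le> Suc (Suc d)"
    using cobordism_flips[OF D0(1) cx e, of "Suc d"] p by simp
  then have "card Y \<le> m" if "Y \<in> D0" for Y using that m p unfolding pure_def by fastforce
  then obtain D \<kappa>' where D: "cobordism \<Delta> D D {}" and \<kappa>': "proper_coloring m D \<kappa>'" "\<forall>x\<in>\<Union>\<Delta>. \<kappa>' x = \<kappa> x"
    using color_ball[OF inf cx(1) D0(1) _ _ \<kappa>] D0(2) by auto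
  have \<Delta>D: "\<Delta> \<inter> D = \<Delta>" using cobordism_mono[OF D] by auto
  from D show ?thesis
  proof cases
    case cobordism_refl
    then show ?thesis using cx(2) by simp
  next
    case (cobordism_step K M)
    obtain A B where *: "finite A" "finite B" "A \<inter> B = {}"
     "\<And>H. H \<subseteq> A \<union> B \<Longrightarrow> H \<in> K \<longleftrightarrow> \<not> B \<subseteq> H" "\<And>H. H \<subseteq> A \<union> B \<Longrightarrow> H \<in> {} \<longleftrightarrow> \<not> A \<subseteq> H"
     "D = K \<union> Pow (A \<union> B)" "M = {} \<union> Pow (A \<union> B)"
      by (rule shelling_moveE[OF cobordism_step(2)]) (rule that)
    have A: "A = {}" using *(5)[of "{}"] by auto
    have KM: "K \<inter> M = simplex_boundary B"
      using *(4,7) A by (auto simp: simplex_boundary_def)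
    have M: "simplicial_complex M" using shelling_move_complex[OF shelling_move_rev[OF cobordism_step(2)] e] .
    have pure: "pure (Suc d) (simplex_boundary B)"
      using cobordism_flips[OF cobordism_step(1) cx M] p \<Delta>D KM by simp
    have "{} \<in> K" using cobordism_mono[OF cobordism_step(1)] cx(2) by auto
    then obtain b where b: "b \<in> B" using *(4)[of "{}"] by auto
    then have "B - {b} \<in> simplex_boundary B" by (auto simp: simplex_boundary_def)
    from pureD(2)[OF pure this] obtain Z where Z: "Z \<subset> B" "B - {b} \<subseteq> Z" "card Z = Suc d"
      by (auto simp: simplex_boundary_def)
    then have "Z = B - {b}" by blast
    then have cB: "card B = d + 2" using Z b *(2) by (metis add_2_eq_Suc' card.remove)
    obtain N Ds where Ds: "Ds 0 = \<Delta>" "Ds N = simplex_boundary B" "\<forall>i\<le>N. Ds i \<subseteq> K"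
      "\<forall>i<N. bistellar_flip (Ds i) (Ds (Suc i))"
      using cobordism_flips[OF cobordism_step(1) cx M, of "Suc d"] p \<Delta>D KM by auto
    have "K \<subseteq> D" using *(6) by blast
    then have "\<forall>i\<le>N. proper_coloring m (Ds i) \<kappa>'"
      using Ds(3) proper_coloring_subset[OF _ \<kappa>'(1)] by (meson subset_trans)
    moreover have "\<forall>v\<in>vertices \<Delta>. \<kappa>' v = \<kappa> v" using \<kappa>'(2) unfolding vertices_def by blast
    ultimately show ?thesis
      by (intro exI[of _ N] exI[of _ Ds] exI[of _ "\<lambda>_. \<kappa>'"]) (use Ds cB *(2) in auto)
  qed
qed

subsection \<open>Cones over simplicial complexes\<close>

definition supp :: "('a \<Rightarrow> real) \<Rightarrow> 'a set" where
  "supp c = {x. c x \<noteq> 0}"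

definition cone_of :: "'a set set \<Rightarrow> ('a \<Rightarrow> real) set" where
  "cone_of \<Sigma> = {c. (\<forall>x. 0 \<le> c x) \<and> supp c \<in> \<Sigma>}"

definition comb :: "('a \<Rightarrow> 'b \<Rightarrow> real) \<Rightarrow> ('a \<Rightarrow> real) \<Rightarrow> 'b \<Rightarrow> real" where
  "comb q c = (\<lambda>i. \<Sum>x\<in>supp c. c x * q x i)"

lemma comb_eq: "finite A \<Longrightarrow> supp c \<subseteq> A \<Longrightarrow> comb q c i = (\<Sum>x\<in>A. c x * q x i)"
  unfolding comb_def by (rule sum.mono_neutral_left) (auto simp: supp_def)

lemma comb_lincomb:
  assumes "finite (supp c)" "finite (supp c')"
  shows "comb q (\<lambda>x. s * c x + t * c' x) = (\<lambda>i. s * comb q c i + t * comb q c' i)"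
proof
  fix i
  let ?A = "supp c \<union> supp c'"
  have "supp (\<lambda>x. s * c x + t * c' x) \<subseteq> ?A" by (auto simp: supp_def)
  then show "comb q (\<lambda>x. s * c x + t * c' x) i = s * comb q c i + t * comb q c' i"
    using assms comb_eq[of ?A _ q i]
    by (simp add: sum.distrib sum_distrib_left algebra_simps)
qed

definition lin :: "(('b \<Rightarrow> real) \<Rightarrow> real) \<Rightarrow> bool" where
  "lin L \<longleftrightarrow> (\<forall>s t x y. L (\<lambda>i. s * x i + t * y i) = s * L x + t * L y)"

lemma linD: "lin L \<Longrightarrow> L (\<lambda>i. s * x i + t * y i) = s * L x + t * L y"
  by (simp add: lin_def)

lemma lin_0: "lin L \<Longrightarrow> L (\<lambda>i. 0) = 0"
  using linD[of L 0 _ 0] by simp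

lemma lin_sum:
  assumes "lin L" "finite A"
  shows "L (\<lambda>i. \<Sum>x\<in>A. c x * q x i) = (\<Sum>x\<in>A. c x * L (q x))"
  using assms(2)
proof (induction A)
  case (insert x A)
  have "L (\<lambda>i. c x * q x i + 1 * (\<Sum>x\<in>A. c x * q x i)) = c x * L (q x) + 1 * L (\<lambda>i. \<Sum>x\<in>A. c x * q x i)"
    by (rule linD[OF assms(1)])
  then show ?case using insert by simp
qed (simp add: lin_0[OF assms(1)])

lemma lin_comb:
  assumes "lin L" "finite A" "supp c \<subseteq> A"
  shows "L (comb q c) = (\<Sum>x\<in>A. c x * L (q x))"
proof -
  have "comb q c = (\<lambda>i. \<Sum>x\<in>A. c x * q x i)" using comb_eq[OF assms(2,3)] by (rule ext)
  then show ?thesis using lin_sum[OF assms(1,2)] by simp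
qed

lemma cone_supp_finite: "simplicial_complex X \<Longrightarrow> c \<in> cone_of X \<Longrightarrow> finite (supp c)"
  using complex_face_finite by (auto simp: cone_of_def)

lemma comb_indicator: "comb q (\<lambda>y. if y = x then 1 else 0) = q x"
proof -
  have "supp (\<lambda>y. if y = x then 1 else 0) = {x}" by (auto simp: supp_def)
  then show ?thesis by (auto simp: comb_def)
qed

lemma indicator_cone: "{x} \<in> X \<Longrightarrow> (\<lambda>y. if y = x then 1 else 0) \<in> cone_of X"
proof -
  have "supp (\<lambda>y. if y = x then 1 else 0) = {x}" by (auto simp: supp_def)
  then show "{x} \<in> X \<Longrightarrow> ?thesis" by (simp add: cone_of_def)
qed

subsection \<open>Edge subdivisions\<close>

locale edge_subdivision =
  fixes \<Sigma> :: "'a set set" and a b v :: 'a and t :: real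
  assumes cx: "simplicial_complex \<Sigma>" and e: "{a, b} \<in> \<Sigma>" "a \<noteq> b" and v: "v \<notin> \<Union>\<Sigma>" and t: "0 < t" "t < 1"
begin

text \<open>The change of coordinates for a new vertex \<open>v\<close> at
  \<open>(1 - t) a + t b\<close>: its coefficient is distributed to \<open>a\<close> and
  \<open>b\<close>.\<close>

definition T :: "('a \<Rightarrow> real) \<Rightarrow> 'a \<Rightarrow> real" where
  "T c = (\<lambda>x. if x = v then 0 else if x = a then c a + (1 - t) * c v else if x = b then c b + t * c v else c x)"

lemma ab: "a \<noteq> v" "b \<noteq> v" using e v by auto

lemma T_comb:
  assumes fin: "finite (supp c)"
  shows "comb q (T c) = comb (q(v := (\<lambda>i. (1 - t) * q a i + t * q b i))) c"
proof
  fix i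
  let ?R = "supp c - {a, b, v}" and ?q' = "q(v := (\<lambda>i. (1 - t) * q a i + t * q b i))"
  let ?A = "insert a (insert b (insert v ?R))"
  have finA: "finite ?A" "finite ?R" using fin by auto
  have sA: "supp (T c) \<subseteq> ?A" "supp c \<subseteq> ?A" by (auto simp: supp_def T_def)
  have 1: "comb q (T c) i = (\<Sum>x\<in>?A. T c x * q x i)" "comb ?q' c i = (\<Sum>x\<in>?A. c x * ?q' x i)"
    by (rule comb_eq[OF finA(1) sA(1)], rule comb_eq[OF finA(1) sA(2)])
  have "(\<Sum>x\<in>?R. T c x * q x i) = (\<Sum>x\<in>?R. c x * ?q' x i)"
  proof (rule sum.cong[OF refl])
    fix x assume "x \<in> ?R"
    then have "x \<noteq> a" "x \<noteq> b" "x \<noteq> v" by blast+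
    then show "T c x * q x i = c x * ?q' x i" by (simp add: T_def)
  qed
  then show "comb q (T c) i = comb ?q' c i"
    unfolding 1 using finA(2) ab e(2) by (simp add: T_def algebra_simps)
qed

lemma T_cone:
  assumes c: "c \<in> cone_of (stellar \<Sigma> {a, b} v)"
  shows "T c \<in> cone_of \<Sigma>" "comb q (T c) = comb (q(v := (\<lambda>i. (1 - t) * q a i + t * q b i))) c"
proof -
  have c0: "\<And>x. 0 \<le> c x" and cs: "supp c \<in> stellar \<Sigma> {a, b} v" using c by (auto simp: cone_of_def)
  have fin: "finite (supp c)" by (rule complex_face_finite[OF complex_stellar[OF cx] cs])
  have "supp (T c) \<in> \<Sigma>"
  proof (cases "c v = 0")
    case True
    have "supp (T c) = supp c" using True ab by (auto simp: supp_def T_def)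
    moreover have "v \<notin> supp c" using True by (simp add: supp_def)
    ultimately show ?thesis using cs by (simp add: stellar_def)
  next
    case False
    then have cv: "c v > 0" using c0[of v] by simp
    have "c a + (1 - t) * c v > 0" "c b + t * c v > 0"
      using c0[of a] c0[of b] cv t by (simp_all add: add_nonneg_pos)
    then have "supp (T c) = (supp c - {v}) \<union> {a, b}" using ab e by (auto simp: supp_def T_def)
    moreover have "v \<in> supp c" using False by (simp add: supp_def)
    ultimately show ?thesis using cs by (simp add: stellar_def)
  qed
  moreover have "0 \<le> T c x" for x using c0 t by (simp add: T_def)
  ultimately show "T c \<in> cone_of \<Sigma>" by (simp add: cone_of_def)
  show "comb q (T c) = comb (q(v := (\<lambda>i. (1 - t) * q a i + t * q b i))) c" by (rule T_comb[OF fin])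
qed

text \<open>No face of the subdivision contains both \<open>a\<close> and \<open>b\<close>, so one
  of their coefficients is zero. Comparing the \<open>a\<close> or the \<open>b\<close> coordinates,
  whichever is free of the old vertex, bounds the coefficient of \<open>v\<close> in each
  direction.\<close>

lemma T_inj: "inj_on T (cone_of (stellar \<Sigma> {a, b} v))"
proof (rule inj_onI)
  fix c c' assume c: "c \<in> cone_of (stellar \<Sigma> {a, b} v)" and c': "c' \<in> cone_of (stellar \<Sigma> {a, b} v)"
    and eq: "T c = T c'"
  have 0: "\<And>x. 0 \<le> c x" "\<And>x. 0 \<le> c' x" "c a = 0 \<or> c b = 0" "c' a = 0 \<or> c' b = 0"
    using c c' by (auto simp: cone_of_def stellar_def supp_def)
  have A: "c a + (1 - t) * c v = c' a + (1 - t) * c' v" using fun_cong[OF eq, of a] ab by (simp add: T_def)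
  have B: "c b + t * c v = c' b + t * c' v" using fun_cong[OF eq, of b] ab e by (simp add: T_def)
  have t1: "1 - t > 0" using t by simp
  have key: "x \<le> y" if "(1 - t) * x \<le> (1 - t) * y \<or> t * x \<le> t * y" for x y
    using that t t1 by (auto simp: mult_le_cancel_left_pos)
  have "c v \<le> c' v"
  proof (cases "c' a = 0")
    case True
    then show ?thesis using A 0(1)[of a] by (intro key) simp
  next
    case False
    then have "c' b = 0" using 0 by simp
    then show ?thesis using B 0(1)[of b] by (intro key) simp
  qed
  moreover have "c' v \<le> c v"
  proof (cases "c a = 0")
    case True
    then show ?thesis using A 0(2)[of a] by (intro key) simp
  next
    case False
    then have "c b = 0" using 0 by simp
    then show ?thesis using B 0(2)[of b] by (intro key) simp
  qed
  ultimately have V: "c v = c' v" by simp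
  show "c = c'"
  proof
    fix x
    show "c x = c' x" using A B V fun_cong[OF eq, of x] by (auto simp: T_def split: if_splits)
  qed
qed

lemma T_surj:
  assumes c: "c \<in> cone_of \<Sigma>"
  shows "\<exists>c'\<in>cone_of (stellar \<Sigma> {a, b} v). T c' = c"
proof -
  have c0: "\<And>x. 0 \<le> c x" and cs: "supp c \<in> \<Sigma>" using c by (auto simp: cone_of_def)
  have cv: "c v = 0" using cs v by (auto simp: supp_def)
  \<comment> \<open>The largest multiple of the new vertex that can be split off while the
    coefficients of \<open>a\<close> and \<open>b\<close> stay nonnegative. One of them becomes
    zero, as membership in the subdivision requires.\<close>
  define s where "s = min (c a / (1 - t)) (c b / t)"
  define c' where "c' = c(v := s, a := c a - (1 - t) * s, b := c b - t * s)"
  have s0: "0 \<le> s" using c0 t by (simp add: s_def)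
  have "s \<le> c a / (1 - t)" "s \<le> c b / t" by (auto simp: s_def)
  then have le: "(1 - t) * s \<le> c a" "t * s \<le> c b" using t by (auto simp: field_simps)
  have z: "c a = (1 - t) * s \<or> c b = t * s"
  proof (cases "c a / (1 - t) \<le> c b / t")
    case True then have "s = c a / (1 - t)" by (simp add: s_def)
    then show ?thesis using t by (simp add: field_simps)
  next
    case False then have "s = c b / t" by (simp add: s_def)
    then show ?thesis using t by (simp add: field_simps)
  qed
  have Tc: "T c' = c" using ab e(2) cv by (auto simp: T_def c'_def fun_eq_iff)
  have nn: "0 \<le> c' x" for x using c0 s0 le by (auto simp: c'_def)
  have ne: "\<not> {a, b} \<subseteq> supp c'" using z ab e(2) by (auto simp: supp_def c'_def)
  have "supp c' \<in> stellar \<Sigma> {a, b} v"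
  proof (cases "s = 0")
    case True
    then have "c' = c" using cv by (auto simp: c'_def)
    moreover have "v \<notin> supp c" using cv by (simp add: supp_def)
    ultimately show ?thesis using cs ne by (simp add: stellar_def)
  next
    case False
    then have "s > 0" using s0 by simp
    moreover from this have "(1 - t) * s > 0" "t * s > 0" using t by simp_all
    ultimately have "c a > 0" "c b > 0" using le by linarith+
    then have "(supp c' - {v}) \<union> {a, b} = supp c" using cv ab e(2) by (auto simp: supp_def c'_def split: if_splits)
    moreover have "v \<in> supp c'" using False ab by (simp add: supp_def c'_def)
    ultimately show ?thesis using cs ne by (simp add: stellar_def)
  qed
  then have "c' \<in> cone_of (stellar \<Sigma> {a, b} v)" using nn by (simp add: cone_of_def)
  then show ?thesis using Tc by blast
qed

lemma bij_comb:
  assumes "bij_betw (comb q) (cone_of \<Sigma>) Y"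
  shows "bij_betw (comb (q(v := (\<lambda>i. (1 - t) * q a i + t * q b i)))) (cone_of (stellar \<Sigma> {a, b} v)) Y"
proof -
  have "bij_betw T (cone_of (stellar \<Sigma> {a, b} v)) (cone_of \<Sigma>)"
    unfolding bij_betw_def using T_inj T_cone(1) T_surj by (metis image_eqI subsetI subset_antisym image_subsetI)
  then have "bij_betw (comb q \<circ> T) (cone_of (stellar \<Sigma> {a, b} v)) Y" using assms by (rule bij_betw_trans)
  then show ?thesis by (rule bij_betw_cong[THEN iffD1, rotated]) (simp add: T_cone(2))
qed

end

inductive edge_subdivided :: "'a set set \<Rightarrow> ('a \<Rightarrow> 'b \<Rightarrow> real) \<Rightarrow> 'a set set \<Rightarrow> ('a \<Rightarrow> 'b \<Rightarrow> real) \<Rightarrow> bool"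
  for \<Sigma> q where
  edge_subdivided_refl: "edge_subdivided \<Sigma> q \<Sigma> q"
| edge_subdivided_step: "edge_subdivided \<Sigma> q \<Sigma>' q' \<Longrightarrow> {a, b} \<in> \<Sigma>' \<Longrightarrow> a \<noteq> b \<Longrightarrow> v \<notin> \<Union>\<Sigma>' \<Longrightarrow> 0 < t \<Longrightarrow> t < 1 \<Longrightarrow>
    edge_subdivided \<Sigma> q (stellar \<Sigma>' {a, b} v) (q'(v := (\<lambda>i. (1 - t) * q' a i + t * q' b i)))"

lemma edge_subdivided_trans: "edge_subdivided \<Sigma>' q' \<Sigma>'' q'' \<Longrightarrow> edge_subdivided \<Sigma> q \<Sigma>' q' \<Longrightarrow> edge_subdivided \<Sigma> q \<Sigma>'' q''"
  by (induction rule: edge_subdivided.induct) (auto intro: edge_subdivided_step)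

lemma edge_subdivided_complex: "edge_subdivided \<Sigma> q \<Sigma>' q' \<Longrightarrow> simplicial_complex \<Sigma> \<Longrightarrow> simplicial_complex \<Sigma>'"
  by (induction rule: edge_subdivided.induct) (auto intro: complex_stellar)

lemma edge_subdivided_empty: "edge_subdivided \<Sigma> q \<Sigma>' q' \<Longrightarrow> {} \<in> \<Sigma> \<Longrightarrow> {} \<in> \<Sigma>'"
  by (induction rule: edge_subdivided.induct) (auto simp: stellar_def)

lemma edge_subdivided_bij:
  assumes "edge_subdivided \<Sigma> q \<Sigma>' q'" "simplicial_complex \<Sigma>" "bij_betw (comb q) (cone_of \<Sigma>) Y"
  shows "bij_betw (comb q') (cone_of \<Sigma>') Y"
  using assms
proof (induction rule: edge_subdivided.induct)
  case (edge_subdivided_step \<Sigma>' q' a b v t)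
  interpret edge_subdivision \<Sigma>' a b v t
    using edge_subdivided_step edge_subdivided_complex by unfold_locales auto
  show ?case using bij_comb edge_subdivided_step by blast
qed

lemma edge_subdivided_good:
  fixes \<Sigma> :: "'a set set"
  assumes "edge_subdivided \<Sigma> q \<Sigma>' q'" "infinite (UNIV :: 'a set)" "simplicial_complex \<Sigma>" "good \<Sigma>'"
  shows "good \<Sigma>"
  using assms
proof (induction rule: edge_subdivided.induct)
  case (edge_subdivided_step \<Sigma>' q' a b v t)
  have "good \<Sigma>'" by (rule good_unsubdivide[of _ a b v]) (use edge_subdivided_step edge_subdivided_complex in auto)
  then show ?case using edge_subdivided_step by blast
qed

lemma edge_subdivided_pure:
  assumes "edge_subdivided \<Sigma> q \<Sigma>' q'" "simplicial_complex \<Sigma>" "pure n \<Sigma>'"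
  shows "pure n \<Sigma>"
  using assms
proof (induction rule: edge_subdivided.induct)
  case (edge_subdivided_step \<Sigma>' q' a b v t)
  have "pure n \<Sigma>'" by (rule pure_unsubdivide[of _ a b v]) (use edge_subdivided_step edge_subdivided_complex in auto)
  then show ?case using edge_subdivided_step by blast
qed

lemma Union_stellar_subset: "\<Union>(stellar \<Sigma> {a, b} v) \<subseteq> insert v (\<Union>\<Sigma>)"
  by (auto simp: stellar_def split: if_splits)

lemma edge_subdivided_convex:
  assumes "edge_subdivided \<Sigma> q \<Sigma>' q'"
    and conv: "\<And>x y t. P x \<Longrightarrow> P y \<Longrightarrow> 0 < t \<Longrightarrow> t < 1 \<Longrightarrow> P (\<lambda>i. (1 - t) * x i + t * y i)"
    and "\<forall>x\<in>\<Union>\<Sigma>. P (q x)"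
  shows "\<forall>x\<in>\<Union>\<Sigma>'. P (q' x)"
  using assms(1)
proof (induction rule: edge_subdivided.induct)
  case (edge_subdivided_step \<Sigma>' q' a b v t)
  have "a \<in> \<Union>\<Sigma>'" "b \<in> \<Union>\<Sigma>'" using edge_subdivided_step by auto
  then have "P (\<lambda>i. (1 - t) * q' a i + t * q' b i)" using conv edge_subdivided_step by blast
  then show ?case using edge_subdivided_step.IH Union_stellar_subset[of \<Sigma>' a b v] by auto
qed (use assms in auto)

section \<open>Cutting by hyperplanes\<close>

text \<open>No edge crosses the hyperplane \<open>L = 0\<close>; by \<open>coherent_face\<close> no
  face does either.\<close>

definition coherent :: "'a set set \<Rightarrow> ('a \<Rightarrow> 'b \<Rightarrow> real) \<Rightarrow> (('b \<Rightarrow> real) \<Rightarrow> real) \<Rightarrow> bool" where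
  "coherent \<Sigma> q L \<longleftrightarrow> (\<forall>a b. {a, b} \<in> \<Sigma> \<longrightarrow> L (q a) < 0 \<longrightarrow> L (q b) \<le> 0)"

lemma coherent_face:
  assumes "coherent \<Sigma> q L" "simplicial_complex \<Sigma>" "H \<in> \<Sigma>"
  shows "(\<forall>x\<in>H. 0 \<le> L (q x)) \<or> (\<forall>x\<in>H. L (q x) \<le> 0)"
proof (rule ccontr)
  assume "\<not> ?thesis"
  then obtain x y where xy: "x \<in> H" "y \<in> H" "L (q x) < 0" "0 < L (q y)" by (auto simp: not_le)
  have "{x, y} \<in> \<Sigma>" by (rule complex_mem[OF assms(2,3)]) (use xy in simp)
  then show False using assms(1) xy unfolding coherent_def by fastforce
qed

lemma stellar_edgeD:
  assumes "{x, v} \<in> stellar \<Sigma> {a, b} v" "simplicial_complex \<Sigma>" "x \<noteq> v"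
  shows "{x, a} \<in> \<Sigma> \<and> {x, b} \<in> \<Sigma>"
proof -
  have "({x, v} - {v}) \<union> {a, b} \<in> \<Sigma>" using assms by (auto simp: stellar_def)
  then have "{a, b, x} \<in> \<Sigma>" using assms(3) by (simp add: insert_Diff_if)
  then show ?thesis using complex_mem[OF assms(2), of "{a, b, x}"] by simp
qed

text \<open>The other end \<open>x\<close> of a new edge at \<open>v\<close> spans a face with both
  \<open>a\<close> and \<open>b\<close>, and the value of \<open>L\<close> at \<open>v\<close> is a
  mixture of those at \<open>a\<close> and \<open>b\<close>; opposite signs at \<open>x\<close> and
  \<open>v\<close> would already occur on an old edge. Hence later cuts do not spoil earlier
  ones.\<close>

lemma coherent_step:
  assumes L: "lin L" and c: "coherent \<Sigma> q L" and cx: "simplicial_complex \<Sigma>" and t: "0 < t" "t < 1"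
  shows "coherent (stellar \<Sigma> {a, b} v) (q(v := (\<lambda>i. (1 - t) * q a i + t * q b i))) L"
  unfolding coherent_def
proof (intro allI impI)
  fix x y
  let ?q = "q(v := (\<lambda>i. (1 - t) * q a i + t * q b i))"
  assume xy: "{x, y} \<in> stellar \<Sigma> {a, b} v" "L (?q x) < 0"
  have Lv: "L (?q v) = (1 - t) * L (q a) + t * L (q b)" using linD[OF L] by simp
  consider "x = y" | "x = v" "y \<noteq> v" | "y = v" "x \<noteq> v" | "x \<noteq> v" "y \<noteq> v" by blast
  then show "L (?q y) \<le> 0"
  proof cases
    case 1 then show ?thesis using xy by simp
  next
    case 2
    have "{y, a} \<in> \<Sigma> \<and> {y, b} \<in> \<Sigma>" by (rule stellar_edgeD) (use xy 2 cx in \<open>auto simp: insert_commute\<close>)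
    moreover have "L (q a) < 0 \<or> L (q b) < 0"
    proof (rule ccontr)
      assume "\<not> ?thesis"
      then have "0 \<le> (1 - t) * L (q a) + t * L (q b)" using t by simp
      then show False using xy 2 Lv by simp
    qed
    ultimately have "L (q y) \<le> 0" using c unfolding coherent_def by (metis insert_commute)
    then show ?thesis using 2 by simp
  next
    case 3
    have "{x, a} \<in> \<Sigma> \<and> {x, b} \<in> \<Sigma>" by (rule stellar_edgeD) (use xy 3 cx in auto)
    moreover have "L (q x) < 0" using xy 3 by simp
    ultimately have "L (q a) \<le> 0" "L (q b) \<le> 0" using c unfolding coherent_def by blast+
    then have "(1 - t) * L (q a) + t * L (q b) \<le> 0" using t by (simp add: add_nonpos_nonpos mult_nonneg_nonpos)
    then show ?thesis using Lv 3 by simp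
  next
    case 4
    then have "{x, y} \<in> \<Sigma>" using xy by (auto simp: stellar_def)
    then show ?thesis using c xy 4 unfolding coherent_def by simp
  qed
qed

lemma edge_subdivided_coherent:
  assumes "edge_subdivided \<Sigma> q \<Sigma>' q'" "lin L" "coherent \<Sigma> q L" "simplicial_complex \<Sigma>"
  shows "coherent \<Sigma>' q' L"
  using assms
proof (induction rule: edge_subdivided.induct)
  case (edge_subdivided_step \<Sigma>' q' a b v t)
  have "simplicial_complex \<Sigma>'" using edge_subdivided_step edge_subdivided_complex by blast
  then show ?case
    by (rule coherent_step[OF edge_subdivided_step.prems(1) edge_subdivided_step.IH[OF edge_subdivided_step.prems] _ edge_subdivided_step.hyps(5,6)])
qed

lemma slice_one:
  fixes \<Sigma> :: "'a set set"
  assumes inf: "infinite (UNIV :: 'a set)" and L: "lin L" and cx: "simplicial_complex \<Sigma>"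
  shows "\<exists>\<Sigma>' q'. edge_subdivided \<Sigma> q \<Sigma>' q' \<and> coherent \<Sigma>' q' L"
  using cx
proof (induction "card {(a, b). {a, b} \<in> \<Sigma> \<and> L (q a) < 0 \<and> 0 < L (q b)}" arbitrary: \<Sigma> q rule: less_induct)
  case less
  let ?bad = "\<lambda>\<Sigma> q. {(a, b). {a, b} \<in> \<Sigma> \<and> L (q a) < 0 \<and> 0 < L (q b)}"
  have fin: "finite (\<Union>\<Sigma>)" by (rule complex_Union_finite[OF less.prems])
  show ?case
  proof (cases "?bad \<Sigma> q = {}")
    case True
    then have "coherent \<Sigma> q L" unfolding coherent_def by (metis (mono_tags, lifting) case_prodI empty_Collect_eq not_le)
    then show ?thesis using edge_subdivided_refl by blast
  next
    case False
    then obtain a b where ab: "{a, b} \<in> \<Sigma>" "L (q a) < 0" "0 < L (q b)" by auto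
    then have ne: "a \<noteq> b" by auto
    obtain v where v: "v \<notin> \<Union>\<Sigma>" using inf fin ex_new_if_finite by metis
    \<comment> \<open>The point of the edge at which \<open>L\<close> vanishes, so that no edge at
      the new vertex crosses the hyperplane.\<close>
    define t where "t = L (q a) / (L (q a) - L (q b))"
    have t: "0 < t" "t < 1" using ab by (auto simp: t_def field_simps)
    let ?S = "stellar \<Sigma> {a, b} v" and ?q = "q(v := (\<lambda>i. (1 - t) * q a i + t * q b i))"
    have e: "edge_subdivided \<Sigma> q ?S ?q" by (rule edge_subdivided_step[OF edge_subdivided_refl ab(1) ne v t])
    have "L (?q v) = (1 - t) * L (q a) + t * L (q b)" using linD[OF L] by simp
    also have "\<dots> = 0"
    proof -
      have "L (q a) - L (q b) \<noteq> 0" using ab by simp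
      then show ?thesis by (simp add: t_def field_simps)
    qed
    finally have Lv: "L (?q v) = 0" .
    have "?bad ?S ?q \<subset> ?bad \<Sigma> q"
    proof
      show "?bad ?S ?q \<subseteq> ?bad \<Sigma> q"
      proof (clarify, intro conjI)
        fix x y assume xy: "{x, y} \<in> ?S" "L (?q x) < 0" "0 < L (?q y)"
        have "x \<noteq> v" "y \<noteq> v" using xy Lv by force+
        then show "{x, y} \<in> \<Sigma>" "L (q x) < 0" "0 < L (q y)" using xy by (auto simp: stellar_def)
      qed
      have "(a, b) \<notin> ?bad ?S ?q" by (auto simp: stellar_def)
      then show "?bad ?S ?q \<noteq> ?bad \<Sigma> q" using ab by blast
    qed
    moreover have "finite (?bad \<Sigma> q)"
      by (rule finite_subset[of _ "\<Union>\<Sigma> \<times> \<Union>\<Sigma>"]) (use fin in auto)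
    ultimately have "card (?bad ?S ?q) < card (?bad \<Sigma> q)" by (rule psubset_card_mono[rotated])
    from less.hyps[OF this complex_stellar[OF less.prems]] show ?thesis using e edge_subdivided_trans by blast
  qed
qed

lemma slice:
  fixes \<Sigma> :: "'a set set"
  assumes inf: "infinite (UNIV :: 'a set)" and cx: "simplicial_complex \<Sigma>"
    and "finite \<Lambda>" "\<And>L. L \<in> \<Lambda> \<Longrightarrow> lin L"
  shows "\<exists>\<Sigma>' q'. edge_subdivided \<Sigma> q \<Sigma>' q' \<and> (\<forall>L\<in>\<Lambda>. coherent \<Sigma>' q' L)"
  using assms(3,4)
proof (induction \<Lambda>)
  case empty
  then show ?case using edge_subdivided_refl by blast
next
  case (insert L \<Lambda>)
  then obtain \<Sigma>1 q1 where 1: "edge_subdivided \<Sigma> q \<Sigma>1 q1" "\<forall>L\<in>\<Lambda>. coherent \<Sigma>1 q1 L" by auto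
  have cx1: "simplicial_complex \<Sigma>1" by (rule edge_subdivided_complex[OF 1(1) cx])
  obtain \<Sigma>2 q2 where 2: "edge_subdivided \<Sigma>1 q1 \<Sigma>2 q2" "coherent \<Sigma>2 q2 L"
    using slice_one[OF inf _ cx1] insert.prems by blast
  have "\<forall>L\<in>\<Lambda>. coherent \<Sigma>2 q2 L" using edge_subdivided_coherent[OF 2(1) _ _ cx1] 1(2) insert.prems by blast
  then show ?case using 2 edge_subdivided_trans[OF 2(1) 1(1)] by blast
qed

subsection \<open>Finitely generated cones are polyhedral\<close>

text \<open>Fourier--Motzkin elimination, one generator at a time.\<close>

lemma cone_polyhedral:
  fixes S :: "('b \<Rightarrow> real) set"
  assumes "finite S" "finite I" "\<And>s i. s \<in> S \<Longrightarrow> i \<notin> I \<Longrightarrow> s i = 0"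
  shows "\<exists>\<Lambda>. finite \<Lambda> \<and> (\<forall>L\<in>\<Lambda>. lin L) \<and> (\<forall>y. (\<forall>i. i \<notin> I \<longrightarrow> y i = 0) \<longrightarrow>
    ((\<exists>c. (\<forall>s\<in>S. 0 \<le> c s) \<and> y = (\<lambda>i. \<Sum>s\<in>S. c s * s i)) \<longleftrightarrow> (\<forall>L\<in>\<Lambda>. 0 \<le> L y)))"
  using assms(1,3)
proof (induction S)
  case empty
  let ?L = "(\<lambda>i y. y i) ` I \<union> (\<lambda>i y. - y i) ` I"
  have "(\<exists>c :: ('b \<Rightarrow> real) \<Rightarrow> real. (\<forall>s\<in>{}. 0 \<le> c s) \<and> y = (\<lambda>i. \<Sum>s\<in>{}. c s * s i)) \<longleftrightarrow> (\<forall>L\<in>?L. 0 \<le> L y)"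
    if "\<forall>i. i \<notin> I \<longrightarrow> y i = 0" for y :: "'b \<Rightarrow> real"
  proof -
    have "(\<forall>L\<in>?L. 0 \<le> L y) \<longleftrightarrow> (\<forall>i\<in>I. y i = 0)" by (simp add: ball_Un) (metis antisym order_refl)
    also have "\<dots> \<longleftrightarrow> y = (\<lambda>i. 0)" using that by auto
    finally show ?thesis by simp
  qed
  moreover have "finite ?L" "\<forall>L\<in>?L. lin L" using assms(2) by (auto simp: lin_def)
  ultimately show ?case by (intro exI[of _ ?L]) auto
next
  case (insert s S)
  have "\<exists>\<Lambda>. finite \<Lambda> \<and> (\<forall>L\<in>\<Lambda>. lin L) \<and> (\<forall>y. (\<forall>i. i \<notin> I \<longrightarrow> y i = 0) \<longrightarrow>
    ((\<exists>c. (\<forall>s\<in>S. 0 \<le> c s) \<and> y = (\<lambda>i. \<Sum>s\<in>S. c s * s i)) \<longleftrightarrow> (\<forall>L\<in>\<Lambda>. 0 \<le> L y)))"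
    by (rule insert.IH) (use insert.prems in simp)
  then obtain \<Lambda> where \<Lambda>: "finite \<Lambda>" "\<And>L. L \<in> \<Lambda> \<Longrightarrow> lin L" "\<And>y. (\<forall>i. i \<notin> I \<longrightarrow> y i = 0) \<Longrightarrow>
    (\<exists>c. (\<forall>s\<in>S. 0 \<le> c s) \<and> y = (\<lambda>i. \<Sum>s\<in>S. c s * s i)) \<longleftrightarrow> (\<forall>L\<in>\<Lambda>. 0 \<le> L y)" by blast
  let ?P = "{L \<in> \<Lambda>. 0 < L s}" and ?N = "{L \<in> \<Lambda>. L s < 0}"
  \<comment> \<open>With the new generator \<open>s\<close>, membership of \<open>y\<close> means
    that some \<open>\<tau> \<ge> 0\<close> satisfies \<open>\<tau> * L s \<le> L y\<close> for all
    \<open>L\<close>. Functionals with \<open>L s < 0\<close> bound \<open>\<tau>\<close> from below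
    and those with \<open>L s > 0\<close> from above. \<open>?M\<close> expresses that no lower
    bound, including \<open>0\<close>, exceeds an upper one, together with the conditions free of
    \<open>\<tau>\<close>.\<close>
  let ?M = "{L \<in> \<Lambda>. 0 \<le> L s} \<union> (\<lambda>(L, M) y. L s * M y - M s * L y) ` (?P \<times> ?N)"
  have fin: "finite ?M" using \<Lambda>(1) by simp
  have "lin (\<lambda>y. L s * M y - M s * L y)" if "lin L" "lin M" for L M
    unfolding lin_def by (simp add: linD[OF that(1)] linD[OF that(2)] algebra_simps)
  then have lin: "\<forall>L\<in>?M. lin L" using \<Lambda>(2) by auto
  have "(\<exists>c. (\<forall>r\<in>insert s S. 0 \<le> c r) \<and> y = (\<lambda>i. \<Sum>r\<in>insert s S. c r * r i)) \<longleftrightarrow> (\<forall>L\<in>?M. 0 \<le> L y)" (is "?l \<longleftrightarrow> ?r")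
    if y: "\<forall>i. i \<notin> I \<longrightarrow> y i = 0" for y
  proof -
    have "?l \<longleftrightarrow> (\<exists>\<tau>\<ge>0. \<exists>c. (\<forall>r\<in>S. 0 \<le> c r) \<and> (\<lambda>i. y i - \<tau> * s i) = (\<lambda>i. \<Sum>r\<in>S. c r * r i))"
    proof
      assume ?l
      then obtain c where c: "\<forall>r\<in>insert s S. 0 \<le> c r" "y = (\<lambda>i. \<Sum>r\<in>insert s S. c r * r i)" by blast
      have "(\<lambda>i. y i - c s * s i) = (\<lambda>i. \<Sum>r\<in>S. c r * r i)" using c(2) insert.hyps by simp
      then show "\<exists>\<tau>\<ge>0. \<exists>c. (\<forall>r\<in>S. 0 \<le> c r) \<and> (\<lambda>i. y i - \<tau> * s i) = (\<lambda>i. \<Sum>r\<in>S. c r * r i)"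
        using c(1) by blast
    next
      assume "\<exists>\<tau>\<ge>0. \<exists>c. (\<forall>r\<in>S. 0 \<le> c r) \<and> (\<lambda>i. y i - \<tau> * s i) = (\<lambda>i. \<Sum>r\<in>S. c r * r i)"
      then obtain \<tau> c where c: "\<tau> \<ge> 0" "\<forall>r\<in>S. 0 \<le> c r" "(\<lambda>i. y i - \<tau> * s i) = (\<lambda>i. \<Sum>r\<in>S. c r * r i)" by blast
      have "y i = (\<Sum>r\<in>insert s S. (c(s := \<tau>)) r * r i)" for i
      proof -
        have "(\<Sum>r\<in>S. (c(s := \<tau>)) r * r i) = (\<Sum>r\<in>S. c r * r i)" by (rule sum.cong) (use insert.hyps in auto)
        then show ?thesis using fun_cong[OF c(3), of i] insert.hyps by simp
      qed
      then show ?l using c by (intro exI[of _ "c(s := \<tau>)"]) auto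
    qed
    also have "\<dots> \<longleftrightarrow> (\<exists>\<tau>\<ge>0. \<forall>L\<in>\<Lambda>. \<tau> * L s \<le> L y)"
    proof -
      have "(\<exists>c. (\<forall>r\<in>S. 0 \<le> c r) \<and> (\<lambda>i. y i - \<tau> * s i) = (\<lambda>i. \<Sum>r\<in>S. c r * r i)) \<longleftrightarrow> (\<forall>L\<in>\<Lambda>. \<tau> * L s \<le> L y)" for \<tau>
      proof -
        have Ls: "L (\<lambda>i. y i - \<tau> * s i) = L y - \<tau> * L s" if "L \<in> \<Lambda>" for L
          using linD[OF \<Lambda>(2)[OF that], of 1 y "- \<tau>" s] by simp
        have "\<forall>i. i \<notin> I \<longrightarrow> y i - \<tau> * s i = 0" using y insert.prems by simp
        moreover have "(\<forall>L\<in>\<Lambda>. 0 \<le> L (\<lambda>i. y i - \<tau> * s i)) \<longleftrightarrow> (\<forall>L\<in>\<Lambda>. \<tau> * L s \<le> L y)"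
          by (intro ball_cong refl) (simp add: Ls)
        ultimately show ?thesis using \<Lambda>(3)[of "\<lambda>i. y i - \<tau> * s i"] by blast
      qed
      then show ?thesis by blast
    qed
    also have "\<dots> \<longleftrightarrow> ?r"
    proof
      assume "\<exists>\<tau>\<ge>0. \<forall>L\<in>\<Lambda>. \<tau> * L s \<le> L y"
      then obtain \<tau> where \<tau>: "\<tau> \<ge> 0" "\<And>L. L \<in> \<Lambda> \<Longrightarrow> \<tau> * L s \<le> L y" by blast
      have "0 \<le> L y" if "L \<in> \<Lambda>" "0 \<le> L s" for L using \<tau>(2)[OF that(1)] mult_nonneg_nonneg[OF \<tau>(1) that(2)] by simp
      moreover have "0 \<le> L s * M y - M s * L y" if "L \<in> \<Lambda>" "0 < L s" "M \<in> \<Lambda>" "M s < 0" for L M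
      proof -
        have "L s * (\<tau> * M s) \<le> L s * M y" using \<tau>(2)[OF that(3)] that(2) by simp
        moreover have "M s * L y \<le> M s * (\<tau> * L s)" using \<tau>(2)[OF that(1)] that(4) by (simp add: mult_left_mono_neg)
        ultimately show ?thesis by (simp add: algebra_simps)
      qed
      ultimately show ?r by auto
    next
      assume ?r
      then have r1: "0 \<le> L y" if "L \<in> \<Lambda>" "0 \<le> L s" for L using that by auto
      have r2: "0 \<le> L s * M y - M s * L y" if "L \<in> \<Lambda>" "0 < L s" "M \<in> \<Lambda>" "M s < 0" for L M
      proof -
        have "(\<lambda>y. L s * M y - M s * L y) \<in> ?M"
          by (rule UnI2, rule image_eqI[of _ _ "(L, M)"]) (use that in auto)
        with \<open>?r\<close> show ?thesis by (rule bspec)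
      qed
      define \<tau> where "\<tau> = Max (insert 0 ((\<lambda>M. M y / M s) ` ?N))"
      have finN: "finite (insert 0 ((\<lambda>M. M y / M s) ` ?N))" using \<Lambda>(1) by simp
      have "0 \<le> \<tau>" unfolding \<tau>_def by (rule Max_ge[OF finN]) simp
      moreover have "\<tau> * L s \<le> L y" if LL: "L \<in> \<Lambda>" for L
      proof -
        consider "L s < 0" | "L s = 0" | "0 < L s" by linarith
        then show ?thesis
        proof cases
          case 1
          then have "L y / L s \<le> \<tau>" unfolding \<tau>_def using LL by (intro Max_ge[OF finN]) auto
          then show ?thesis using 1 by (simp add: field_simps)
        next
          case 2 then show ?thesis using r1[OF LL] by simp
        next
          case 3
          have "\<tau> \<in> insert 0 ((\<lambda>M. M y / M s) ` ?N)" unfolding \<tau>_def by (rule Max_in[OF finN]) simp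
          then consider "\<tau> = 0" | M where "M \<in> \<Lambda>" "M s < 0" "\<tau> = M y / M s" by auto
          then show ?thesis
          proof cases
            case 1 then show ?thesis using r1[OF LL] 3 by simp
          next
            case (2 M)
            then have "M y = M s * \<tau>" by simp
            then have "M s * L y \<le> M s * (\<tau> * L s)" using r2[OF LL 3 2(1,2)] by (simp add: algebra_simps)
            then show ?thesis using 2(2) by (simp add: mult_le_cancel_left_neg)
          qed
        qed
      qed
      ultimately show "\<exists>\<tau>\<ge>0. \<forall>L\<in>\<Lambda>. \<tau> * L s \<le> L y" by blast
    qed
    finally show ?thesis .
  qed
  then show ?case using fin lin by (intro exI[of _ ?M]) blast
qed

section \<open>From PL homeomorphisms to maps linear on cones\<close>

lemma sum_supp: "finite A \<Longrightarrow> supp c \<subseteq> A \<Longrightarrow> sum c A = sum c (supp c)"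
  by (rule sum.mono_neutral_right) (auto simp: supp_def)

lemma realization_iff:
  assumes "simplicial_complex \<Delta>"
  shows "p \<in> realization \<Delta> \<longleftrightarrow> p \<in> cone_of \<Delta> \<and> sum p (supp p) = 1"
proof
  assume "p \<in> realization \<Delta>"
  then obtain F where F: "F \<in> \<Delta>" "\<forall>v. p v \<ge> 0" "\<forall>v. v \<notin> F \<longrightarrow> p v = 0" "sum p F = 1"
    by (auto simp: realization_def)
  then have "supp p \<subseteq> F" by (auto simp: supp_def)
  then show "p \<in> cone_of \<Delta> \<and> sum p (supp p) = 1"
    using F sum_supp[of F p] complex_mem[OF assms F(1)] complex_face_finite[OF assms F(1)] by (auto simp: cone_of_def)
next
  assume "p \<in> cone_of \<Delta> \<and> sum p (supp p) = 1"
  then show "p \<in> realization \<Delta>"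
    by (auto simp: realization_def cone_of_def supp_def intro!: bexI[of _ "supp p"])
qed

lemma supp_scale: "m \<noteq> 0 \<Longrightarrow> supp (\<lambda>x. m * c x) = supp c"
  by (auto simp: supp_def)

lemma cone_scale: "c \<in> cone_of X \<Longrightarrow> 0 < m \<Longrightarrow> (\<lambda>x. m * c x) \<in> cone_of X"
  using supp_scale[of m c] by (auto simp: cone_of_def)

lemma cone_polar:
  assumes "simplicial_complex X" "c \<in> cone_of X" "supp c \<noteq> {}"
  obtains m c' where "0 < m" "c' \<in> realization X" "c = (\<lambda>x. m * c' x)"
proof
  let ?m = "sum c (supp c)"
  have fin: "finite (supp c)" by (rule cone_supp_finite[OF assms(1,2)])
  have pos: "0 < c x" if "x \<in> supp c" for x
    using that assms(2) by (auto simp: cone_of_def supp_def less_le)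
  show m: "0 < ?m" by (rule sum_pos[OF fin assms(3) pos])
  have "(\<lambda>x. 1 / ?m * c x) \<in> cone_of X" by (rule cone_scale[OF assms(2)]) (use m in simp)
  moreover have "sum (\<lambda>x. 1 / ?m * c x) (supp c) = 1" using m by (simp flip: sum_divide_distrib)
  ultimately show "(\<lambda>x. 1 / ?m * c x) \<in> realization X"
    using realization_iff[OF assms(1)] supp_scale[of "1 / ?m" c] m by simp
  show "c = (\<lambda>x. ?m * (1 / ?m * c x))" using m by auto
qed

lemma comb_scale: "finite (supp c) \<Longrightarrow> comb q (\<lambda>x. m * c x) = (\<lambda>i. m * comb q c i)"
  using comb_lincomb[of c c q m 0] by simp

text \<open>The cell spanned by each \<open>S\<close> generates a cone described by finitely many
  functionals. Once \<open>\<Delta>\<close> is cut along all of them, a face with an inner point in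
  a cell has all its vertices in the cone of that cell. So \<open>f\<close> is affine on every face,
  and its homogeneous extension is linear on every cone.\<close>

lemma pl_homeo_subdivision:
  fixes \<Delta> :: "'a set set" and \<Gamma> :: "'b set set"
  assumes inf: "infinite (UNIV :: 'a set)" and cx: "simplicial_complex \<Delta>" "{} \<in> \<Delta>"
    and cx': "simplicial_complex \<Gamma>" "{} \<in> \<Gamma>"
    and f: "bij_betw f (realization \<Delta>) (realization \<Gamma>)" and pl: "pl_map_on (realization \<Delta>) f"
  shows "\<exists>\<Sigma> p. edge_subdivided \<Delta> (\<lambda>x i. if i = x then 1 else 0) \<Sigma> p \<and> bij_betw (comb (\<lambda>x. f (p x))) (cone_of \<Sigma>) (cone_of \<Gamma>)"
proof -
  \<comment> \<open>Every vertex starts at its own unit vector, where \<open>comb\<close> is the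
    identity on the cone.\<close>
  define p0 :: "'a \<Rightarrow> 'a \<Rightarrow> real" where "p0 = (\<lambda>x i. if i = x then 1 else 0)"
  let ?I = "\<Union>\<Delta>"
  have finI: "finite ?I" by (rule complex_Union_finite[OF cx(1)])
  \<comment> \<open>The total mass, which is \<open>1\<close> exactly on the realization within the
    cone. New vertices are convex combinations of old ones and keep mass \<open>1\<close>, so
    \<open>comb p\<close> matches the two realizations.\<close>
  define L1 :: "('a \<Rightarrow> real) \<Rightarrow> real" where "L1 = (\<lambda>y. \<Sum>i\<in>?I. y i)"
  have linL1: "lin L1" by (simp add: lin_def L1_def sum.distrib sum_distrib_left)
  have cone_zero: "y i = 0" if "y \<in> cone_of \<Delta>" "i \<notin> ?I" for y i
    using that by (auto simp: cone_of_def supp_def)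
  have L1_cone: "L1 y = sum y (supp y)" if "y \<in> cone_of \<Delta>" for y
    unfolding L1_def by (rule sum_supp[OF finI]) (use that in \<open>auto simp: cone_of_def\<close>)
  have rD: "y \<in> realization \<Delta> \<longleftrightarrow> y \<in> cone_of \<Delta> \<and> L1 y = 1" for y
    using realization_iff[OF cx(1)] L1_cone by auto
  from pl obtain \<S> where "finite \<S>" and fS: "\<forall>S\<in>\<S>. finite S" and "realization \<Delta> = \<Union> (conv_hull_fun ` \<S>)"
    and aff': "\<forall>S\<in>\<S>. \<forall>c. (\<forall>s\<in>S. c s \<ge> 0) \<and> sum c S = 1 \<longrightarrow> f (conv_comb c id S) = conv_comb c f S"
    unfolding pl_map_on_def by (elim exE conjE) (rule that)
  note \<S> = this(1) bspec[OF fS] this(3)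
  have aff: "f (conv_comb c id S) = conv_comb c f S" if "S \<in> \<S>" "\<forall>s\<in>S. c s \<ge> 0" "sum c S = 1" for S c
    using bspec[OF aff' that(1)] that(2,3) by simp
  have S_real: "s \<in> realization \<Delta>" if "S \<in> \<S>" "s \<in> S" for S s
  proof -
    let ?c = "\<lambda>r. if r = s then 1 else (0::real)"
    have "conv_comb ?c id S = s"
    proof
      fix i
      have "(\<Sum>r\<in>S. ?c r * id r i) = (\<Sum>r\<in>S. if r = s then s i else 0)" by (rule sum.cong) auto
      then show "conv_comb ?c id S i = s i" using that \<S>(2)[OF that(1)] by (simp add: conv_comb_def)
    qed
    moreover have "sum ?c S = 1" using that \<S>(2)[OF that(1)] by simp
    ultimately have "s \<in> conv_hull_fun S"
      unfolding conv_hull_fun_def by (auto intro!: exI[of _ ?c])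
    then show ?thesis using \<S>(3) that by blast
  qed
  let ?P = "\<lambda>S \<Lambda>. finite \<Lambda> \<and> (\<forall>L\<in>\<Lambda>. lin L) \<and> (\<forall>y. (\<forall>i. i \<notin> ?I \<longrightarrow> y i = 0) \<longrightarrow>
    ((\<exists>c. (\<forall>s\<in>S. 0 \<le> c s) \<and> y = (\<lambda>i. \<Sum>s\<in>S. c s * s i)) \<longleftrightarrow> (\<forall>L\<in>\<Lambda>. 0 \<le> L y)))"
  have "\<forall>S\<in>\<S>. \<exists>\<Lambda>. ?P S \<Lambda>"
  proof
    fix S assume S: "S \<in> \<S>"
    have "s i = 0" if "s \<in> S" "i \<notin> ?I" for s i using S_real[OF S that(1)] rD cone_zero that(2) by blast
    then show "\<exists>\<Lambda>. ?P S \<Lambda>" by (rule cone_polyhedral[OF \<S>(2)[OF S] finI])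
  qed
  from bchoice[OF this] obtain \<Lambda> where \<Lambda>0: "\<forall>S\<in>\<S>. ?P S (\<Lambda> S)" by (elim exE) (rule that)
  have \<Lambda>1: "finite (\<Lambda> S)" if "S \<in> \<S>" for S using bspec[OF \<Lambda>0 that] by (elim conjE)
  have \<Lambda>2: "lin L" if "S \<in> \<S>" "L \<in> \<Lambda> S" for S L
    using bspec[OF bspec[OF \<Lambda>0 that(1), THEN conjunct2, THEN conjunct1] that(2)] .
  have \<Lambda>3: "(\<exists>c. (\<forall>s\<in>S. 0 \<le> c s) \<and> y = (\<lambda>i. \<Sum>s\<in>S. c s * s i)) \<longleftrightarrow> (\<forall>L\<in>\<Lambda> S. 0 \<le> L y)"
    if "S \<in> \<S>" "\<forall>i. i \<notin> ?I \<longrightarrow> y i = 0" for S y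
    using bspec[OF \<Lambda>0 that(1), THEN conjunct2, THEN conjunct2, THEN spec, THEN mp, OF that(2)] .
  have "finite (\<Union> (\<Lambda> ` \<S>))" "\<And>L. L \<in> \<Union> (\<Lambda> ` \<S>) \<Longrightarrow> lin L" using \<Lambda>1 \<Lambda>2 \<S>(1) by auto
  from slice[OF inf cx(1) this] obtain \<Sigma> p
    where e: "edge_subdivided \<Delta> p0 \<Sigma> p" and coh: "\<forall>L\<in>\<Union> (\<Lambda> ` \<S>). coherent \<Sigma> p L" by blast
  have cxS: "simplicial_complex \<Sigma>" by (rule edge_subdivided_complex[OF e cx(1)])
  have eS: "{} \<in> \<Sigma>" by (rule edge_subdivided_empty[OF e cx(2)])
  have "comb p0 c = c" if "c \<in> cone_of \<Delta>" for c
  proof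
    fix i
    show "comb p0 c i = c i"
      unfolding comb_def p0_def using cone_supp_finite[OF cx(1) that]
      by (simp add: if_distrib[of "\<lambda>x. _ * x"] sum.delta supp_def cong: if_cong)
  qed
  then have "bij_betw (comb p0) (cone_of \<Delta>) (cone_of \<Delta>)" by (simp add: bij_betw_def inj_on_def)
  then have bij: "bij_betw (comb p) (cone_of \<Sigma>) (cone_of \<Delta>)" by (rule edge_subdivided_bij[OF e cx(1)])
  have "\<forall>x\<in>\<Union>\<Delta>. L1 (p0 x) = 1" using finI by (simp add: L1_def p0_def)
  then have mass: "\<forall>x\<in>\<Union>\<Sigma>. L1 (p x) = 1"
    by (rule edge_subdivided_convex[OF e, where P = "\<lambda>y. L1 y = 1", rotated]) (simp add: linD[OF linL1])
  have p_cone: "p x \<in> cone_of \<Delta>" if "x \<in> \<Union>\<Sigma>" for x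
  proof -
    have "{x} \<in> \<Sigma>" using that complex_mem[OF cxS] by blast
    then have "comb p (\<lambda>y. if y = x then 1 else 0) \<in> cone_of \<Delta>"
      by (rule bspec[OF bij_betwE[OF bij] indicator_cone])
    then show ?thesis by (simp add: comb_indicator)
  qed
  have L1_comb: "L1 (comb p c) = sum c (supp c)" if "c \<in> cone_of \<Sigma>" for c
  proof -
    have "L1 (comb p c) = (\<Sum>x\<in>supp c. c x * L1 (p x))"
      by (rule lin_comb[OF linL1 cone_supp_finite[OF cxS that]]) simp
    also have "\<dots> = sum c (supp c)" by (rule sum.cong) (use mass that in \<open>auto simp: cone_of_def\<close>)
    finally show ?thesis .
  qed
  have comb_real: "comb p c \<in> realization \<Delta> \<longleftrightarrow> c \<in> realization \<Sigma>" if "c \<in> cone_of \<Sigma>" for c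
    unfolding rD realization_iff[OF cxS] using L1_comb[OF that] bspec[OF bij_betwE[OF bij] that] that by simp
  let ?q = "\<lambda>x. f (p x)"
  have affine: "f (comb p c) = comb ?q c" if c: "c \<in> realization \<Sigma>" for c
  proof -
    have cc: "c \<in> cone_of \<Sigma>" "sum c (supp c) = 1" using c realization_iff[OF cxS] by auto
    let ?H = "supp c" and ?y = "comb p c"
    have H: "?H \<in> \<Sigma>" "finite ?H" using cc cone_supp_finite[OF cxS] by (auto simp: cone_of_def)
    have pos: "0 < c x" if "x \<in> ?H" for x using that cc by (auto simp: cone_of_def supp_def less_le)
    have "?y \<in> realization \<Delta>" using comb_real[OF cc(1)] c by simp
    then obtain S where S: "S \<in> \<S>" "?y \<in> conv_hull_fun S" using \<S>(3) by blast
    have finS: "finite S" by (rule \<S>(2)[OF S(1)])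
    have y0: "\<forall>i. i \<notin> ?I \<longrightarrow> ?y i = 0" using \<open>?y \<in> realization \<Delta>\<close> rD cone_zero by blast
    have "\<exists>d. (\<forall>s\<in>S. 0 \<le> d s) \<and> ?y = (\<lambda>i. \<Sum>s\<in>S. d s * s i)"
      using S(2) unfolding conv_hull_fun_def conv_comb_def by auto
    then have Ly: "0 \<le> L ?y" if "L \<in> \<Lambda> S" for L using \<Lambda>3[OF S(1) y0] that by blast
    have "\<forall>x\<in>?H. \<exists>d. (\<forall>s\<in>S. 0 \<le> d s) \<and> p x = (\<lambda>i. \<Sum>s\<in>S. d s * s i)"
    proof
      fix x assume x: "x \<in> ?H"
      have xS: "x \<in> \<Union>\<Sigma>" using H x by blast
      have "0 \<le> L (p x)" if L: "L \<in> \<Lambda> S" for L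
      proof -
        have Lsum: "L ?y = (\<Sum>x\<in>?H. c x * L (p x))" by (rule lin_comb[OF \<Lambda>2[OF S(1) L] H(2)]) simp
        \<comment> \<open>\<open>?y\<close> has positive coefficients on all of \<open>?H\<close>.
          If \<open>L\<close> is nonpositive at all its vertices, then \<open>0 \<le> L ?y\<close>
          forces \<open>L\<close> to vanish at each of them.\<close>
        have "coherent \<Sigma> p L" using coh S(1) L by blast
        from coherent_face[OF this cxS H(1)] show ?thesis
        proof
          assume n: "\<forall>x\<in>?H. L (p x) \<le> 0"
          have np: "c z * L (p z) \<le> 0" if "z \<in> ?H" for z
            using n pos[OF that] that by (simp add: mult_nonneg_nonpos)
          have s0: "(\<Sum>x\<in>?H. - (c x * L (p x))) = 0"
          proof (rule antisym)
            show "(\<Sum>x\<in>?H. - (c x * L (p x))) \<le> 0" using Ly[OF L] Lsum by (simp add: sum_negf)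
            show "0 \<le> (\<Sum>x\<in>?H. - (c x * L (p x)))" by (rule sum_nonneg) (use np in simp)
          qed
          have "\<forall>x\<in>?H. c x * L (p x) = 0"
            using sum_nonneg_eq_0_iff[OF H(2), of "\<lambda>x. - (c x * L (p x))"] s0 np by simp
          then have "c x * L (p x) = 0" using x by (rule bspec)
          then show ?thesis using pos[OF x] by simp
        qed (use x in blast)
      qed
      then have "\<forall>L\<in>\<Lambda> S. 0 \<le> L (p x)" by (rule ballI)
      moreover have pz: "\<forall>i. i \<notin> ?I \<longrightarrow> p x i = 0" using cone_zero[OF p_cone[OF xS]] by simp
      ultimately show "\<exists>d. (\<forall>s\<in>S. 0 \<le> d s) \<and> p x = (\<lambda>i. \<Sum>s\<in>S. d s * s i)"
        by (intro iffD2[OF \<Lambda>3[OF S(1) pz]])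
    qed
    from bchoice[OF this] obtain d where d0: "\<forall>x\<in>?H. (\<forall>s\<in>S. 0 \<le> d x s) \<and> p x = (\<lambda>i. \<Sum>s\<in>S. d x s * s i)"
      by (elim exE) (rule that)
    have d: "\<And>x s. x \<in> ?H \<Longrightarrow> s \<in> S \<Longrightarrow> 0 \<le> d x s"
      "\<And>x. x \<in> ?H \<Longrightarrow> p x = (\<lambda>i. \<Sum>s\<in>S. d x s * s i)" using d0 by simp_all
    have dsum: "sum (d x) S = 1" if x: "x \<in> ?H" for x
    proof -
      have "x \<in> \<Union>\<Sigma>" using H x by blast
      then have "1 = L1 (p x)" by (rule bspec[OF mass, symmetric])
      also have "\<dots> = (\<Sum>s\<in>S. d x s * L1 s)" unfolding d(2)[OF x] by (rule lin_sum[OF linL1 finS])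
      also have "\<dots> = sum (d x) S" by (rule sum.cong) (use S_real[OF S(1)] rD in auto)
      finally show ?thesis by simp
    qed
    have fp: "f (p x) = (\<lambda>i. \<Sum>s\<in>S. d x s * f s i)" if x: "x \<in> ?H" for x
    proof -
      have "p x = conv_comb (d x) id S" using d(2)[OF x] by (simp add: conv_comb_def)
      then show ?thesis using aff[OF S(1) _ dsum[OF x]] d(1)[OF x] by (simp add: conv_comb_def)
    qed
    define D where "D s = (\<Sum>x\<in>?H. c x * d x s)" for s
    have D0: "\<forall>s\<in>S. 0 \<le> D s"
    proof
      fix s assume s: "s \<in> S"
      have "0 \<le> c x * d x s" if "x \<in> ?H" for x using d(1)[OF that s] pos[OF that] by simp
      then show "0 \<le> D s" unfolding D_def by (rule sum_nonneg)
    qed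
    have "sum D S = (\<Sum>x\<in>?H. c x * sum (d x) S)" unfolding D_def sum_distrib_left by (rule sum.swap)
    also have "\<dots> = 1" using dsum cc(2) by simp
    finally have D1: "sum D S = 1" .
    have swap: "(\<Sum>x\<in>?H. c x * (\<Sum>s\<in>S. d x s * g s)) = (\<Sum>s\<in>S. D s * g s)" for g
    proof -
      have "(\<Sum>x\<in>?H. c x * (\<Sum>s\<in>S. d x s * g s)) = (\<Sum>x\<in>?H. \<Sum>s\<in>S. c x * d x s * g s)"
        by (simp add: sum_distrib_left mult.assoc)
      also have "\<dots> = (\<Sum>s\<in>S. \<Sum>x\<in>?H. c x * d x s * g s)" by (rule sum.swap)
      finally show ?thesis by (simp add: D_def sum_distrib_right)
    qed
    have "?y i = conv_comb D id S i" for i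
    proof -
      have "?y i = (\<Sum>x\<in>?H. c x * (\<Sum>s\<in>S. d x s * s i))"
        unfolding comb_def by (rule sum.cong) (use d(2) in auto)
      then show ?thesis using swap[of "\<lambda>s. s i"] by (simp add: conv_comb_def)
    qed
    then have "?y = conv_comb D id S" by blast
    then have "f ?y = conv_comb D f S" using aff[OF S(1) D0 D1] by simp
    moreover have "comb ?q c i = conv_comb D f S i" for i
    proof -
      have "comb ?q c i = (\<Sum>x\<in>?H. c x * (\<Sum>s\<in>S. d x s * f s i))"
        unfolding comb_def by (rule sum.cong) (use fp in auto)
      then show ?thesis using swap[of "\<lambda>s. f s i"] by (simp add: conv_comb_def)
    qed
    ultimately show ?thesis by auto
  qed
  have real_map: "comb ?q c \<in> realization \<Gamma>" if "c \<in> realization \<Sigma>" for c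
  proof -
    have "comb p c \<in> realization \<Delta>" using comb_real[of c] that realization_iff[OF cxS] by simp
    then have "f (comb p c) \<in> realization \<Gamma>" by (rule bspec[OF bij_betwE[OF f]])
    then show ?thesis using affine[OF that] by simp
  qed
  have real_inj: "c = c'" if "c \<in> realization \<Sigma>" "c' \<in> realization \<Sigma>" "comb ?q c = comb ?q c'" for c c'
  proof -
    have "f (comb p c) = f (comb p c')" using affine that by simp
    moreover have "comb p c \<in> realization \<Delta>" "comb p c' \<in> realization \<Delta>"
      using comb_real[of c] comb_real[of c'] that realization_iff[OF cxS] by simp_all
    ultimately have "comb p c = comb p c'" by (rule inj_onD[OF bij_betw_imp_inj_on[OF f]])
    then show ?thesis
      by (rule inj_onD[OF bij_betw_imp_inj_on[OF bij]]) (use that realization_iff[OF cxS] in auto)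
  qed
  have zero: "c = (\<lambda>x. 0)" if "supp c = {}" for c :: "'c \<Rightarrow> real" using that by (auto simp: supp_def)
  have comb0: "comb ?q (\<lambda>x. 0) = (\<lambda>i. 0)" by (simp add: comb_def supp_def)
  have polarS: "\<exists>m c'. 0 < m \<and> c' \<in> realization \<Sigma> \<and> c = (\<lambda>x. m * c' x) \<and> comb ?q c = (\<lambda>i. m * comb ?q c' i)"
    if cc: "c \<in> cone_of \<Sigma>" "supp c \<noteq> {}" for c
  proof -
    obtain m c' where *: "0 < m" "c' \<in> realization \<Sigma>" "c = (\<lambda>x. m * c' x)"
      by (rule cone_polar[OF cxS cc])
    have "finite (supp c')" using *(2) realization_iff[OF cxS] cone_supp_finite[OF cxS] by blast
    from comb_scale[OF this, of ?q m] show ?thesis using * by (intro exI[of _ m] exI[of _ c']) simp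
  qed
  \<comment> \<open>The scale of a cone point can be recovered from the mass of its image, so
    bijectivity on the realizations extends to the cones.\<close>
  have sumy: "sum (\<lambda>i. m * y i) (supp (\<lambda>i. m * y i)) = m" if "y \<in> realization \<Gamma>" "0 < m" for m y
    using that realization_iff[OF cx'(1)] supp_scale[of m y] by (simp flip: sum_distrib_left)
  have "bij_betw (comb ?q) (cone_of \<Sigma>) (cone_of \<Gamma>)"
  proof (rule bij_betw_imageI)
    show "inj_on (comb ?q) (cone_of \<Sigma>)"
    proof (rule inj_onI)
      fix c d assume c: "c \<in> cone_of \<Sigma>" and d: "d \<in> cone_of \<Sigma>" and eq: "comb ?q c = comb ?q d"
      have nz: "comb ?q c \<noteq> (\<lambda>i. 0)" if cc: "c \<in> cone_of \<Sigma>" "supp c \<noteq> {}" for c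
      proof -
        obtain m c' where mc: "0 < m" "c' \<in> realization \<Sigma>" "comb ?q c = (\<lambda>i. m * comb ?q c' i)"
          using polarS[OF cc] by (elim exE conjE) (rule that)
        have "sum (comb ?q c) (supp (comb ?q c)) = m" unfolding mc(3) by (rule sumy[OF real_map[OF mc(2)] mc(1)])
        then show ?thesis using mc(1) by auto
      qed
      show "c = d"
      proof (cases "supp c = {} \<or> supp d = {}")
        case True
        have zq: "comb ?q x = (\<lambda>i. 0)" if "supp x = {}" for x using zero[OF that] comb0 by simp
        have "supp d = {}" if "supp c = {}" by (rule ccontr) (use nz[OF d] zq[OF that] eq in simp)
        moreover have "supp c = {}" if "supp d = {}" by (rule ccontr) (use nz[OF c] zq[OF that] eq in simp)
        ultimately have z: "supp c = {}" "supp d = {}" using True by metis+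
        show ?thesis by (rule trans[OF zero[OF z(1)] zero[OF z(2), symmetric]])
      next
        case False
        then have ne: "supp c \<noteq> {}" "supp d \<noteq> {}" by simp_all
        obtain m c' where *: "0 < m" "c' \<in> realization \<Sigma>" "c = (\<lambda>x. m * c' x)" "comb ?q c = (\<lambda>i. m * comb ?q c' i)"
          using polarS[OF c ne(1)] by (elim exE conjE) (rule that)
        obtain n d' where **: "0 < n" "d' \<in> realization \<Sigma>" "d = (\<lambda>x. n * d' x)" "comb ?q d = (\<lambda>i. n * comb ?q d' i)"
          using polarS[OF d ne(2)] by (elim exE conjE) (rule that)
        have fe: "(\<lambda>i. m * comb ?q c' i) = (\<lambda>i. n * comb ?q d' i)" using eq * ** by simp
        from arg_cong[OF this, of "\<lambda>y. sum y (supp y)"] have "m = n"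
          using sumy[OF real_map[OF *(2)] *(1)] sumy[OF real_map[OF **(2)] **(1)] by argo
        then have "comb ?q c' i = comb ?q d' i" for i using fun_cong[OF fe, of i] *(1) by simp
        then have "c' = d'" by (intro real_inj[OF *(2) **(2)] ext)
        then show ?thesis unfolding *(3) **(3) \<open>m = n\<close> by (rule arg_cong)
      qed
    qed
    show "comb ?q ` cone_of \<Sigma> = cone_of \<Gamma>"
    proof
      show "comb ?q ` cone_of \<Sigma> \<subseteq> cone_of \<Gamma>"
      proof
        fix y assume "y \<in> comb ?q ` cone_of \<Sigma>"
        then obtain c where c: "c \<in> cone_of \<Sigma>" "y = comb ?q c" by blast
        show "y \<in> cone_of \<Gamma>"
        proof (cases "supp c = {}")
          case True
          have "(\<lambda>i. 0) \<in> cone_of \<Gamma>" using cx'(2) by (simp add: cone_of_def supp_def)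
          then show ?thesis using c zero[OF True] comb0 by simp
        next
          case False
          then obtain m c' where mc: "0 < m" "c' \<in> realization \<Sigma>" "comb ?q c = (\<lambda>i. m * comb ?q c' i)"
            using polarS[OF c(1) False] by (elim exE conjE) (rule that)
          have "comb ?q c' \<in> cone_of \<Gamma>" using real_map[OF mc(2)] realization_iff[OF cx'(1)] by simp
          then show ?thesis unfolding c(2) mc(3) by (rule cone_scale[OF _ mc(1)])
        qed
      qed
      show "cone_of \<Gamma> \<subseteq> comb ?q ` cone_of \<Sigma>"
      proof
        fix y assume y: "y \<in> cone_of \<Gamma>"
        show "y \<in> comb ?q ` cone_of \<Sigma>"
        proof (cases "supp y = {}")
          case True
          have "(\<lambda>x. 0) \<in> cone_of \<Sigma>" using eS by (simp add: cone_of_def supp_def)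
          then show ?thesis by (rule image_eqI[rotated]) (simp add: zero[OF True] comb0)
        next
          case False
          obtain m y' where *: "0 < m" "y' \<in> realization \<Gamma>" "y = (\<lambda>x. m * y' x)" by (rule cone_polar[OF cx'(1) y False])
          have "y' \<in> f ` realization \<Delta>" using bij_betw_imp_surj_on[OF f] *(2) by simp
          then obtain z where z: "z \<in> realization \<Delta>" "y' = f z" by (rule imageE)
          have "z \<in> comb p ` cone_of \<Sigma>" using bij_betw_imp_surj_on[OF bij] z(1) rD by simp
          then obtain c where c: "z = comb p c" "c \<in> cone_of \<Sigma>" by (rule imageE)
          have cr: "c \<in> realization \<Sigma>" using comb_real[OF c(2)] z c by simp
          have "comb ?q (\<lambda>x. m * c x) = y"
            using comb_scale[OF cone_supp_finite[OF cxS c(2)], of ?q m] affine[OF cr] c z * by simp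
          then show ?thesis by (intro image_eqI[OF _ cone_scale[OF c(2) *(1)]]) simp
        qed
      qed
    qed
  qed
  then show ?thesis using e unfolding p0_def by blast
qed

subsection \<open>Complete simplicial fans\<close>

definition cspace :: "nat \<Rightarrow> (nat \<Rightarrow> real) set" where
  "cspace N = {y. \<forall>i\<ge>N. y i = 0}"

text \<open>The truncation of \<open>y\<close> to its first \<open>N\<close> coordinates makes the coordinates linear on the whole
  function space.\<close>

definition coord :: "('a \<Rightarrow> nat \<Rightarrow> real) \<Rightarrow> nat \<Rightarrow> 'a set \<Rightarrow> (nat \<Rightarrow> real) \<Rightarrow> 'a \<Rightarrow> real" where
  "coord q N F y = (SOME c. supp c \<subseteq> F \<and> comb q c = (\<lambda>i. if i < N then y i else 0))"

text \<open>For a facet \<open>F\<close> this is the linear function with value \<open>w x\<close>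
  at each vertex position \<open>q x\<close> of \<open>F\<close>.\<close>

definition ell :: "('a \<Rightarrow> nat \<Rightarrow> real) \<Rightarrow> nat \<Rightarrow> ('a \<Rightarrow> real) \<Rightarrow> 'a set \<Rightarrow> (nat \<Rightarrow> real) \<Rightarrow> real" where
  "ell q N w F y = (\<Sum>x\<in>F. coord q N F y x * w x)"

definition facets :: "'a set set \<Rightarrow> 'a set set" where
  "facets \<Sigma> = {F \<in> \<Sigma>. \<forall>G\<in>\<Sigma>. F \<subseteq> G \<longrightarrow> F = G}"

lemma facets_ex:
  assumes "simplicial_complex \<Sigma>" "H \<in> \<Sigma>"
  shows "\<exists>F\<in>facets \<Sigma>. H \<subseteq> F"
  using finite_has_maximal2[of \<Sigma> H] assms by (auto simp: facets_def simplicial_complex_def)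

lemma cspace_lincomb: "y \<in> cspace N \<Longrightarrow> z \<in> cspace N \<Longrightarrow> (\<lambda>i. s * y i + t * z i) \<in> cspace N"
  by (simp add: cspace_def)

lemma supp_lincomb:
  assumes "supp c \<subseteq> F" "supp c' \<subseteq> F"
  shows "supp (\<lambda>x. s * c x + t * c' x) \<subseteq> F"
proof (rule subsetI, rule ccontr)
  fix x assume x: "x \<in> supp (\<lambda>x. s * c x + t * c' x)" "x \<notin> F"
  then have "x \<notin> supp c" "x \<notin> supp c'" using assms by blast+
  then show False using x by (simp add: supp_def)
qed

text \<open>Gaussian elimination: a vector \<open>x0\<close> that is nonzero in coordinate
  \<open>j\<close> is used to clear that coordinate in all others.\<close>

lemma exists_kernel:
  fixes q :: "'x \<Rightarrow> 'j \<Rightarrow> real"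
  assumes "finite J" "finite X" "card J < card X"
  shows "\<exists>c. (\<exists>x\<in>X. c x \<noteq> 0) \<and> (\<forall>j\<in>J. (\<Sum>x\<in>X. c x * q x j) = 0)"
  using assms
proof (induction J arbitrary: X q)
  case empty
  then have "X \<noteq> {}" by auto
  then show ?case by (intro exI[of _ "\<lambda>_. 1"]) auto
next
  case (insert j J)
  show ?case
  proof (cases "\<forall>x\<in>X. q x j = 0")
    case True
    have "card J < card X" using insert by simp
    from insert.IH[OF insert.prems(1) this, of q] show ?thesis using True by auto
  next
    case False
    then obtain x0 where x0: "x0 \<in> X" "q x0 j \<noteq> 0" by blast
    let ?X = "X - {x0}" and ?q = "\<lambda>x i. q x i - q x j / q x0 j * q x0 i"
    have "card J < card ?X" using insert x0 by simp
    from insert.IH[OF _ this, of ?q] insert.prems(1) obtain c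
      where c: "\<exists>x\<in>?X. c x \<noteq> 0" "\<forall>i\<in>J. (\<Sum>x\<in>?X. c x * ?q x i) = 0" by auto
    define c' where "c' = c(x0 := - (\<Sum>x\<in>?X. c x * q x j) / q x0 j)"
    have "(\<Sum>x\<in>X. c' x * q x i) = (\<Sum>x\<in>?X. c x * ?q x i)" for i
    proof -
      have "(\<Sum>x\<in>X. c' x * q x i) = c' x0 * q x0 i + (\<Sum>x\<in>?X. c' x * q x i)"
        using x0 insert.prems(1) by (simp add: sum.remove)
      also have "(\<Sum>x\<in>?X. c' x * q x i) = (\<Sum>x\<in>?X. c x * q x i)" by (rule sum.cong) (auto simp: c'_def)
      also have "c' x0 * q x0 i = - (\<Sum>x\<in>?X. c x * (q x j / q x0 j * q x0 i))"
        by (simp add: c'_def sum_divide_distrib sum_distrib_right mult.assoc)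
      finally show ?thesis by (simp add: sum_subtractf right_diff_distrib)
    qed
    moreover have "(\<Sum>x\<in>?X. c x * ?q x j) = 0" using x0 by simp
    moreover have "\<exists>x\<in>X. c' x \<noteq> 0" using c(1) by (auto simp: c'_def)
    ultimately show ?thesis using c(2) by (intro exI[of _ c']) auto
  qed
qed

lemma exists_generic:
  assumes "finite \<L>" "\<And>L. L \<in> \<L> \<Longrightarrow> lin L \<and> (\<exists>z\<in>cspace N. L z \<noteq> 0)"
  shows "\<exists>u\<in>cspace N. \<forall>L\<in>\<L>. L u \<noteq> 0"
  using assms
proof (induction \<L>)
  case empty
  have "(\<lambda>i. 0) \<in> cspace N" by (simp add: cspace_def)
  then show ?case by blast
next
  case (insert L \<L>)
  then obtain u where u: "u \<in> cspace N" "\<forall>M\<in>\<L>. M u \<noteq> 0" by auto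
  obtain z where z: "z \<in> cspace N" "L z \<noteq> 0" using insert.prems by blast
  \<comment> \<open>On the line through \<open>u\<close> in direction \<open>z\<close>, each
    functional that is not constant vanishes for only one parameter; a functional with
    \<open>M z = 0\<close> keeps its nonzero value.\<close>
  have "finite ((\<lambda>M. - M u / M z) ` insert L \<L>)" using insert by simp
  then obtain t where t: "t \<notin> (\<lambda>M. - M u / M z) ` insert L \<L>"
    using ex_new_if_finite[OF infinite_UNIV_char_0[where 'a = real]] by blast
  have "M (\<lambda>i. 1 * u i + t * z i) \<noteq> 0" if M: "M \<in> insert L \<L>" for M
  proof
    assume "M (\<lambda>i. 1 * u i + t * z i) = 0"
    then have 0: "M u + t * M z = 0" using insert.prems[OF M] linD[of M 1 u t z] by simp
    show False
    proof (cases "M z = 0")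
      case True
      then show False using 0 u M z by auto
    next
      case False
      then have "t = - M u / M z" using 0 by (simp add: field_simps add_eq_0_iff)
      then show False using t M by blast
    qed
  qed
  then show ?case using cspace_lincomb[OF u(1) z(1), of 1 t] by blast
qed

text \<open>One bijection encodes a complete simplicial fan: surjectivity says that the cones cover
  the space, and injectivity that every point has unique coordinates in the cone of a unique
  smallest face.\<close>

locale fan =
  fixes \<Sigma> :: "'a set set" and q :: "'a \<Rightarrow> nat \<Rightarrow> real" and N :: nat
  assumes cx: "simplicial_complex \<Sigma>" and bij: "bij_betw (comb q) (cone_of \<Sigma>) (cspace N)"
begin

lemma face_finite: "F \<in> \<Sigma> \<Longrightarrow> finite F" by (rule complex_face_finite[OF cx])

lemma cone_inj: "c \<in> cone_of \<Sigma> \<Longrightarrow> c' \<in> cone_of \<Sigma> \<Longrightarrow> comb q c = comb q c' \<Longrightarrow> c = c'"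
  by (rule inj_onD[OF bij_betw_imp_inj_on[OF bij]])

lemma cone_ex: "y \<in> cspace N \<Longrightarrow> \<exists>c\<in>cone_of \<Sigma>. comb q c = y"
  using bij by (metis bij_betw_iff_bijections)

lemma vertex: "x \<in> \<Union>\<Sigma> \<Longrightarrow> {x} \<in> \<Sigma>"
proof -
  assume "x \<in> \<Union>\<Sigma>"
  then obtain F where F: "F \<in> \<Sigma>" "x \<in> F" by blast
  show ?thesis by (rule complex_mem[OF cx F(1)]) (use F in simp)
qed

lemma q_cspace: "x \<in> \<Union>\<Sigma> \<Longrightarrow> q x \<in> cspace N"
  using bspec[OF bij_betwE[OF bij] indicator_cone[OF vertex, of x]] by (simp add: comb_indicator)

lemma comb_cspace:
  assumes "F \<in> \<Sigma>" "supp c \<subseteq> F"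
  shows "comb q c \<in> cspace N"
proof -
  have "q x i = 0" if "x \<in> supp c" "N \<le> i" for x i
    using q_cspace[of x] assms that by (auto simp: cspace_def)
  then show ?thesis by (simp add: cspace_def comb_def)
qed

lemma cone_subset: "F \<in> \<Sigma> \<Longrightarrow> supp c \<subseteq> F \<Longrightarrow> (\<And>x. 0 \<le> c x) \<Longrightarrow> c \<in> cone_of \<Sigma>"
  using complex_mem[OF cx] by (simp add: cone_of_def)

lemma independent:
  assumes F: "F \<in> \<Sigma>" and c: "supp c \<subseteq> F" "supp c' \<subseteq> F" and eq: "comb q c = comb q c'"
  shows "c = c'"
proof -
  have fin: "finite F" "finite (supp c)" "finite (supp c')" using face_finite[OF F] c finite_subset by auto
  \<comment> \<open>Adding \<open>k\<close> times the sum of all vertices of \<open>F\<close> makes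
    both coefficient functions nonnegative, and then injectivity on the cone applies.\<close>
  define k where "k = (\<Sum>x\<in>F. \<bar>c x\<bar> + \<bar>c' x\<bar>)"
  let ?o = "\<lambda>x. if x \<in> F then 1 else (0::real)"
  have o: "supp ?o = F" by (auto simp: supp_def)
  have k: "\<bar>c x\<bar> + \<bar>c' x\<bar> \<le> k" if "x \<in> F" for x
    unfolding k_def by (rule member_le_sum[OF that _ fin(1)]) auto
  have out: "c x = 0" "c' x = 0" if "x \<notin> F" for x using c that by (auto simp: supp_def)
  have "(\<lambda>x. 1 * c x + k * ?o x) = (\<lambda>x. 1 * c' x + k * ?o x)"
  proof (rule cone_inj)
    have "0 \<le> 1 * c x + k * ?o x \<and> 0 \<le> 1 * c' x + k * ?o x" for x
      using k[of x] out[of x] by (cases "x \<in> F") auto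
    then show "(\<lambda>x. 1 * c x + k * ?o x) \<in> cone_of \<Sigma>" "(\<lambda>x. 1 * c' x + k * ?o x) \<in> cone_of \<Sigma>"
      by (intro cone_subset[OF F]; use out in \<open>auto simp: supp_def\<close>)+
    show "comb q (\<lambda>x. 1 * c x + k * ?o x) = comb q (\<lambda>x. 1 * c' x + k * ?o x)"
      using comb_lincomb[of c ?o q 1 k] comb_lincomb[of c' ?o q 1 k] fin eq o by simp
  qed
  then show ?thesis by (auto simp: fun_eq_iff)
qed

text \<open>If \<open>y + \<epsilon> z\<close> lies in a fixed cone for arbitrarily small \<open>\<epsilon>\<close>, its coordinates there are affine in
  \<open>\<epsilon>\<close>, so they stay nonnegative at \<open>\<epsilon> = 0\<close>.\<close>

lemma local_cone:
  assumes c: "c \<in> cone_of \<Sigma>" and z: "z \<in> cspace N"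
  shows "\<exists>H\<in>\<Sigma>. supp c \<subseteq> H \<and> (\<exists>\<epsilon>>0. \<exists>c'\<in>cone_of \<Sigma>. supp c' \<subseteq> H \<and> comb q c' = (\<lambda>i. comb q c i + \<epsilon> * z i))"
proof -
  define eps where "eps n = 1 / real (Suc n)" for n
  have cW: "comb q c \<in> cspace N" by (rule bspec[OF bij_betwE[OF bij] c])
  have "\<exists>r\<in>cone_of \<Sigma>. comb q r = (\<lambda>i. comb q c i + eps n * z i)" for n
    using cone_ex cspace_lincomb[OF cW z, of 1 "eps n"] by simp
  then obtain r where r: "\<And>n. r n \<in> cone_of \<Sigma>" "\<And>n. comb q (r n) = (\<lambda>i. comb q c i + eps n * z i)" by metis
  have rS: "supp (r n) \<in> \<Sigma>" "\<And>x. 0 \<le> r n x" for n using r(1) by (auto simp: cone_of_def)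
  \<comment> \<open>There are only finitely many faces, so a single one supports \<open>r n\<close>
    for infinitely many \<open>n\<close>, that is, for arbitrarily small
    \<open>\<epsilon>\<close>.\<close>
  have "finite ((\<lambda>n. supp (r n)) ` UNIV)"
    by (rule finite_subset[of _ \<Sigma>]) (use rS cx in \<open>auto simp: simplicial_complex_def\<close>)
  then obtain n0 where n0: "infinite {n \<in> UNIV. supp (r n) = supp (r n0)}"
    using pigeonhole_infinite[OF infinite_UNIV_nat] by blast
  let ?X = "{n. supp (r n) = supp (r n0)}" and ?H = "supp (r n0)"
  have inf: "\<exists>n>k. n \<in> ?X" for k using n0 by (simp add: infinite_nat_iff_unbounded)
  obtain n1 where n1: "n1 > n0" "supp (r n1) = ?H" using inf by auto
  let ?e0 = "eps n0" and ?e1 = "eps n1"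
  have de: "?e0 - ?e1 \<noteq> 0" "?e0 > 0" using n1 by (auto simp: eps_def)
  \<comment> \<open>Intercept and slope of the line through the coordinates at two parameters with
    this support. By independence the line gives the coordinates at all such parameters.\<close>
  define \<alpha> where "\<alpha> = (\<lambda>x. (?e0 / (?e0 - ?e1)) * r n1 x + (- ?e1 / (?e0 - ?e1)) * r n0 x)"
  define \<beta> where "\<beta> = (\<lambda>x. (1 / (?e0 - ?e1)) * r n0 x + (- 1 / (?e0 - ?e1)) * r n1 x)"
  have H: "?H \<in> \<Sigma>" "finite ?H" using rS face_finite by auto
  have \<alpha>H: "supp \<alpha> \<subseteq> ?H"
  proof
    fix x assume "x \<in> supp \<alpha>"
    then have "x \<in> supp (r n0) \<or> x \<in> supp (r n1)" by (auto simp: supp_def \<alpha>_def)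
    then show "x \<in> ?H" using n1 by blast
  qed
  have \<beta>H: "supp \<beta> \<subseteq> ?H"
  proof
    fix x assume "x \<in> supp \<beta>"
    then have "x \<in> supp (r n0) \<or> x \<in> supp (r n1)" by (auto simp: supp_def \<beta>_def)
    then show "x \<in> ?H" using n1 by blast
  qed
  have fin: "finite (supp (r n0))" "finite (supp (r n1))" "finite (supp \<alpha>)" "finite (supp \<beta>)"
    using H n1 \<alpha>H \<beta>H finite_subset by auto
  have c\<alpha>: "comb q \<alpha> = comb q c"
  proof
    fix i
    have "comb q \<alpha> i = (?e0 / (?e0 - ?e1)) * comb q (r n1) i + (- ?e1 / (?e0 - ?e1)) * comb q (r n0) i"
      unfolding \<alpha>_def by (rule fun_cong[OF comb_lincomb[OF fin(2,1)]])
    also have "\<dots> = (?e0 * (comb q c i + ?e1 * z i) - ?e1 * (comb q c i + ?e0 * z i)) / (?e0 - ?e1)"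
      by (simp add: r(2) diff_divide_distrib)
    also have "\<dots> = comb q c i"
    proof -
      have "?e0 * (comb q c i + ?e1 * z i) - ?e1 * (comb q c i + ?e0 * z i) = (?e0 - ?e1) * comb q c i"
        by (simp add: algebra_simps)
      then show ?thesis using de by simp
    qed
    finally show "comb q \<alpha> i = comb q c i" .
  qed
  have c\<beta>: "comb q \<beta> = z"
  proof
    fix i
    have "comb q \<beta> i = (1 / (?e0 - ?e1)) * comb q (r n0) i + (- 1 / (?e0 - ?e1)) * comb q (r n1) i"
      unfolding \<beta>_def by (rule fun_cong[OF comb_lincomb[OF fin(1,2)]])
    also have "\<dots> = ((comb q c i + ?e0 * z i) - (comb q c i + ?e1 * z i)) / (?e0 - ?e1)"
      by (simp add: r(2) diff_divide_distrib add_divide_distrib)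
    also have "\<dots> = z i"
    proof -
      have "(comb q c i + ?e0 * z i) - (comb q c i + ?e1 * z i) = (?e0 - ?e1) * z i" by (simp add: algebra_simps)
      then show ?thesis using de by simp
    qed
    finally show "comb q \<beta> i = z i" .
  qed
  have rn: "r n = (\<lambda>x. 1 * \<alpha> x + eps n * \<beta> x)" if "n \<in> ?X" for n
  proof (rule independent[OF H(1)])
    show "supp (r n) \<subseteq> ?H" using that by simp
    show "supp (\<lambda>x. 1 * \<alpha> x + eps n * \<beta> x) \<subseteq> ?H" by (rule supp_lincomb[OF \<alpha>H \<beta>H])
    show "comb q (r n) = comb q (\<lambda>x. 1 * \<alpha> x + eps n * \<beta> x)"
      unfolding comb_lincomb[OF fin(3,4)] c\<alpha> c\<beta> r(2) by simp
  qed
  have \<alpha>0: "0 \<le> \<alpha> x" for x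
  proof (rule ccontr)
    assume neg: "\<not> 0 \<le> \<alpha> x"
    obtain k where k: "\<bar>\<beta> x\<bar> / - \<alpha> x < real k" using reals_Archimedean2 by blast
    obtain n where n: "n > k" "n \<in> ?X" using inf by blast
    have "\<bar>\<beta> x\<bar> < real (Suc n) * - \<alpha> x"
    proof -
      have "\<bar>\<beta> x\<bar> < real k * - \<alpha> x" using k neg by (simp add: field_simps)
      also have "\<dots> \<le> real (Suc n) * - \<alpha> x" by (rule mult_right_mono) (use n neg in auto)
      finally show ?thesis .
    qed
    then have "\<bar>\<beta> x\<bar> / real (Suc n) < - \<alpha> x" by (simp add: field_simps)
    moreover have "eps n * \<beta> x \<le> \<bar>\<beta> x\<bar> / real (Suc n)" unfolding eps_def by (simp add: divide_right_mono)
    moreover have "0 \<le> \<alpha> x + eps n * \<beta> x" using rn[OF n(2)] rS(2)[of n x] by simp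
    ultimately show False by linarith
  qed
  have "\<alpha> = c" by (rule cone_inj[OF cone_subset[OF H(1) \<alpha>H \<alpha>0] c c\<alpha>])
  then have "supp c \<subseteq> ?H" using \<alpha>H by simp
  then show ?thesis using H(1) r[of n0] de(2) by blast
qed

lemma facet_face: "F \<in> facets \<Sigma> \<Longrightarrow> F \<in> \<Sigma>"
  by (simp add: facets_def)

lemma facet_eq: "F \<in> facets \<Sigma> \<Longrightarrow> G \<in> \<Sigma> \<Longrightarrow> F \<subseteq> G \<Longrightarrow> G = F"
  by (auto simp: facets_def)

lemma ones:
  assumes "F \<in> \<Sigma>"
  shows "supp (\<lambda>x. if x \<in> F then 1 else (0::real)) = F" "(\<lambda>x. if x \<in> F then 1 else 0) \<in> cone_of \<Sigma>"
proof -
  show "supp (\<lambda>x. if x \<in> F then 1 else (0::real)) = F" by (auto simp: supp_def)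
  then show "(\<lambda>x. if x \<in> F then 1 else 0) \<in> cone_of \<Sigma>" using assms by (simp add: cone_of_def)
qed

text \<open>A small step in direction \<open>z\<close> from the interior of the cone of
  \<open>F\<close> stays in the cone of a face containing \<open>F\<close>, that is, of
  \<open>F\<close> itself; so \<open>z\<close> is a combination of the vertices of
  \<open>F\<close>.\<close>

lemma facet_span:
  assumes F: "F \<in> facets \<Sigma>" and z: "z \<in> cspace N"
  shows "\<exists>c. supp c \<subseteq> F \<and> comb q c = z"
proof -
  let ?o = "\<lambda>x. if x \<in> F then 1 else (0::real)"
  note o = ones[OF facet_face[OF F]]
  from local_cone[OF o(2) z] obtain H \<epsilon> c' where H: "H \<in> \<Sigma>" "F \<subseteq> H" "\<epsilon> > 0" "c' \<in> cone_of \<Sigma>" "supp c' \<subseteq> H"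
    "comb q c' = (\<lambda>i. comb q ?o i + \<epsilon> * z i)" unfolding o(1) by blast
  have HF: "H = F" using facet_eq[OF F H(1,2)] .
  let ?c = "\<lambda>x. (1 / \<epsilon>) * c' x + (- 1 / \<epsilon>) * ?o x"
  have "comb q ?c = (\<lambda>i. (1 / \<epsilon>) * comb q c' i + (- 1 / \<epsilon>) * comb q ?o i)"
    by (rule comb_lincomb) (use cone_supp_finite[OF cx H(4)] o face_finite[OF facet_face[OF F]] in auto)
  also have "\<dots> = z" using H(3,6) by (auto simp: fun_eq_iff field_simps)
  finally have "comb q ?c = z" .
  moreover have "supp ?c \<subseteq> F" using H(5) HF by (auto simp: supp_def)
  ultimately show ?thesis by blast
qed

abbreviation co where "co \<equiv> coord q N"

lemma co_ex:
  assumes "F \<in> facets \<Sigma>"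
  shows "supp (co F y) \<subseteq> F" "comb q (co F y) = (\<lambda>i. if i < N then y i else 0)"
proof -
  have "(\<lambda>i. if i < N then y i else 0) \<in> cspace N" by (simp add: cspace_def)
  from someI_ex[OF facet_span[OF assms this]]
  show "supp (co F y) \<subseteq> F" "comb q (co F y) = (\<lambda>i. if i < N then y i else 0)" unfolding coord_def by auto
qed

lemma co_out: "F \<in> facets \<Sigma> \<Longrightarrow> x \<notin> F \<Longrightarrow> co F y x = 0"
  using co_ex(1)[of F y] by (auto simp: supp_def)

lemma co_cspace:
  assumes "F \<in> facets \<Sigma>" "y \<in> cspace N"
  shows "comb q (co F y) = y"
  using co_ex(2)[OF assms(1)] assms(2) by (auto simp: cspace_def fun_eq_iff)

lemma co_unique:
  assumes F: "F \<in> facets \<Sigma>" and c: "supp c \<subseteq> F" "comb q c = (\<lambda>i. if i < N then y i else 0)"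
  shows "co F y = c"
  using independent[OF facet_face[OF F] co_ex(1)[OF F] c(1)] co_ex(2)[OF F] c(2) by simp

lemma co_unique':
  assumes F: "F \<in> facets \<Sigma>" and c: "supp c \<subseteq> F" "comb q c = y"
  shows "co F y = c"
proof -
  have "y \<in> cspace N" using comb_cspace[OF facet_face[OF F] c(1)] c(2) by simp
  then have "comb q c = (\<lambda>i. if i < N then y i else 0)" using c by (auto simp: cspace_def fun_eq_iff)
  then show ?thesis by (rule co_unique[OF F c(1)])
qed

lemma co_lin: "F \<in> facets \<Sigma> \<Longrightarrow> lin (\<lambda>y. co F y x)"
  unfolding lin_def
proof (intro allI)
  fix s t y z assume F: "F \<in> facets \<Sigma>"
  have fin: "finite (supp (co F y))" for y using co_ex(1)[OF F] face_finite[OF facet_face[OF F]] finite_subset by blast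
  have "co F (\<lambda>i. s * y i + t * z i) = (\<lambda>x. s * co F y x + t * co F z x)"
  proof (rule co_unique[OF F])
    show "supp (\<lambda>x. s * co F y x + t * co F z x) \<subseteq> F" by (rule supp_lincomb[OF co_ex(1)[OF F] co_ex(1)[OF F]])
    show "comb q (\<lambda>x. s * co F y x + t * co F z x) = (\<lambda>i. if i < N then s * y i + t * z i else 0)"
      unfolding comb_lincomb[OF fin fin] co_ex(2)[OF F] by auto
  qed
  then show "co F (\<lambda>i. s * y i + t * z i) x = s * co F y x + t * co F z x" by simp
qed

lemma co_vertex: "F \<in> facets \<Sigma> \<Longrightarrow> x \<in> F \<Longrightarrow> co F (q x) = (\<lambda>y. if y = x then 1 else 0)"
  by (rule co_unique'[OF _ _ comb_indicator]) (auto simp: supp_def)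

lemma lin_expand:
  assumes "lin L" "F \<in> facets \<Sigma>" "y \<in> cspace N"
  shows "L y = (\<Sum>x\<in>F. co F y x * L (q x))"
proof -
  have "L y = L (comb q (co F y))" using co_cspace assms by simp
  also have "\<dots> = (\<Sum>x\<in>F. co F y x * L (q x))"
    by (rule lin_comb[OF assms(1) face_finite[OF facet_face[OF assms(2)]] co_ex(1)[OF assms(2)]])
  finally show ?thesis .
qed

lemma ell_lin: "F \<in> facets \<Sigma> \<Longrightarrow> lin (ell q N w F)"
proof -
  assume F: "F \<in> facets \<Sigma>"
  show ?thesis unfolding lin_def ell_def
    using linD[OF co_lin[OF F]] by (simp add: sum.distrib sum_distrib_left algebra_simps)
qed

lemma ell_vertex:
  assumes "F \<in> facets \<Sigma>" "x \<in> F"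
  shows "ell q N w F (q x) = w x"
  unfolding ell_def co_vertex[OF assms]
  using assms face_finite[OF facet_face[OF assms(1)]]
  by (simp add: if_distrib[of "\<lambda>x. x * _"] sum.delta cong: if_cong)

text \<open>Step from the interior of the cone of \<open>F - {x}\<close> away from
  \<open>q x\<close>. A facet that receives this step and contains \<open>x\<close> would be
  \<open>F\<close>, where the coordinate at \<open>x\<close> is negative.\<close>

lemma facet_adjacent:
  assumes F: "F \<in> facets \<Sigma>" and x: "x \<in> F"
  shows "\<exists>F'\<in>facets \<Sigma>. F - {x} \<subseteq> F' \<and> x \<notin> F'"
proof -
  let ?o = "\<lambda>y. if y \<in> F - {x} then 1 else (0::real)"
  have FS: "F - {x} \<in> \<Sigma>" by (rule complex_mem[OF cx facet_face[OF F]]) blast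
  have xS: "x \<in> \<Union>\<Sigma>" using facet_face[OF F] x by blast
  have z: "(\<lambda>i. - 1 * q x i) \<in> cspace N" using cspace_lincomb[OF q_cspace[OF xS] q_cspace[OF xS], of "-1" 0] by simp
  note o = ones[OF FS]
  from local_cone[OF o(2) z] obtain H \<epsilon> c' where H: "H \<in> \<Sigma>" "F - {x} \<subseteq> H" "\<epsilon> > 0" "c' \<in> cone_of \<Sigma>" "supp c' \<subseteq> H"
    "comb q c' = (\<lambda>i. comb q ?o i + \<epsilon> * (- 1 * q x i))" unfolding o(1) by blast
  obtain F' where F': "F' \<in> facets \<Sigma>" "H \<subseteq> F'" using facets_ex[OF cx H(1)] by blast
  have "x \<notin> F'"
  proof
    assume "x \<in> F'"
    then have FF: "F' = F" using facet_eq[OF F facet_face[OF F'(1)]] F' H(2) by blast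
    have "c' = (\<lambda>y. 1 * ?o y + (- \<epsilon>) * (if y = x then 1 else 0))"
    proof (rule independent[OF facet_face[OF F]])
      show "supp c' \<subseteq> F" using H(5) F' FF by blast
      show "supp (\<lambda>y. 1 * ?o y + (- \<epsilon>) * (if y = x then 1 else 0)) \<subseteq> F" using x by (auto simp: supp_def)
      have "supp (\<lambda>y. if y = x then 1 else (0::real)) = {x}" by (auto simp: supp_def)
      then have "comb q (\<lambda>y. 1 * ?o y + (- \<epsilon>) * (if y = x then 1 else 0)) = (\<lambda>i. 1 * comb q ?o i + (- \<epsilon>) * comb q (\<lambda>y. if y = x then 1 else 0) i)"
        by (intro comb_lincomb) (use o(1) face_finite[OF FS] in auto)
      then show "comb q c' = comb q (\<lambda>y. 1 * ?o y + (- \<epsilon>) * (if y = x then 1 else 0))"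
        unfolding H(6) comb_indicator by simp
    qed
    then have "c' x = - \<epsilon>" by simp
    moreover have "0 \<le> c' x" using H(4) by (simp add: cone_of_def)
    ultimately show False using H(3) by simp
  qed
  then show ?thesis using F' H(2) by blast
qed

lemma card_facet:
  assumes F: "F \<in> facets \<Sigma>"
  shows "card F = N"
proof (rule antisym)
  note finF = face_finite[OF facet_face[OF F]]
  show "card F \<le> N"
  proof (rule ccontr)
    assume "\<not> card F \<le> N"
    then have "card {..<N} < card F" by simp
    from exists_kernel[OF _ finF this, of q] obtain c
      where c: "\<exists>x\<in>F. c x \<noteq> 0" "\<forall>j\<in>{..<N}. (\<Sum>x\<in>F. c x * q x j) = 0" by auto
    let ?c = "\<lambda>x. if x \<in> F then c x else 0"
    have s: "supp ?c \<subseteq> F" "supp (\<lambda>x. 0 :: real) \<subseteq> F" by (auto simp: supp_def)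
    have "comb q ?c i = 0" for i
    proof (cases "i < N")
      case True
      have "comb q ?c i = (\<Sum>x\<in>F. ?c x * q x i)" by (rule comb_eq[OF finF s(1)])
      also have "\<dots> = (\<Sum>x\<in>F. c x * q x i)" by (rule sum.cong) auto
      finally show ?thesis using c(2) True by simp
    next
      case False
      then show ?thesis using comb_cspace[OF facet_face[OF F] s(1)] by (simp add: cspace_def)
    qed
    then have "comb q ?c = comb q (\<lambda>x. 0)" by (auto simp: comb_def supp_def)
    then have "?c = (\<lambda>x. 0)" by (rule independent[OF facet_face[OF F] s])
    then show False using c(1) by (metis)
  qed
  show "N \<le> card F"
  proof (rule ccontr)
    assume "\<not> N \<le> card F"
    then have "card F < card {..<N}" by simp
    \<comment> \<open>With fewer than \<open>N\<close> vertices, the coordinate vectors of the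
      \<open>N\<close> unit vectors are linearly dependent. This yields a nonzero vector whose
      coordinates with respect to \<open>F\<close> all vanish.\<close>
    let ?e = "\<lambda>j i. if i = j then 1 else (0::real)"
    from exists_kernel[OF finF _ \<open>card F < card {..<N}\<close>, of "\<lambda>j. co F (?e j)"] obtain d
      where d: "\<exists>j\<in>{..<N}. d j \<noteq> 0" "\<forall>x\<in>F. (\<Sum>j\<in>{..<N}. d j * co F (?e j) x) = 0" by auto
    let ?y = "\<lambda>i. \<Sum>j\<in>{..<N}. d j * ?e j i"
    have y: "?y i = (if i < N then d i else 0)" for i
      by (simp add: if_distrib[of "\<lambda>x. _ * x"] sum.delta cong: if_cong)
    have "co F ?y x = 0" for x
    proof (cases "x \<in> F")
      case True
      then show ?thesis using lin_sum[OF co_lin[OF F, of x] finite_lessThan, of d ?e N] d(2) by simp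
    next
      case False
      then show ?thesis using co_ex(1)[OF F, of ?y] by (auto simp: supp_def)
    qed
    then have "co F ?y = (\<lambda>x. 0)" by blast
    then have "comb q (co F ?y) = (\<lambda>i. 0)" by (simp add: comb_def supp_def)
    then have "(\<lambda>i. if i < N then ?y i else 0) = (\<lambda>i. 0)" using co_ex(2)[OF F, of ?y] by simp
    then have "d i = 0" if "i < N" for i using that y[of i] by (metis (mono_tags, lifting))
    then show False using d(1) by auto
  qed
qed

lemma pure: "pure N \<Sigma>"
  unfolding pure_def
proof
  fix Y assume Y: "Y \<in> \<Sigma>"
  then obtain F where F: "F \<in> facets \<Sigma>" "Y \<subseteq> F" using facets_ex[OF cx] by blast
  then show "card Y \<le> N \<and> (\<exists>Z\<in>\<Sigma>. Y \<subseteq> Z \<and> card Z = N)"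
    using card_facet[OF F(1)] facet_face[OF F(1)] card_mono[OF face_finite F(2)] by auto
qed

text \<open>The line shelling of Bruggesser and Mani: the facets are ordered by the value at a generic
  point \<open>u\<close> of the linear functions that make up the strictly convex function with vertex values \<open>w\<close>.\<close>

lemma regular_bishelling:
  assumes w: "\<And>F x. F \<in> facets \<Sigma> \<Longrightarrow> x \<in> \<Union>\<Sigma> \<Longrightarrow> x \<notin> F \<Longrightarrow> ell q N w F (q x) < w x"
  shows "\<exists>u. bishelling (facets \<Sigma>) (\<lambda>F. ell q N w F u) (\<lambda>F. {x \<in> F. co F u x < 0})"
proof -
  have finfac: "finite (facets \<Sigma>)" using cx by (simp add: facets_def simplicial_complex_def)
  let ?L = "(\<lambda>(F, x) y. co F y x) ` (SIGMA F:facets \<Sigma>. F)"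
  have "finite ?L" using finfac face_finite facet_face by (intro finite_imageI finite_SigmaI) auto
  moreover have "lin L \<and> (\<exists>z\<in>cspace N. L z \<noteq> 0)" if L: "L \<in> ?L" for L
  proof -
    obtain F x where Fx: "F \<in> facets \<Sigma>" "x \<in> F" "L = (\<lambda>y. co F y x)" using L by auto
    have "x \<in> \<Union>\<Sigma>" using Fx facet_face by blast
    then show ?thesis using co_lin[OF Fx(1)] Fx co_vertex[OF Fx(1,2)] q_cspace by (auto intro!: bexI[of _ "q x"])
  qed
  ultimately have "\<exists>u\<in>cspace N. \<forall>L\<in>?L. L u \<noteq> 0" by (rule exists_generic)
  then obtain u where u: "u \<in> cspace N" and u': "\<forall>L\<in>?L. L u \<noteq> 0" by (rule bexE)
  have ne: "co F u x \<noteq> 0" if "F \<in> facets \<Sigma>" "x \<in> F" for F x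
  proof -
    have "(\<lambda>y. co F y x) \<in> ?L" by (rule image_eqI[of _ _ "(F, x)"]) (use that in auto)
    from bspec[OF u' this] show ?thesis .
  qed
  let ?l = "\<lambda>F. ell q N w F u"
  have V: "x \<in> \<Union>\<Sigma>" if "F \<in> facets \<Sigma>" "x \<in> F" for F x using that facet_face by blast
  \<comment> \<open>Vertices common to both facets contribute nothing, and by convexity the second
    factor is negative at the others. So the signs of the coordinates of \<open>u\<close> decide
    which facet comes first, and for an adjacent facet a single sign does.\<close>
  have diff: "?l F' - ?l F = (\<Sum>x\<in>F - F'. co F u x * (ell q N w F' (q x) - w x))"
    if F: "F \<in> facets \<Sigma>" and F': "F' \<in> facets \<Sigma>" for F F'
  proof -
    have finF: "finite F" using F face_finite facet_face by blast
    have "?l F' = (\<Sum>x\<in>F. co F u x * ell q N w F' (q x))" by (rule lin_expand[OF ell_lin[OF F'] F u])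
    then have "?l F' - ?l F = (\<Sum>x\<in>F. co F u x * (ell q N w F' (q x) - w x))"
      unfolding ell_def[of q N w F] by (simp add: sum_subtractf right_diff_distrib)
    also have "\<dots> = (\<Sum>x\<in>F - F'. co F u x * (ell q N w F' (q x) - w x))"
      by (rule sum.mono_neutral_right) (use finF ell_vertex[OF F'] in auto)
    finally show ?thesis .
  qed
  have neg: "ell q N w F' (q x) - w x < 0" if "F \<in> facets \<Sigma>" "F' \<in> facets \<Sigma>" "x \<in> F - F'" for F F' x
    using w[OF that(2) V[OF that(1)]] that(3) by simp
  have sub: "F - F' \<noteq> {} \<and> finite (F - F')" if "F \<in> facets \<Sigma>" "F' \<in> facets \<Sigma>" "F \<noteq> F'" for F F'
    using facet_eq[OF that(1) facet_face[OF that(2)]] that face_finite facet_face by blast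
  have "bishelling (facets \<Sigma>) ?l (\<lambda>F. {x \<in> F. co F u x < 0})"
  proof unfold_locales
    show "finite (facets \<Sigma>)" by fact
    show "finite F" if "F \<in> facets \<Sigma>" for F using that face_finite facet_face by blast
    show "{x \<in> F. co F u x < 0} \<subseteq> F" for F by blast
  next
    fix F F' assume F: "F \<in> facets \<Sigma>" "F' \<in> facets \<Sigma>" "F \<noteq> F'" and R: "{x \<in> F. co F u x < 0} \<subseteq> F'"
    have "0 < (\<Sum>x\<in>F - F'. - (co F u x * (ell q N w F' (q x) - w x)))"
    proof (rule sum_pos)
      fix x assume x: "x \<in> F - F'"
      then have "co F u x > 0" using R ne[OF F(1), of x] by force
      then show "0 < - (co F u x * (ell q N w F' (q x) - w x))" using neg[OF F(1,2) x] by (simp add: mult_pos_neg)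
    qed (use sub[OF F] in auto)
    then show "?l F' < ?l F" using diff[OF F(1,2)] by (simp add: sum_negf)
  next
    fix F F' assume F: "F \<in> facets \<Sigma>" "F' \<in> facets \<Sigma>" "F \<noteq> F'" and R: "F - {x \<in> F. co F u x < 0} \<subseteq> F'"
    have "0 < (\<Sum>x\<in>F - F'. co F u x * (ell q N w F' (q x) - w x))"
    proof (rule sum_pos)
      fix x assume x: "x \<in> F - F'"
      then have "co F u x < 0" using R ne[OF F(1), of x] by force
      then show "0 < co F u x * (ell q N w F' (q x) - w x)" using neg[OF F(1,2) x] by (simp add: mult_neg_neg)
    qed (use sub[OF F] in auto)
    then show "?l F < ?l F'" using diff[OF F(1,2)] by simp
  next
    fix F x assume F: "F \<in> facets \<Sigma>" and x: "x \<in> {x \<in> F. co F u x < 0}"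
    obtain F' where F': "F' \<in> facets \<Sigma>" "F - {x} \<subseteq> F'" "x \<notin> F'" using facet_adjacent[OF F] x by blast
    have "F - F' = {x}" using F' x by blast
    then have "?l F' - ?l F = co F u x * (ell q N w F' (q x) - w x)" using diff[OF F F'(1)] by simp
    also have "\<dots> > 0" using neg[OF F F'(1), of x] x F' by (simp add: mult_neg_neg)
    finally have "?l F < ?l F'" by simp
    then show "\<exists>F'\<in>facets \<Sigma>. F - {x} \<subseteq> F' \<and> ?l F < ?l F'" using F'(2) by (intro bexI[OF _ F'(1)]) simp
  next
    fix F x assume F: "F \<in> facets \<Sigma>" and x: "x \<in> F - {x \<in> F. co F u x < 0}"
    obtain F' where F': "F' \<in> facets \<Sigma>" "F - {x} \<subseteq> F'" "x \<notin> F'" using facet_adjacent[OF F] x by blast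
    have "F - F' = {x}" using F' x by blast
    then have "?l F' - ?l F = co F u x * (ell q N w F' (q x) - w x)" using diff[OF F F'(1)] by simp
    also have "\<dots> < 0"
    proof -
      have "co F u x > 0" using x ne[OF F, of x] by force
      then show ?thesis using neg[OF F F'(1), of x] x F' by (simp add: mult_pos_neg)
    qed
    finally have "?l F' < ?l F" by simp
    then show "\<exists>F'\<in>facets \<Sigma>. F - {x} \<subseteq> F' \<and> ?l F' < ?l F" using F'(2) by (intro bexI[OF _ F'(1)]) simp
  qed
  then show ?thesis by blast
qed

lemma regular_good:
  assumes "infinite (UNIV :: 'a set)"
    and "\<And>F x. F \<in> facets \<Sigma> \<Longrightarrow> x \<in> \<Union>\<Sigma> \<Longrightarrow> x \<notin> F \<Longrightarrow> ell q N w F (q x) < w x"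
  shows "good \<Sigma>"
proof -
  obtain u where "bishelling (facets \<Sigma>) (\<lambda>F. ell q N w F u) (\<lambda>F. {x \<in> F. co F u x < 0})"
    using regular_bishelling[OF assms(2)] by blast
  then have "good (\<Union>F\<in>facets \<Sigma>. Pow F)" by (rule bishelling_good[OF assms(1)])
  moreover have "(\<Union>F\<in>facets \<Sigma>. Pow F) = \<Sigma>"
    using facets_ex[OF cx] complex_mem[OF cx facet_face] by blast
  ultimately show ?thesis by simp
qed

end

subsection \<open>Regular subdivisions of fans\<close>

text \<open>For \<open>y\<close> in the space covered by the fan, this is the unique face whose
  relatively open cone contains \<open>y\<close>.\<close>

definition carrier_face :: "'a set set \<Rightarrow> ('a \<Rightarrow> nat \<Rightarrow> real) \<Rightarrow> (nat \<Rightarrow> real) \<Rightarrow> 'a set" where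
  "carrier_face \<Sigma> q y = supp (inv_into (cone_of \<Sigma>) (comb q) y)"

context fan
begin

abbreviation rep where "rep \<equiv> inv_into (cone_of \<Sigma>) (comb q)"

lemma rep:
  assumes "y \<in> cspace N"
  shows "rep y \<in> cone_of \<Sigma>" "comb q (rep y) = y"
proof -
  have "y \<in> comb q ` cone_of \<Sigma>" using bij_betw_imp_surj_on[OF bij] assms by simp
  then show "rep y \<in> cone_of \<Sigma>" "comb q (rep y) = y" by (rule inv_into_into, rule f_inv_into_f)
qed

lemma rep_unique: "c \<in> cone_of \<Sigma> \<Longrightarrow> comb q c = y \<Longrightarrow> rep y = c"
  using inv_into_f_f[OF bij_betw_imp_inj_on[OF bij]] by auto

lemma carrier_face_vertex:
  assumes "x \<in> \<Union>\<Sigma>"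
  shows "carrier_face \<Sigma> q (q x) = {x}"
proof -
  have "rep (q x) = (\<lambda>y. if y = x then 1 else 0)"
    by (rule rep_unique[OF indicator_cone[OF vertex[OF assms]] comb_indicator])
  then show ?thesis by (auto simp: carrier_face_def supp_def)
qed

text \<open>Inside a common cone the coordinates of the two points are nonnegative, so a combination
  with positive weights cancels none of them.\<close>

lemma carrier_face_segment:
  assumes y: "y \<in> cspace N" "z \<in> cspace N" and t: "0 < t" "t < 1"
    and un: "carrier_face \<Sigma> q y \<union> carrier_face \<Sigma> q z \<in> \<Sigma>"
  shows "carrier_face \<Sigma> q (\<lambda>i. (1 - t) * y i + t * z i) = carrier_face \<Sigma> q y \<union> carrier_face \<Sigma> q z"
proof -
  let ?c = "\<lambda>x. (1 - t) * rep y x + t * rep z x"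
  have nn: "0 \<le> rep y x" "0 \<le> rep z x" for x using rep(1)[OF y(1)] rep(1)[OF y(2)] by (auto simp: cone_of_def)
  have s: "supp ?c = supp (rep y) \<union> supp (rep z)"
  proof (rule set_eqI)
    fix x
    have "(1 - t) * rep y x + t * rep z x = 0 \<longleftrightarrow> (1 - t) * rep y x = 0 \<and> t * rep z x = 0"
      by (rule add_nonneg_eq_0_iff) (use nn t in simp_all)
    then show "x \<in> supp ?c \<longleftrightarrow> x \<in> supp (rep y) \<union> supp (rep z)" using t by (auto simp: supp_def)
  qed
  have "rep (\<lambda>i. (1 - t) * y i + t * z i) = ?c"
  proof (rule rep_unique)
    show "?c \<in> cone_of \<Sigma>" using un nn t s by (simp add: cone_of_def carrier_face_def)
    have "comb q ?c = (\<lambda>i. (1 - t) * comb q (rep y) i + t * comb q (rep z) i)"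
      by (rule comb_lincomb) (use rep(1) y cone_supp_finite[OF cx] in auto)
    then show "comb q ?c = (\<lambda>i. (1 - t) * y i + t * z i)" by (simp add: rep(2) y)
  qed
  then show ?thesis using s by (simp add: carrier_face_def)
qed

lemma co_rep:
  assumes F: "F \<in> facets \<Sigma>" and y: "y \<in> cspace N" and s: "carrier_face \<Sigma> q y \<subseteq> F"
  shows "co F y = rep y"
  by (rule co_unique'[OF F _ rep(2)[OF y]]) (use s in \<open>simp add: carrier_face_def\<close>)

end

lemma facets_stellar:
  assumes cx: "simplicial_complex \<Sigma>" and e: "{a, b} \<in> \<Sigma>" "a \<noteq> b" and v: "v \<notin> \<Union>\<Sigma>"
    and F: "F \<in> facets (stellar \<Sigma> {a, b} v)"
  obtains "v \<notin> F" "F \<in> facets \<Sigma>" "\<not> {a, b} \<subseteq> F"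
  | G where "G \<in> facets \<Sigma>" "{a, b} \<subseteq> G" "F = insert v (G - {a})"
  | G where "G \<in> facets \<Sigma>" "{a, b} \<subseteq> G" "F = insert v (G - {b})"
proof -
  let ?S' = "stellar \<Sigma> {a, b} v"
  have FS: "F \<in> ?S'" and mx: "\<And>G. G \<in> ?S' \<Longrightarrow> F \<subseteq> G \<Longrightarrow> F = G" using F by (auto simp: facets_def)
  have ab: "a \<noteq> v" "b \<noteq> v" using e v by auto
  have ins: "insert v (Y - {x}) \<in> ?S'" if Y: "Y \<in> \<Sigma>" "{a, b} \<subseteq> Y" "x \<in> {a, b}" for Y x
  proof -
    have vY: "v \<notin> Y" using v Y(1) by blast
    have 1: "insert v (Y - {x}) - {v} \<union> {a, b} = Y" using vY Y(2,3) by blast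
    have 2: "\<not> {a, b} \<subseteq> insert v (Y - {x})" using Y(3) ab by auto
    show ?thesis unfolding stellar_def mem_Collect_eq 1 using 2 Y(1) by (intro conjI) simp_all
  qed
  show thesis
  proof (cases "v \<in> F")
    case False
    then have F1: "F \<in> \<Sigma>" "\<not> {a, b} \<subseteq> F" using FS by (auto simp: stellar_def)
    have "F = Y" if Y: "Y \<in> \<Sigma>" "F \<subseteq> Y" for Y
    proof (cases "{a, b} \<subseteq> Y")
      case True
      obtain x where x: "x \<in> {a, b}" "x \<notin> F" using F1 by blast
      then have "F \<subseteq> insert v (Y - {x})" using Y by blast
      from mx[OF ins[OF Y(1) True x(1)] this] show ?thesis using False by blast
    next
      case nF: False
      have "v \<notin> Y" using v Y(1) by blast
      then have "Y \<in> ?S'" using nF Y(1) by (simp add: stellar_def)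
      then show ?thesis using mx Y(2) by simp
    qed
    then have "F \<in> facets \<Sigma>" using F1(1) by (simp add: facets_def)
    then show thesis using that(1) False F1 by simp
  next
    case True
    let ?G = "F - {v} \<union> {a, b}"
    have G: "?G \<in> \<Sigma>" "\<not> {a, b} \<subseteq> F" using FS True by (auto simp: stellar_def)
    have vG: "v \<notin> ?G" using v G(1) by blast
    obtain x where x: "x \<in> {a, b}" "x \<notin> F" using G(2) by blast
    have "F \<subseteq> insert v (?G - {x})" using x by blast
    from mx[OF ins[OF G(1) _ x(1)] this] have Fx: "F = insert v (?G - {x})" by blast
    have "?G = Y" if Y: "Y \<in> \<Sigma>" "?G \<subseteq> Y" for Y
    proof -
      have "{a, b} \<subseteq> Y" using Y by blast
      have "F \<subseteq> insert v (Y - {x})" using Y x by blast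
      from mx[OF ins[OF Y(1) \<open>{a, b} \<subseteq> Y\<close> x(1)] this] have "F = insert v (Y - {x})" .
      moreover have "v \<notin> Y" using v Y(1) by blast
      ultimately have "F - {v} = Y - {x}" by blast
      then show ?thesis using \<open>{a, b} \<subseteq> Y\<close> x by blast
    qed
    then have GF: "?G \<in> facets \<Sigma>" using G(1) unfolding facets_def by blast
    have sub: "{a, b} \<subseteq> ?G" by blast
    show thesis
    proof (cases "x = a")
      case True
      show thesis by (rule that(2)[OF GF sub]) (use Fx True in simp)
    next
      case False
      then have "x = b" using x by simp
      show thesis by (rule that(3)[OF GF sub]) (use Fx \<open>x = b\<close> in simp)
    qed
  qed
qed

text \<open>The value at \<open>v\<close> lies \<open>\<epsilon>\<close> below the interpolation
  along the edge. So the linear function on the new facet drops by \<open>\<epsilon>\<close> times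
  the coordinate at \<open>v\<close>, which must account for the whole former coordinate at
  \<open>a\<close>, namely \<open>(1 - t)\<close> times itself.\<close>

lemma ell_subdivide:
  fixes \<Sigma> :: "'a set set"
  assumes "fan \<Sigma> q N" "fan \<Sigma>' q' N" "edge_subdivision \<Sigma> a b v t"
    and q': "q' = q(v := (\<lambda>i. (1 - t) * q a i + t * q b i))"
    and G: "G \<in> facets \<Sigma>" "{a, b} \<subseteq> G" and F: "insert v (G - {a}) \<in> facets \<Sigma>'"
    and \<phi>': "\<And>x. x \<noteq> v \<Longrightarrow> \<phi>' x = \<phi> x" "\<phi>' v = (1 - t) * \<phi> a + t * \<phi> b - \<epsilon>"
  shows "ell q' N \<phi>' (insert v (G - {a})) y = ell q N \<phi> G y - \<epsilon> * (coord q N G y a / (1 - t))"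
proof -
  interpret F: fan \<Sigma> q N by fact
  interpret F': fan \<Sigma>' q' N by fact
  interpret edge_subdivision \<Sigma> a b v t by fact
  let ?F = "insert v (G - {a})"
  define c where "c = coord q N G y"
  define c' where "c' = (\<lambda>x. if x = v then c a / (1 - t) else if x = a then 0
    else if x = b then c b - t * (c a / (1 - t)) else c x)"
  have vG: "v \<notin> G" using v F.facet_face[OF G(1)] by blast
  have finG: "finite G" by (rule F.face_finite[OF F.facet_face[OF G(1)]])
  have out: "c x = 0" if "x \<notin> G" for x unfolding c_def by (rule F.co_out[OF G(1) that])
  have sc': "supp c' \<subseteq> ?F" using out G(2) by (auto simp: supp_def c'_def split: if_splits)
  have "T c' = c"
  proof
    fix x
    have t1: "1 - t \<noteq> 0" using t by simp
    have "(1 - t) * (c a / (1 - t)) = c a" using t1 by simp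
    then show "T c' x = c x" using ab e(2) out[OF vG] by (auto simp: T_def c'_def)
  qed
  moreover have "finite (supp c')" using sc' finG finite_subset by blast
  ultimately have "comb q' c' = comb q c" using T_comb[of c' q] q' by simp
  then have "comb q' c' = (\<lambda>i. if i < N then y i else 0)" using F.co_ex(2)[OF G(1)] by (simp add: c_def)
  then have cc': "coord q' N ?F y = c'" by (rule F'.co_unique[OF F sc'])
  let ?R = "G - {a, b}"
  have GR: "G = insert a (insert b ?R)" using G(2) by blast
  have FR: "?F = insert v (insert b ?R)" using G(2) e(2) by blast
  have R: "finite ?R" "a \<notin> ?R" "b \<notin> ?R" "v \<notin> ?R" using finG vG by auto
  have "(\<Sum>x\<in>?R. c' x * \<phi>' x) = (\<Sum>x\<in>?R. c x * \<phi> x)"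
  proof (rule sum.cong[OF refl])
    fix x assume "x \<in> ?R"
    then have "x \<noteq> a" "x \<noteq> b" "x \<noteq> v" using R(4) by auto
    then show "c' x * \<phi>' x = c x * \<phi> x" using \<phi>'(1) by (simp add: c'_def)
  qed
  moreover have "ell q' N \<phi>' ?F y = c' v * \<phi>' v + (c' b * \<phi>' b + (\<Sum>x\<in>?R. c' x * \<phi>' x))"
    unfolding ell_def cc' by (subst FR) (use R ab in simp)
  moreover have "ell q N \<phi> G y = c a * \<phi> a + (c b * \<phi> b + (\<Sum>x\<in>?R. c x * \<phi> x))"
    unfolding ell_def c_def[symmetric] by (subst GR) (use R e(2) in simp)
  moreover have "c' v * \<phi>' v + c' b * \<phi>' b = c a * \<phi> a + c b * \<phi> b - \<epsilon> * (c a / (1 - t))"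
  proof -
    define k where "k = c a / (1 - t)"
    have k: "c a / (1 - t) = k" "c a = (1 - t) * k" using t by (simp_all add: k_def)
    have cv: "c' v = k" "c' b = c b - t * k" using k(1) ab e(2) by (auto simp: c'_def)
    show ?thesis unfolding cv \<phi>'(2) \<phi>'(1)[OF ab(2)] k(1) unfolding k(2) by (simp add: algebra_simps)
  qed
  ultimately show ?thesis unfolding c_def by simp
qed

lemma eventually_perturb:
  fixes \<alpha> \<beta> \<gamma> :: real
  assumes "\<alpha> < \<beta>"
  shows "\<forall>\<^sub>F \<epsilon> in at_right 0. \<alpha> + \<epsilon> * \<gamma> < \<beta>"
proof -
  have "((\<lambda>\<epsilon>. \<alpha> + \<epsilon> * \<gamma>) \<longlongrightarrow> \<alpha> + 0 * \<gamma>) (at_right 0)" by (intro tendsto_intros)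
  then show ?thesis using assms by (intro order_tendstoD(2)) auto
qed

text \<open>\<open>\<phi>\<close> is strictly convex on each cone of the coarse fan \<open>\<Sigma>0\<close>.\<close>

definition relatively_regular ::
  "'a set set \<Rightarrow> ('a \<Rightarrow> nat \<Rightarrow> real) \<Rightarrow> nat \<Rightarrow> 'a set set \<Rightarrow> ('a \<Rightarrow> nat \<Rightarrow> real) \<Rightarrow> ('a \<Rightarrow> real) \<Rightarrow> bool" where
  "relatively_regular \<Sigma>0 q0 N \<Sigma> q \<phi> \<longleftrightarrow>
     (\<forall>H\<in>\<Sigma>. (\<Union>x\<in>H. carrier_face \<Sigma>0 q0 (q x)) \<in> \<Sigma>0) \<and>
     (\<forall>F\<in>facets \<Sigma>. \<forall>x\<in>\<Union>\<Sigma>. x \<notin> F \<longrightarrow> (\<Union>z\<in>insert x F. carrier_face \<Sigma>0 q0 (q z)) \<in> \<Sigma>0 \<longrightarrow>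
        ell q N \<phi> F (q x) < \<phi> x)"

text \<open>The value at \<open>v\<close> is chosen slightly below the interpolation of those at
  \<open>a\<close> and \<open>b\<close>. Old strict inequalities survive a small
  \<open>\<epsilon>\<close>. Between the two parts of a split facet, equality turns into strict
  inequality because of \<open>\<epsilon>\<close>. For an old facet and the vertex \<open>v\<close>,
  interpolating the inequalities at \<open>a\<close> and \<open>b\<close> is strict, as one endpoint
  lies outside the facet. The conditions are finite in number, so one \<open>\<epsilon>\<close>
  meets all of them.\<close>

lemma relatively_regular_step:
  fixes \<Sigma> :: "'a set set"
  assumes base: "fan \<Sigma>0 q0 N" and fan: "fan \<Sigma> q N" and fan': "fan (stellar \<Sigma> {a, b} v) q' N"
    and es: "edge_subdivision \<Sigma> a b v t"
    and q': "q' = q(v := (\<lambda>i. (1 - t) * q a i + t * q b i))"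
    and rr: "relatively_regular \<Sigma>0 q0 N \<Sigma> q \<phi>"
  shows "\<exists>\<phi>'. relatively_regular \<Sigma>0 q0 N (stellar \<Sigma> {a, b} v) q' \<phi>'"
proof -
  interpret B: fan \<Sigma>0 q0 N by fact
  interpret F: fan \<Sigma> q N by fact
  interpret F': fan "stellar \<Sigma> {a, b} v" q' N by fact
  interpret edge_subdivision \<Sigma> a b v t by fact
  let ?S' = "stellar \<Sigma> {a, b} v"
  define car where "car = (\<lambda>x. carrier_face \<Sigma>0 q0 (q x))"
  define car' where "car' = (\<lambda>x. carrier_face \<Sigma>0 q0 (q' x))"
  have face: "(\<Union>x\<in>H. car x) \<in> \<Sigma>0" if "H \<in> \<Sigma>" for H
    using rr that by (simp add: relatively_regular_def car_def)
  have less: "ell q N \<phi> F (q x) < \<phi> x" if "F \<in> facets \<Sigma>" "x \<in> \<Union>\<Sigma>" "x \<notin> F" "(\<Union>z\<in>insert x F. car z) \<in> \<Sigma>0" for F x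
    by (rule bspec[OF bspec[OF conjunct2[OF rr[unfolded relatively_regular_def]] that(1)] that(2),
      THEN mp, OF that(3), THEN mp, OF that(4)[unfolded car_def]])
  have V: "a \<in> \<Union>\<Sigma>" "b \<in> \<Union>\<Sigma>" using e by auto
  have qv: "q' v = (\<lambda>i. (1 - t) * q a i + t * q b i)" using q' by simp
  have qx: "q' x = q x" if "x \<noteq> v" for x using that q' by simp
  have car_x: "car' x = car x" if "x \<noteq> v" for x using qx[OF that] by (simp add: car_def car'_def)
  have car_v: "car' v = car a \<union> car b"
    unfolding car'_def car_def qv
  proof (rule B.carrier_face_segment[OF F.q_cspace[OF V(1)] F.q_cspace[OF V(2)] t])
    show "carrier_face \<Sigma>0 q0 (q a) \<union> carrier_face \<Sigma>0 q0 (q b) \<in> \<Sigma>0" using face[OF e(1)] by (simp add: car_def)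
  qed
  have car_un: "(\<Union>z\<in>H. car' z) = (\<Union>z\<in>H - {v} \<union> {a, b}. car z)" if "v \<in> H" for H
  proof -
    have "(\<Union>z\<in>H. car' z) = car' v \<union> (\<Union>z\<in>H - {v}. car' z)" using that by blast
    also have "(\<Union>z\<in>H - {v}. car' z) = (\<Union>z\<in>H - {v}. car z)" by (rule SUP_cong[OF refl], rule car_x) blast
    finally show ?thesis unfolding car_v by auto
  qed
  have car_un': "(\<Union>z\<in>H. car' z) = (\<Union>z\<in>H. car z)" if "v \<notin> H" for H
    by (rule SUP_cong[OF refl], rule car_x) (use that in blast)
  define \<psi> where "\<psi> = (\<lambda>\<epsilon>. \<phi>(v := (1 - t) * \<phi> a + t * \<phi> b - \<epsilon>))"
  have \<psi>: "\<psi> \<epsilon> v = (1 - t) * \<phi> a + t * \<phi> b - \<epsilon>" "x \<noteq> v \<Longrightarrow> \<psi> \<epsilon> x = \<phi> x" for \<epsilon> x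
    by (auto simp: \<psi>_def)
  have old: "ell q' N (\<psi> \<epsilon>) F y = ell q N \<phi> F y"
    if F: "F \<in> facets \<Sigma>" "F \<in> facets ?S'" "v \<notin> F" for F y \<epsilon>
  proof -
    let ?c = "coord q N F y"
    have s: "supp ?c \<subseteq> F" by (rule F.co_ex(1)[OF F(1)])
    have "comb q' ?c i = comb q ?c i" for i
      unfolding comb_def by (rule sum.cong[OF refl]) (metis qx F(3) s subsetD)
    then have "comb q' ?c = comb q ?c" by (rule ext)
    then have "coord q' N F y = ?c" using F.co_ex(2)[OF F(1)] by (intro F'.co_unique[OF F(2) s]) simp
    moreover have "(\<Sum>x\<in>F. ?c x * \<psi> \<epsilon> x) = (\<Sum>x\<in>F. ?c x * \<phi> x)"
      by (rule sum.cong[OF refl]) (metis \<psi>(2) F(3))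
    ultimately show ?thesis by (simp add: ell_def)
  qed
  \<comment> \<open>The names of the endpoints are left open, so that exchanging them and replacing
    \<open>t\<close> by \<open>1 - t\<close> also covers the facets that lose
    \<open>b\<close>.\<close>
  have new: "\<forall>\<^sub>F \<epsilon> in at_right 0. ell q' N (\<psi> \<epsilon>) (insert v (G - {\<alpha>})) (q' x) < \<psi> \<epsilon> x"
    if es': "edge_subdivision \<Sigma> \<alpha> \<beta> v \<tau>" and q'': "q' = q(v := (\<lambda>i. (1 - \<tau>) * q \<alpha> i + \<tau> * q \<beta> i))"
      and \<psi>': "\<And>\<epsilon>. \<psi> \<epsilon> v = (1 - \<tau>) * \<phi> \<alpha> + \<tau> * \<phi> \<beta> - \<epsilon>" and \<alpha>\<beta>: "{\<alpha>, \<beta>} = {a, b}"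
      and G: "G \<in> facets \<Sigma>" "{\<alpha>, \<beta>} \<subseteq> G" and Fc: "insert v (G - {\<alpha>}) \<in> facets ?S'"
      and x: "x \<in> \<Union>?S'" "x \<notin> insert v (G - {\<alpha>})"
      and comp: "(\<Union>z\<in>insert x (insert v (G - {\<alpha>})). car' z) \<in> \<Sigma>0" for \<alpha> \<beta> \<tau> G x
  proof -
    interpret e2: edge_subdivision \<Sigma> \<alpha> \<beta> v \<tau> by fact
    have ell: "ell q' N (\<psi> \<epsilon>) (insert v (G - {\<alpha>})) y = ell q N \<phi> G y - \<epsilon> * (coord q N G y \<alpha> / (1 - \<tau>))" for \<epsilon> y
      by (rule ell_subdivide[OF fan fan' es' q'' G Fc \<psi>(2) \<psi>'])
    have xv: "x \<noteq> v" using x by simp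
    have q'x: "q' x = q x" by (rule qx[OF xv])
    show ?thesis
    proof (cases "x = \<alpha>")
      case True
      have \<alpha>G: "\<alpha> \<in> G" using G by simp
      have "ell q N \<phi> G (q \<alpha>) = \<phi> \<alpha>" "coord q N G (q \<alpha>) \<alpha> = 1"
        using F.ell_vertex[OF G(1) \<alpha>G] F.co_vertex[OF G(1) \<alpha>G] by simp_all
      then have "ell q' N (\<psi> \<epsilon>) (insert v (G - {\<alpha>})) (q' x) < \<psi> \<epsilon> x" if "0 < \<epsilon>" for \<epsilon>
        unfolding q'x ell \<psi>(2)[OF xv] using True that e2.t by simp
      then show ?thesis by (intro eventually_mono[OF eventually_at_right_less]) simp
    next
      case False
      then have xG: "x \<notin> G" using x by simp
      have xS: "x \<in> \<Union>\<Sigma>" using x(1) xv Union_stellar_subset[of \<Sigma> a b v] by blast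
      have vG: "v \<notin> G" using v F.facet_face[OF G(1)] by blast
      have "insert x (insert v (G - {\<alpha>})) - {v} \<union> {a, b} = insert x G"
        using G(2) \<alpha>\<beta> vG xv by blast
      then have "(\<Union>z\<in>insert x (insert v (G - {\<alpha>})). car' z) = (\<Union>z\<in>insert x G. car z)"
        using car_un[of "insert x (insert v (G - {\<alpha>}))"] by (simp only: insertI1 insertI2)
      from comp[unfolded this] have "(\<Union>z\<in>insert x G. car z) \<in> \<Sigma>0" .
      then have "ell q N \<phi> G (q x) < \<phi> x" by (rule less[OF G(1) xS xG])
      from eventually_perturb[OF this, of "- (coord q N G (q x) \<alpha> / (1 - \<tau>))"]
      show ?thesis unfolding q'x ell \<psi>(2)[OF xv] by simp
    qed
  qed
  have "\<forall>\<^sub>F \<epsilon> in at_right 0. \<forall>(F, x)\<in>{(F, x). F \<in> facets ?S' \<and> x \<in> \<Union>?S' \<and> x \<notin> F \<and> (\<Union>z\<in>insert x F. car' z) \<in> \<Sigma>0}.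
     ell q' N (\<psi> \<epsilon>) F (q' x) < \<psi> \<epsilon> x"
  proof (rule eventually_ball_finite)
    have "finite ?S'" "finite (\<Union>?S')" using F'.cx complex_Union_finite by (auto simp: simplicial_complex_def)
    then have "finite (?S' \<times> \<Union>?S')" by (rule finite_cartesian_product)
    moreover have "{(F, x). F \<in> facets ?S' \<and> x \<in> \<Union>?S' \<and> x \<notin> F \<and> (\<Union>z\<in>insert x F. car' z) \<in> \<Sigma>0} \<subseteq> ?S' \<times> \<Union>?S'"
    proof (rule subrelI, unfold mem_Collect_eq case_prod_conv, elim conjE)
      fix F x assume "F \<in> facets ?S'" "x \<in> \<Union>?S'"
      then show "(F, x) \<in> ?S' \<times> \<Union>?S'" by (intro SigmaI F'.facet_face)
    qed
    ultimately show "finite {(F, x). F \<in> facets ?S' \<and> x \<in> \<Union>?S' \<and> x \<notin> F \<and> (\<Union>z\<in>insert x F. car' z) \<in> \<Sigma>0}"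
      by (rule finite_subset[rotated])
  next
    show "\<forall>p\<in>{(F, x). F \<in> facets ?S' \<and> x \<in> \<Union>?S' \<and> x \<notin> F \<and> (\<Union>z\<in>insert x F. car' z) \<in> \<Sigma>0}.
      \<forall>\<^sub>F \<epsilon> in at_right 0. case p of (F, x) \<Rightarrow> ell q' N (\<psi> \<epsilon>) F (q' x) < \<psi> \<epsilon> x"
    proof (intro ballI, elim CollectE case_prodE conjE)
      fix p F x assume p: "p = (F, x)" and F: "F \<in> facets ?S'" and xU: "x \<in> \<Union>?S'" and x: "x \<notin> F"
        and comp: "(\<Union>z\<in>insert x F. car' z) \<in> \<Sigma>0"
      have goal: "\<forall>\<^sub>F \<epsilon> in at_right 0. ell q' N (\<psi> \<epsilon>) F (q' x) < \<psi> \<epsilon> x"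
      proof (rule facets_stellar[OF cx e v F])
        fix G assume G: "G \<in> facets \<Sigma>" "{a, b} \<subseteq> G" "F = insert v (G - {a})"
        show ?thesis unfolding G(3)
          by (rule new[OF es q' \<psi>(1) refl G(1,2)]) (use F x xU comp G(3) in auto)
      next
        fix G assume G: "G \<in> facets \<Sigma>" "{a, b} \<subseteq> G" "F = insert v (G - {b})"
        have es2: "edge_subdivision \<Sigma> b a v (1 - t)"
          using cx e v t by unfold_locales (auto simp: insert_commute)
        show ?thesis unfolding G(3)
          by (rule new[OF es2 _ _ insert_commute G(1)]) (use F x xU comp G q' \<psi>(1) in \<open>auto simp: add.commute\<close>)
      next
        assume F1: "v \<notin> F" "F \<in> facets \<Sigma>" "\<not> {a, b} \<subseteq> F"
        show ?thesis
        proof (cases "x = v")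
          case False
          have xS: "x \<in> \<Union>\<Sigma>" using xU False Union_stellar_subset[of \<Sigma> a b v] by blast
          have "(\<Union>z\<in>insert x F. car z) \<in> \<Sigma>0" using comp car_un'[of "insert x F"] F1(1) False by simp
          then have "ell q N \<phi> F (q x) < \<phi> x" by (rule less[OF F1(2) xS x])
          then have "ell q' N (\<psi> \<epsilon>) F (q' x) < \<psi> \<epsilon> x" for \<epsilon>
            unfolding old[OF F1(2) F F1(1)] qx[OF False] \<psi>(2)[OF False] .
          then show ?thesis by simp
        next
          case True
          have "(\<Union>z\<in>insert x F. car' z) = (\<Union>z\<in>insert x F - {v} \<union> {a, b}. car z)" by (rule car_un) (simp add: True)
          from comp[unfolded this] have un: "(\<Union>z\<in>insert x F - {v} \<union> {a, b}. car z) \<in> \<Sigma>0" .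
          have le: "ell q N \<phi> F (q y) \<le> \<phi> y \<and> (y \<notin> F \<longrightarrow> ell q N \<phi> F (q y) < \<phi> y)" if y: "y \<in> {a, b}" for y
          proof (cases "y \<in> F")
            case True
            then show ?thesis using F.ell_vertex[OF F1(2)] by simp
          next
            case False
            have "(\<Union>z\<in>insert y F. car z) \<in> \<Sigma>0"
              by (rule complex_mem[OF B.cx un], rule UN_mono) (use y F1(1) True in auto)
            moreover have "y \<in> \<Union>\<Sigma>" using y V by auto
            ultimately show ?thesis using less[OF F1(2) _ False] by force
          qed
          have "(1 - t) * ell q N \<phi> F (q a) + t * ell q N \<phi> F (q b) < (1 - t) * \<phi> a + t * \<phi> b"
          proof -
            have l: "ell q N \<phi> F (q a) \<le> \<phi> a" "ell q N \<phi> F (q b) \<le> \<phi> b" using le by simp_all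
            have m: "(1 - t) * ell q N \<phi> F (q a) \<le> (1 - t) * \<phi> a" "t * ell q N \<phi> F (q b) \<le> t * \<phi> b"
              using l t by (simp_all add: mult_left_mono)
            consider "a \<notin> F" | "b \<notin> F" using F1(3) by blast
            then show ?thesis
            proof cases
              case 1
              then have "(1 - t) * ell q N \<phi> F (q a) < (1 - t) * \<phi> a" using le[of a] t by simp
              then show ?thesis using m by linarith
            next
              case 2
              then have "t * ell q N \<phi> F (q b) < t * \<phi> b" using le[of b] t by simp
              then show ?thesis using m by linarith
            qed
          qed
          moreover have "ell q N \<phi> F (q' v) = (1 - t) * ell q N \<phi> F (q a) + t * ell q N \<phi> F (q b)"
            unfolding qv by (rule linD[OF F.ell_lin[OF F1(2)]])
          ultimately have "ell q N \<phi> F (q' v) < (1 - t) * \<phi> a + t * \<phi> b" by simp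
          from eventually_perturb[OF this, of 1] show ?thesis
            unfolding True old[OF F1(2) F F1(1)] \<psi>(1) by (simp add: less_diff_eq)
        qed
      qed
      then show "\<forall>\<^sub>F \<epsilon> in at_right 0. case p of (F, x) \<Rightarrow> ell q' N (\<psi> \<epsilon>) F (q' x) < \<psi> \<epsilon> x"
        unfolding p case_prod_conv .
    qed
  qed
  then obtain \<epsilon> where \<epsilon>: "\<forall>(F, x)\<in>{(F, x). F \<in> facets ?S' \<and> x \<in> \<Union>?S' \<and> x \<notin> F \<and> (\<Union>z\<in>insert x F. car' z) \<in> \<Sigma>0}.
     ell q' N (\<psi> \<epsilon>) F (q' x) < \<psi> \<epsilon> x"
    using eventually_happens'[OF trivial_limit_at_right_real] by blast
  have "relatively_regular \<Sigma>0 q0 N ?S' q' (\<psi> \<epsilon>)"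
    unfolding relatively_regular_def
  proof (intro conjI ballI impI)
    fix H assume H: "H \<in> ?S'"
    have "(\<Union>x\<in>H. car' x) \<in> \<Sigma>0"
    proof (cases "v \<in> H")
      case True
      then have "H - {v} \<union> {a, b} \<in> \<Sigma>" using H by (simp add: stellar_def)
      then show ?thesis unfolding car_un[OF True] by (rule face)
    next
      case False
      then have "H \<in> \<Sigma>" using H by (simp add: stellar_def)
      then show ?thesis unfolding car_un'[OF False] by (rule face)
    qed
    then show "(\<Union>x\<in>H. carrier_face \<Sigma>0 q0 (q' x)) \<in> \<Sigma>0" by (simp add: car'_def)
  next
    fix F x assume F: "F \<in> facets ?S'" "x \<in> \<Union>?S'" "x \<notin> F" "(\<Union>z\<in>insert x F. carrier_face \<Sigma>0 q0 (q' z)) \<in> \<Sigma>0"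
    then have "(F, x) \<in> {(F, x). F \<in> facets ?S' \<and> x \<in> \<Union>?S' \<and> x \<notin> F \<and> (\<Union>z\<in>insert x F. car' z) \<in> \<Sigma>0}"
      by (simp add: car'_def)
    from bspec[OF \<epsilon> this] show "ell q' N (\<psi> \<epsilon>) F (q' x) < \<psi> \<epsilon> x" by simp
  qed
  then show ?thesis by blast
qed

lemma edge_subdivided_relatively_regular:
  assumes "edge_subdivided \<Sigma>0 q0 \<Sigma> q" and base: "fan \<Sigma>0 q0 N"
  shows "\<exists>\<phi>. relatively_regular \<Sigma>0 q0 N \<Sigma> q \<phi>"
  using assms(1)
proof (induction rule: edge_subdivided.induct)
  case edge_subdivided_refl
  interpret fan \<Sigma>0 q0 N by fact
  have car: "(\<Union>x\<in>H. carrier_face \<Sigma>0 q0 (q0 x)) = H" if "H \<subseteq> \<Union>\<Sigma>0" for H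
  proof -
    have "(\<Union>x\<in>H. carrier_face \<Sigma>0 q0 (q0 x)) = (\<Union>x\<in>H. {x})"
      by (rule SUP_cong[OF refl], rule carrier_face_vertex) (use that in blast)
    then show ?thesis by simp
  qed
  \<comment> \<open>The zero function will do: a facet of the coarse fan and a vertex outside it
    never lie in a common cone.\<close>
  have "relatively_regular \<Sigma>0 q0 N \<Sigma>0 q0 (\<lambda>_. 0)"
    unfolding relatively_regular_def
  proof (intro conjI ballI impI)
    fix H assume H: "H \<in> \<Sigma>0"
    then have "H \<subseteq> \<Union>\<Sigma>0" by blast
    then show "(\<Union>x\<in>H. carrier_face \<Sigma>0 q0 (q0 x)) \<in> \<Sigma>0" using car[of H] H by simp
  next
    fix F x assume F: "F \<in> facets \<Sigma>0" "x \<in> \<Union>\<Sigma>0" "x \<notin> F" "(\<Union>z\<in>insert x F. carrier_face \<Sigma>0 q0 (q0 z)) \<in> \<Sigma>0"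
    have "insert x F \<subseteq> \<Union>\<Sigma>0" using F(2) facet_face[OF F(1)] by blast
    then have "insert x F \<in> \<Sigma>0" using F(4) car[of "insert x F"] by simp
    then have "insert x F = F" by (rule facet_eq[OF F(1)]) blast
    then show "ell q0 N (\<lambda>_. 0) F (q0 x) < 0" using F(3) by blast
  qed
  then show ?case by blast
next
  case (edge_subdivided_step \<Sigma> q a b v t)
  interpret B: fan \<Sigma>0 q0 N by fact
  have es: "edge_subdivision \<Sigma> a b v t"
    using edge_subdivided_complex[OF edge_subdivided_step(1) B.cx] edge_subdivided_step by unfold_locales auto
  let ?q = "q(v := (\<lambda>i. (1 - t) * q a i + t * q b i))"
  have f: "fan \<Sigma> q N"
    by unfold_locales (rule edge_subdivided_complex[OF edge_subdivided_step(1) B.cx], rule edge_subdivided_bij[OF edge_subdivided_step(1) B.cx B.bij])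
  have e: "edge_subdivided \<Sigma>0 q0 (stellar \<Sigma> {a, b} v) ?q" by (rule edge_subdivided.edge_subdivided_step) fact+
  have f': "fan (stellar \<Sigma> {a, b} v) ?q N"
    by unfold_locales (rule edge_subdivided_complex[OF e B.cx], rule edge_subdivided_bij[OF e B.cx B.bij])
  from edge_subdivided_step.IH obtain \<phi> where "relatively_regular \<Sigma>0 q0 N \<Sigma> q \<phi>" by blast
  from relatively_regular_step[OF base f f' es refl this] show ?case .
qed

text \<open>The function \<open>\<Sum>L\<in>\<Lambda>. \<bar>L y\<bar>\<close> is linear exactly on the cells of a hyperplane arrangement that
  refines \<open>\<Sigma>0\<close>. A large multiple of it makes the relatively convex \<open>\<phi>\<close> strictly convex.\<close>

lemma fan_good_subdivision:
  fixes \<Sigma>0 :: "'a set set"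
  assumes inf: "infinite (UNIV :: 'a set)" and base: "fan \<Sigma>0 q0 N"
  shows "\<exists>\<Sigma> q. edge_subdivided \<Sigma>0 q0 \<Sigma> q \<and> good \<Sigma> \<and> pure N \<Sigma>"
proof -
  interpret B: fan \<Sigma>0 q0 N by fact
  \<comment> \<open>Each functional is the coordinate of a facet at one vertex; its zero set in
    \<open>cspace N\<close> is the hyperplane spanned by the opposite wall.\<close>
  define \<Lambda> where "\<Lambda> = (\<lambda>(F, x) y. coord q0 N F y x) ` (SIGMA F:facets \<Sigma>0. F)"
  have "finite (facets \<Sigma>0)" using B.cx by (simp add: facets_def simplicial_complex_def)
  then have fin: "finite \<Lambda>"
    unfolding \<Lambda>_def using B.face_finite[OF B.facet_face] by (intro finite_imageI finite_SigmaI)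
  have lin: "lin L" if "L \<in> \<Lambda>" for L using that B.co_lin by (auto simp: \<Lambda>_def)
  have "\<exists>\<Sigma> q. edge_subdivided \<Sigma>0 q0 \<Sigma> q \<and> (\<forall>L\<in>\<Lambda>. coherent \<Sigma> q L)" by (rule slice[OF inf B.cx fin lin])
  then obtain \<Sigma> q where e: "edge_subdivided \<Sigma>0 q0 \<Sigma> q" and coh: "\<forall>L\<in>\<Lambda>. coherent \<Sigma> q L"
    by (elim exE conjE) (rule that)
  obtain \<phi> where rr: "relatively_regular \<Sigma>0 q0 N \<Sigma> q \<phi>" using edge_subdivided_relatively_regular[OF e base] by (elim exE) (rule that)
  interpret F: fan \<Sigma> q N
    by unfold_locales (rule edge_subdivided_complex[OF e B.cx], rule edge_subdivided_bij[OF e B.cx B.bij])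
  define car where "car = (\<lambda>x. carrier_face \<Sigma>0 q0 (q x))"
  have face: "(\<Union>x\<in>H. car x) \<in> \<Sigma>0" if "H \<in> \<Sigma>" for H
    using rr that by (simp add: relatively_regular_def car_def)
  have less: "ell q N \<phi> F (q x) < \<phi> x" if "F \<in> facets \<Sigma>" "x \<in> \<Union>\<Sigma>" "x \<notin> F" "(\<Union>z\<in>insert x F. car z) \<in> \<Sigma>0" for F x
    by (rule bspec[OF bspec[OF conjunct2[OF rr[unfolded relatively_regular_def]] that(1)] that(2),
      THEN mp, OF that(3), THEN mp, OF that(4)[unfolded car_def]])
  define g where "g = (\<lambda>y. \<Sum>L\<in>\<Lambda>. \<bar>L y\<bar>)"
  define w where "w = (\<lambda>M x. M * g (q x) + \<phi> x)"
  have ell_w: "ell q N (w M) F y = M * ell q N (\<lambda>x. g (q x)) F y + ell q N \<phi> F y" for M F y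
    unfolding ell_def w_def by (simp add: sum.distrib sum_distrib_left algebra_simps)
  have key: "\<forall>\<^sub>F M in at_top. ell q N (w M) F (q x) < w M x"
    if F: "F \<in> facets \<Sigma>" and x: "x \<in> \<Union>\<Sigma>" "x \<notin> F" for F x
  proof -
    have FS: "F \<in> \<Sigma>" by (rule F.facet_face[OF F])
    \<comment> \<open>With the sign \<open>s L\<close> of \<open>L\<close> on \<open>F\<close>, the
      function \<open>g\<close> agrees at the vertices of \<open>F\<close> with the sum of all
      \<open>s L * L\<close>, a linear function that nowhere exceeds \<open>g\<close>.\<close>
    have "\<forall>L\<in>\<Lambda>. \<exists>s. (s = 1 \<or> s = -1) \<and> (\<forall>z\<in>F. \<bar>L (q z)\<bar> = s * L (q z))"
    proof
      fix L assume L: "L \<in> \<Lambda>"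
      from coherent_face[OF bspec[OF coh L] F.cx FS]
      show "\<exists>s. (s = 1 \<or> s = -1) \<and> (\<forall>z\<in>F. \<bar>L (q z)\<bar> = s * L (q z))"
      proof
        assume "\<forall>z\<in>F. 0 \<le> L (q z)"
        then show ?thesis by (intro exI[of _ 1]) simp
      next
        assume "\<forall>z\<in>F. L (q z) \<le> 0"
        then show ?thesis by (intro exI[of _ "-1"]) simp
      qed
    qed
    from bchoice[OF this] obtain s where s: "\<forall>L\<in>\<Lambda>. (s L = 1 \<or> s L = -1) \<and> (\<forall>z\<in>F. \<bar>L (q z)\<bar> = s L * L (q z))"
      by (elim exE) (rule that)
    have qW: "q x \<in> cspace N" by (rule F.q_cspace[OF x(1)])
    have "ell q N (\<lambda>x. g (q x)) F (q x) = (\<Sum>L\<in>\<Lambda>. \<Sum>z\<in>F. coord q N F (q x) z * \<bar>L (q z)\<bar>)"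
      unfolding ell_def g_def sum_distrib_left by (rule sum.swap)
    also have "\<dots> = (\<Sum>L\<in>\<Lambda>. s L * L (q x))"
    proof (rule sum.cong[OF refl])
      fix L assume L: "L \<in> \<Lambda>"
      have "(\<Sum>z\<in>F. coord q N F (q x) z * \<bar>L (q z)\<bar>) = (\<Sum>z\<in>F. s L * (coord q N F (q x) z * L (q z)))"
        using s L by (intro sum.cong[OF refl]) simp
      also have "\<dots> = s L * L (q x)"
        unfolding sum_distrib_left[symmetric] using F.lin_expand[OF lin[OF L] F qW] by simp
      finally show "(\<Sum>z\<in>F. coord q N F (q x) z * \<bar>L (q z)\<bar>) = s L * L (q x)" .
    qed
    finally have G: "ell q N (\<lambda>x. g (q x)) F (q x) = (\<Sum>L\<in>\<Lambda>. s L * L (q x))" .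
    have le: "s L * L (q x) \<le> \<bar>L (q x)\<bar>" if "L \<in> \<Lambda>" for L
      using bspec[OF s that] by (elim conjE disjE) auto
    show ?thesis
    proof (cases "ell q N (\<lambda>x. g (q x)) F (q x) < g (q x)")
      case True
      let ?d = "g (q x) - ell q N (\<lambda>x. g (q x)) F (q x)"
      have d: "?d > 0" using True by simp
      have "\<forall>\<^sub>F M in at_top. (ell q N \<phi> F (q x) - \<phi> x) / ?d < M" by (rule eventually_gt_at_top)
      then show ?thesis
      proof (rule eventually_mono)
        fix M assume "(ell q N \<phi> F (q x) - \<phi> x) / ?d < M"
        then have "ell q N \<phi> F (q x) - \<phi> x < M * ?d" using d by (simp add: pos_divide_less_eq)
        then show "ell q N (w M) F (q x) < w M x" unfolding ell_w by (simp add: w_def algebra_simps)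
      qed
    next
      case False
      \<comment> \<open>In the case of equality every \<open>L\<close> has absolute value
        \<open>s L * L\<close> at \<open>q x\<close> too. This will place \<open>q x\<close> in the
        coarse cone that contains \<open>F\<close>, where \<open>\<phi>\<close> provides the strict
        inequality.\<close>
      have "(\<Sum>L\<in>\<Lambda>. \<bar>L (q x)\<bar> - s L * L (q x)) = 0"
      proof (rule antisym)
        show "(\<Sum>L\<in>\<Lambda>. \<bar>L (q x)\<bar> - s L * L (q x)) \<le> 0"
          using False G by (simp add: sum_subtractf g_def)
        show "0 \<le> (\<Sum>L\<in>\<Lambda>. \<bar>L (q x)\<bar> - s L * L (q x))" by (rule sum_nonneg) (use le in simp)
      qed
      then have eq: "\<forall>L\<in>\<Lambda>. \<bar>L (q x)\<bar> - s L * L (q x) = 0"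
        using sum_nonneg_eq_0_iff[OF fin, of "\<lambda>L. \<bar>L (q x)\<bar> - s L * L (q x)"] le by simp
      have "g (q x) = (\<Sum>L\<in>\<Lambda>. s L * L (q x))" unfolding g_def by (rule sum.cong[OF refl]) (use eq in simp)
      then have geq: "g (q x) = ell q N (\<lambda>x. g (q x)) F (q x)" using G by simp
      obtain F1 where F1: "F1 \<in> facets \<Sigma>0" "(\<Union>z\<in>F. car z) \<subseteq> F1" using facets_ex[OF B.cx face[OF FS]] by blast
      have "0 \<le> coord q0 N F1 (q x) y" for y
      proof (cases "y \<in> F1")
        case False
        then show ?thesis using B.co_out[OF F1(1)] by simp
      next
        case True
        define L where "L = (\<lambda>u. coord q0 N F1 u y)"
        have LL: "L \<in> \<Lambda>" unfolding \<Lambda>_def L_def by (rule image_eqI[of _ _ "(F1, y)"]) (use F1 True in auto)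
        have nn: "0 \<le> L (q z)" if z: "z \<in> F" for z
        proof -
          have zW: "q z \<in> cspace N" by (rule F.q_cspace) (use z FS in blast)
          have "carrier_face \<Sigma>0 q0 (q z) \<subseteq> F1" using F1(2) z by (auto simp: car_def)
          from B.co_rep[OF F1(1) zW this] have "L (q z) = B.rep (q z) y" by (simp add: L_def)
          then show ?thesis using B.rep(1)[OF zW] by (simp add: cone_of_def)
        qed
        have yW: "q0 y \<in> cspace N" by (rule B.q_cspace) (use True B.facet_face[OF F1(1)] in blast)
        \<comment> \<open>The vertices of \<open>F\<close> span the space, so \<open>L\<close> does
          not vanish at all of them; being nonnegative there, it must have the sign
          \<open>s L = 1\<close>.\<close>
        have "L (q0 y) = 1" using B.co_vertex[OF F1(1) True] by (simp add: L_def)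
        moreover have "L (q0 y) = (\<Sum>z\<in>F. coord q N F (q0 y) z * L (q z))"
          by (rule F.lin_expand[OF lin[OF LL] F yW])
        ultimately have "\<exists>z\<in>F. L (q z) \<noteq> 0" by (metis (no_types, lifting) mult_zero_right sum.neutral zero_neq_one)
        then obtain z where z: "z \<in> F" "L (q z) \<noteq> 0" by (rule bexE)
        then have "L (q z) > 0" using nn[OF z(1)] by simp
        moreover have "\<bar>L (q z)\<bar> = s L * L (q z)" "s L = 1 \<or> s L = -1" using bspec[OF s LL] z(1) by auto
        ultimately have "s L = 1" by auto
        then have "\<bar>L (q x)\<bar> = L (q x)" using bspec[OF eq LL] by simp
        then show ?thesis by (simp add: L_def)
      qed
      then have cone: "coord q0 N F1 (q x) \<in> cone_of \<Sigma>0"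
        by (rule B.cone_subset[OF B.facet_face[OF F1(1)] B.co_ex(1)[OF F1(1)]])
      have "B.rep (q x) = coord q0 N F1 (q x)"
        by (rule B.rep_unique[OF cone B.co_cspace[OF F1(1) qW]])
      then have "car x \<subseteq> F1" using B.co_ex(1)[OF F1(1)] by (simp add: car_def carrier_face_def)
      then have "(\<Union>z\<in>insert x F. car z) \<subseteq> F1" using F1(2) by simp
      then have "(\<Union>z\<in>insert x F. car z) \<in> \<Sigma>0" by (rule complex_mem[OF B.cx B.facet_face[OF F1(1)]])
      from less[OF F x this] have "ell q N (w M) F (q x) < w M x" for M
        unfolding ell_w using geq by (simp add: w_def)
      then show ?thesis by simp
    qed
  qed
  have "\<forall>\<^sub>F M in at_top. \<forall>(F, x)\<in>{(F, x). F \<in> facets \<Sigma> \<and> x \<in> \<Union>\<Sigma> \<and> x \<notin> F}. ell q N (w M) F (q x) < w M x"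
  proof (rule eventually_ball_finite)
    have "finite \<Sigma>" "finite (\<Union>\<Sigma>)" using F.cx complex_Union_finite by (auto simp: simplicial_complex_def)
    then have "finite (\<Sigma> \<times> \<Union>\<Sigma>)" by (rule finite_cartesian_product)
    moreover have "{(F, x). F \<in> facets \<Sigma> \<and> x \<in> \<Union>\<Sigma> \<and> x \<notin> F} \<subseteq> \<Sigma> \<times> \<Union>\<Sigma>"
    proof (rule subrelI, unfold mem_Collect_eq case_prod_conv, elim conjE)
      fix F x assume "F \<in> facets \<Sigma>" "x \<in> \<Union>\<Sigma>"
      then show "(F, x) \<in> \<Sigma> \<times> \<Union>\<Sigma>" by (intro SigmaI F.facet_face)
    qed
    ultimately show "finite {(F, x). F \<in> facets \<Sigma> \<and> x \<in> \<Union>\<Sigma> \<and> x \<notin> F}"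
      by (rule finite_subset[rotated])
    show "\<forall>p\<in>{(F, x). F \<in> facets \<Sigma> \<and> x \<in> \<Union>\<Sigma> \<and> x \<notin> F}.
      \<forall>\<^sub>F M in at_top. case p of (F, x) \<Rightarrow> ell q N (w M) F (q x) < w M x"
    proof (intro ballI, elim CollectE case_prodE conjE)
      fix p F x assume p: "p = (F, x)" and Fx: "F \<in> facets \<Sigma>" "x \<in> \<Union>\<Sigma>" "x \<notin> F"
      show "\<forall>\<^sub>F M in at_top. case p of (F, x) \<Rightarrow> ell q N (w M) F (q x) < w M x"
        unfolding p case_prod_conv by (rule key[OF Fx])
    qed
  qed
  then obtain M where M: "\<forall>(F, x)\<in>{(F, x). F \<in> facets \<Sigma> \<and> x \<in> \<Union>\<Sigma> \<and> x \<notin> F}. ell q N (w M) F (q x) < w M x"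
    using eventually_happens'[OF trivial_limit_at_top_linorder] by blast
  have "good \<Sigma>"
  proof (rule F.regular_good[OF inf])
    fix F x assume "F \<in> facets \<Sigma>" "x \<in> \<Union>\<Sigma>" "x \<notin> F"
    then have "(F, x) \<in> {(F, x). F \<in> facets \<Sigma> \<and> x \<in> \<Union>\<Sigma> \<and> x \<notin> F}" by simp
    from bspec[OF M this] show "ell q N (w M) F (q x) < w M x" by simp
  qed
  then show ?thesis using e F.pure by blast
qed

section \<open>From combinatorial spheres to coloured flips\<close>

text \<open>The cone over the boundary of the simplex consists of the nonnegative vectors on
  \<open>{0..N}\<close> with at least one zero coordinate. It meets every line in the direction of
  the all-ones vector exactly once. Subtracting the last coordinate from the others removes that
  direction, so it maps the cone bijectively onto \<open>cspace N\<close>.\<close>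

lemma simplex_boundary_fan:
  assumes "bij_betw (comb q) (cone_of \<Sigma>) (cone_of (simplex_boundary {0..N}))"
    and cx: "simplicial_complex \<Sigma>"
  shows "fan \<Sigma> (\<lambda>x i. if i < N then q x i - q x N else 0) N"
proof
  show "simplicial_complex \<Sigma>" by fact
  let ?pi = "\<lambda>y i. if i < N then y i - y N else (0::real)"
  let ?Y = "cone_of (simplex_boundary {0..N})"
  have Y: "y \<in> ?Y \<longleftrightarrow> (\<forall>i. 0 \<le> y i) \<and> (\<forall>i>N. y i = 0) \<and> (\<exists>i\<le>N. y i = 0)" for y
  proof -
    have "supp y \<subseteq> {0..N} \<longleftrightarrow> (\<forall>i. y i \<noteq> 0 \<longrightarrow> i \<le> N)" by (simp add: supp_def subset_iff)
    also have "\<dots> \<longleftrightarrow> (\<forall>i>N. y i = 0)" by (metis leD leI)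
    finally have 1: "supp y \<subseteq> {0..N} \<longleftrightarrow> (\<forall>i>N. y i = 0)" .
    have "{0..N} \<subseteq> supp y \<longleftrightarrow> (\<forall>i\<le>N. y i \<noteq> 0)" by (simp add: supp_def subset_iff)
    then have 2: "\<not> {0..N} \<subseteq> supp y \<longleftrightarrow> (\<exists>i\<le>N. y i = 0)" by blast
    show ?thesis
      unfolding cone_of_def simplex_boundary_def mem_Collect_eq psubset_eq using 1 2 by (metis set_eq_subset)
  qed
  have "bij_betw ?pi ?Y (cspace N)"
  proof (rule bij_betw_imageI)
    show "inj_on ?pi ?Y"
    proof (rule inj_onI)
      fix y z assume y: "y \<in> ?Y" and z: "z \<in> ?Y" and eq: "?pi y = ?pi z"
      define k where "k = y N - z N"
      have d: "y i - z i = k" if "i \<le> N" for i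
        using fun_cong[OF eq, of i] that by (cases "i = N") (auto simp: k_def split: if_splits)
      obtain i j where i: "i \<le> N" "y i = 0" and j: "j \<le> N" "z j = 0" using y z Y by blast
      have "k \<le> 0" using d[OF i(1)] i(2) z Y by (metis diff_0 neg_le_0_iff_le)
      moreover have "0 \<le> k" using d[OF j(1)] j(2) y Y by (metis diff_zero)
      ultimately have "k = 0" by simp
      show "y = z"
      proof
        fix i show "y i = z i" using d[of i] \<open>k = 0\<close> y z Y by (cases "i \<le> N") auto
      qed
    qed
    show "?pi ` ?Y = cspace N"
    proof
      show "?pi ` ?Y \<subseteq> cspace N" by (auto simp: cspace_def)
      show "cspace N \<subseteq> ?pi ` ?Y"
      proof
        fix u :: "nat \<Rightarrow> real" assume u: "u \<in> cspace N"
        \<comment> \<open>Subtracting the minimum makes all coordinates nonnegative and one of them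
          zero. The index \<open>N\<close>, at which \<open>u\<close> is zero, has to be included
          because it becomes a coordinate of the preimage.\<close>
        define m where "m = Min (u ` {..N})"
        have fin: "finite (u ` {..N})" "u ` {..N} \<noteq> {}" by auto
        have mle: "m \<le> u i" if "i \<le> N" for i unfolding m_def by (rule Min_le[OF fin(1)]) (use that in simp)
        have "m \<in> u ` {..N}" unfolding m_def by (rule Min_in[OF fin])
        then obtain i where i: "i \<le> N" "u i = m" by auto
        let ?y = "\<lambda>i. if i \<le> N then u i - m else 0"
        have "?y \<in> ?Y" unfolding Y using mle i by auto
        moreover have "u = ?pi ?y" using u by (auto simp: cspace_def fun_eq_iff not_less)
        ultimately show "u \<in> ?pi ` ?Y" by (intro image_eqI[of _ ?pi ?y])
      qed
    qed
  qed
  with assms(1) have "bij_betw (?pi \<circ> comb q) (cone_of \<Sigma>) (cspace N)" by (rule bij_betw_trans)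
  moreover have "(?pi \<circ> comb q) c = comb (\<lambda>x i. if i < N then q x i - q x N else 0) c" for c
    by (auto simp: comb_def fun_eq_iff sum_subtractf algebra_simps)
  ultimately show "bij_betw (comb (\<lambda>x i. if i < N then q x i - q x N else 0)) (cone_of \<Sigma>) (cspace N)"
    by (simp add: bij_betw_cong[of _ "?pi \<circ> comb q" "comb (\<lambda>x i. if i < N then q x i - q x N else 0)"])
qed

theorem combinatorial_sphere_good_pure:
  fixes \<Delta> :: "'a set set"
  assumes inf: "infinite (UNIV :: 'a set)" and s: "combinatorial_sphere d \<Delta>"
  shows "simplicial_complex \<Delta>" "{} \<in> \<Delta>" "good \<Delta>" "pure (Suc d) \<Delta>"
proof -
  let ?G = "simplex_boundary {0..d + 1}"
  show cx: "simplicial_complex \<Delta>" using s by (simp add: combinatorial_sphere_def)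
  have cxG: "simplicial_complex ?G"
  proof -
    have "?G \<subseteq> Pow {0..d + 1}" by (auto simp: simplex_boundary_def)
    then have "finite ?G" by (rule finite_subset) simp
    then show ?thesis unfolding simplicial_complex_def simplex_boundary_def by auto
  qed
  have eG: "{} \<in> ?G" by (auto simp: simplex_boundary_def)
  obtain f g where fg: "homeomorphism (realization \<Delta>) (realization ?G) f g" "pl_map_on (realization \<Delta>) f"
    using s unfolding combinatorial_sphere_def pl_homeomorphic_def by blast
  have f: "bij_betw f (realization \<Delta>) (realization ?G)"
    using fg(1) unfolding homeomorphism_def by (auto intro!: bij_betw_byWitness[where f' = g])
  \<comment> \<open>A point of the target shows that \<open>\<Delta>\<close> has a face and hence
    contains the empty face.\<close>
  have "(\<lambda>i. if i = 0 then 1 else 0) \<in> realization ?G"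
  proof -
    have "{0} \<subset> {0..d + 1}"
    proof (rule psubsetI)
      have "1 \<in> {0..d + 1}" "1 \<notin> {0::nat}" by simp_all
      then show "{0} \<noteq> {0..d + 1}" by metis
    qed simp
    then have "{0} \<in> ?G" by (simp only: simplex_boundary_def mem_Collect_eq)
    then show ?thesis unfolding realization_def by (intro CollectI bexI[of _ "{0}"]) simp_all
  qed
  then have "realization \<Delta> \<noteq> {}" using f by (auto simp: bij_betw_def)
  then obtain F where "F \<in> \<Delta>" by (auto simp: realization_def)
  then show e: "{} \<in> \<Delta>" using complex_mem[OF cx] by blast
  from pl_homeo_subdivision[OF inf cx e cxG eG f fg(2)] obtain \<Sigma> p
    where 1: "edge_subdivided \<Delta> (\<lambda>x i. if i = x then 1 else 0) \<Sigma> p"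
      "bij_betw (comb (\<lambda>x. f (p x))) (cone_of \<Sigma>) (cone_of ?G)" by (elim exE conjE) (rule that)
  have cxS: "simplicial_complex \<Sigma>" by (rule edge_subdivided_complex[OF 1(1) cx])
  \<comment> \<open>The second chain of subdivisions starts from the images of the vertices, not
    from the positions \<open>p\<close>. This is harmless, since \<open>good\<close> and
    \<open>pure\<close> are carried back along the complexes alone.\<close>
  from fan_good_subdivision[OF inf simplex_boundary_fan[OF 1(2) cxS]] obtain \<Sigma>2 q2
    where 2: "edge_subdivided \<Sigma> (\<lambda>x i. if i < d + 1 then f (p x) i - f (p x) (d + 1) else 0) \<Sigma>2 q2" "good \<Sigma>2" "pure (d + 1) \<Sigma>2"
    by (elim exE conjE) (rule that)
  show "good \<Delta>" by (rule edge_subdivided_good[OF 1(1) inf cx edge_subdivided_good[OF 2(1) inf cxS 2(2)]])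
  show "pure (Suc d) \<Delta>" using edge_subdivided_pure[OF 1(1) cx edge_subdivided_pure[OF 2(1) cxS 2(3)]] by simp
qed

theorem theorem3p3:
  fixes \<Delta> :: "'a set set" and \<kappa> :: "'a \<Rightarrow> nat" and d m :: nat
  assumes "infinite (UNIV :: 'a set)"
    and "m \<ge> d + 2"
    and "combinatorial_sphere d \<Delta>"
    and "proper_coloring m \<Delta> \<kappa>"
  shows "\<exists>n (Ds :: nat \<Rightarrow> 'a set set) (ks :: nat \<Rightarrow> 'a \<Rightarrow> nat).
           Ds 0 = \<Delta> \<and>
           (\<forall>i<n. bistellar_flip (Ds i) (Ds (Suc i))) \<and>
           (\<exists>F. finite F \<and> card F = d + 2 \<and> Ds n = simplex_boundary F) \<and>
           (\<forall>i\<le>n. proper_coloring m (Ds i) (ks i)) \<and>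
           (\<forall>v\<in>vertices \<Delta>. ks 0 v = \<kappa> v) \<and>
           (\<forall>i<n. \<forall>v\<in>vertices (Ds i) \<inter> vertices (Ds (Suc i)). ks i v = ks (Suc i) v)"
proof -
  note sphere = combinatorial_sphere_good_pure[OF assms(1,3)]
  show ?thesis by (rule good_colored_flips[OF assms(1,2) sphere assms(4)])
qed

end
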